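(* Let $\theta\in(0,1)$, let $0\in V$ be a fixed vertex, and let $c_*:=8c_G^{2/d}$. Suppose there exist constants $R_0\ge1$, $c_0\in(1/2,1)$ and $C>0$ such that: (i) for every $R_0<R<r_G$ and $R^\theta/2\le r\le 2R$, $$\sup_{x\in B(0,6R)}\sum_{y\in V:\rho(x,y)\le r}\frac{w_{x,y}}{\rho(x,y)^{d+\alpha-2}}\le C r^{2-\alpha},$$ $$\mu(B^w_z(x,r))\ge c_0\,\mu(B(x,r))\quad\text{for all }x,z\in B(0,6R),$$ $$\sup_{x\in B(0,6R)}\sum_{y\in B^w(x,c_*r)}w_{x,y}^{-1}\le C r^d;$$ (ii) for every $R_0<R<r_G$ and $r\ge R^\theta/2$, $$\sup_{x\in B(0,6R)}\sum_{y\in V:\rho(x,y)>r}\frac{w_{x,y}}{\rho(x,y)^{d+\alpha}}\le C r^{-\alpha}.$$ Then, for every $\theta'\in(\theta,1)$, there exist constants $R_1\ge1$, $\delta\in(\theta,1)$ and $C_0,C_1,C_2>0$ such that for all $R_1<R<r_G/(2c_* )$ and $R^\delta\le r\le R$: (1) $$\sup_{x\in B(0,2R)}\mathbb{P}_x\big(\tau_{B(x,r)}\le C_0r^\alpha\big)\le\frac14.$$ (2) $$\sup_{x\in B(0,2R)}\mathbb{P}_x\big(\tau_{B(x,r)}\le t\big)\le C_1\Big(\frac{t}{r^\alpha}\Big)^{1/2}\Big[1\vee\log\Big(\frac{r^\alpha}{t}\Big)\Big],\quad\forall\ t\ge r^{\theta'\alpha},$$ and $$C_2r^\alpha\le\inf_{x\in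 B(0,2R)}\mathbb{E}_x[\tau_{B(x,r)}]\le\sup_{x\in B(0,2R)}\mathbb{E}_x[\tau_{B(x,r)}]\le C_1r^\alpha.$$
   Context: $G=(V,E_V)$ is a locally finite connected graph with graph distance $\rho$ and balls $B(x,r)=\{y\in V:\rho(x,y)\le r\}$. $\mu$ is a measure on $V$ with $\mu_x=\mu(\{x\})$ and $c_M^{-1}\le\mu_x\le c_M$ for all $x\in V$ and some $c_M\ge1$. There are $d>0$, $r_G\in[1,\infty]$ and $c_G\ge1$ such that $c_G^{-1}r^d\le\mu(B(x,r))\le c_Gr^d$ for all $x\in V$ and $1\le r<r_G$. $\alpha\in(0,2)$, and $\{w_{x,y}:x,y\in V\}$ satisfies $w_{x,x}=0$, $w_{x,y}=w_{y,x}\ge0$ for $x\ne y$, and $\sum_{y\in V}\frac{w_{x,y}}{\rho(x,y)^{d+\alpha}}\mu_y<\infty$ for each $x\in V$ (convention $0/0=0$). Notation: $B^w_z(x,r)=\{u\in B(x,r):w_{u,z}>0\}$ and $B^w(x,r)=B^w_x(x,r)$. $X=((X_t)_{t\ge0},(\mathbb{P}_x)_{x\in V})$ is the symmetric Hunt process associated with the regular symmetric Dirichlet form $D(f,f)=\frac12\sum_{x,y\in V}(f(x)-f(y))^2\frac{w_{x,y}}{\rho(x,y)^{d+\alpha}}\mu_x\mu_y$ on $L^2(V;\mu)$ with domain $\{f\in L^2(V;\mu):D(f,f)<\infty\}$; i.e. with $C_{x,y}=w_{x,y}/\rho(x,y)^{d+\alpha}$, from $x$ it waits an exponential time of parameter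 $C_x=\sum_yC_{x,y}\mu_y$ and jumps to $y$ with probability $C_{x,y}\mu_y/C_x$. $\tau_A=\inf\{t>0:X_t\notin A\}$. Constants in the conclusion are independent of $r_G$; dependence on $c_G$, $c_M$ is allowed and not stressed. *)

theory Defs
  imports "HOL-Probability.Probability"
begin

text \<open>A graph is given by its vertex set \<open>V\<close> and its set \<open>E\<close> of (symmetric) adjacent pairs.\<close>

definition gdist :: "('v \<times> 'v) set \<Rightarrow> 'v \<Rightarrow> 'v \<Rightarrow> nat" where
  "gdist E x y = (LEAST n. (x, y) \<in> E ^^ n)"

definition gball :: "'v set \<Rightarrow> ('v \<times> 'v) set \<Rightarrow> 'v \<Rightarrow> real \<Rightarrow> 'v set" where
  "gball V E x r = {y \<in> V. real (gdist E x y) \<le> r}"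

definition wball :: "'v set \<Rightarrow> ('v \<times> 'v) set \<Rightarrow> ('v \<Rightarrow> 'v \<Rightarrow> real) \<Rightarrow> 'v \<Rightarrow> 'v \<Rightarrow> real \<Rightarrow> 'v set" where
  "wball V E w z x r = {u \<in> gball V E x r. w u z > 0}"

definition conductance ::
    "('v \<times> 'v) set \<Rightarrow> ('v \<Rightarrow> 'v \<Rightarrow> real) \<Rightarrow> real \<Rightarrow> real \<Rightarrow> 'v \<Rightarrow> 'v \<Rightarrow> real" where
  "conductance E w d \<alpha> x y = w x y / real (gdist E x y) powr (d + \<alpha>)"

locale weighted_graph =
  fixes V :: "'v set" and E :: "('v \<times> 'v) set" and \<mu> :: "'v measure"
    and w :: "'v \<Rightarrow> 'v \<Rightarrow> real" and d \<alpha> :: real and r\<^sub>G :: ereal and c\<^sub>G c\<^sub>M :: real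
  assumes edges: "E \<subseteq> V \<times> V" "sym E"
    and locally_finite: "\<And>x. x \<in> V \<Longrightarrow> finite {y. (x, y) \<in> E}"
    and connected: "\<And>x y. x \<in> V \<Longrightarrow> y \<in> V \<Longrightarrow> (x, y) \<in> E\<^sup>*"
    and measure_on_V: "space \<mu> = V" "sets \<mu> = Pow V"
    and c_M: "c\<^sub>M \<ge> 1"
    and atoms: "\<And>x. x \<in> V \<Longrightarrow> 1 / c\<^sub>M \<le> measure \<mu> {x} \<and> measure \<mu> {x} \<le> c\<^sub>M"
    and d: "d > 0" and r_G: "r\<^sub>G \<ge> 1" and c_G: "c\<^sub>G \<ge> 1"
    and volume: "\<And>x r. x \<in> V \<Longrightarrow> 1 \<le> r \<Longrightarrow> ereal r < r\<^sub>G \<Longrightarrow>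
      1 / c\<^sub>G * r powr d \<le> measure \<mu> (gball V E x r) \<and>
      measure \<mu> (gball V E x r) \<le> c\<^sub>G * r powr d"
    and alpha: "0 < \<alpha>" "\<alpha> < 2"
    and w_diag: "\<And>x. x \<in> V \<Longrightarrow> w x x = 0"
    and w_sym: "\<And>x y. x \<in> V \<Longrightarrow> y \<in> V \<Longrightarrow> x \<noteq> y \<Longrightarrow> w x y = w y x \<and> w y x \<ge> 0"
    and w_summable: "\<And>x. x \<in> V \<Longrightarrow>
      (\<lambda>y. w x y / real (gdist E x y) powr (d + \<alpha>) * measure \<mu> {y}) summable_on V"

text \<open>
  The process that waits at \<open>x\<close> an exponential time of parameter \<open>jump_rate x\<close> and then moves
  to \<open>y\<close> with probability \<open>jump_prob x y\<close>. A vertex of rate \<open>0\<close> is absorbing: the waiting time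
  there is infinite, and \<open>jump_prob\<close> is completed to a stochastic kernel by putting mass \<open>1\<close> on
  the diagonal.
\<close>

definition jump_rate ::
    "'v set \<Rightarrow> ('v \<times> 'v) set \<Rightarrow> 'v measure \<Rightarrow> ('v \<Rightarrow> 'v \<Rightarrow> real) \<Rightarrow> real \<Rightarrow> real \<Rightarrow> 'v \<Rightarrow> real" where
  "jump_rate V E \<mu> w d \<alpha> x = (\<Sum>\<^sub>\<infinity>y\<in>V. conductance E w d \<alpha> x y * measure \<mu> {y})"

definition jump_prob ::
    "'v set \<Rightarrow> ('v \<times> 'v) set \<Rightarrow> 'v measure \<Rightarrow> ('v \<Rightarrow> 'v \<Rightarrow> real) \<Rightarrow> real \<Rightarrow> real \<Rightarrow> 'v \<Rightarrow> 'v \<Rightarrow> real" where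
  "jump_prob V E \<mu> w d \<alpha> x y =
    (if jump_rate V E \<mu> w d \<alpha> x = 0 then of_bool (y = x)
     else conductance E w d \<alpha> x y * measure \<mu> {y} / jump_rate V E \<mu> w d \<alpha> x)"

text \<open>
  The path visiting \<open>y 0, y 1, \<dots>\<close> with waiting times \<open>s 0, s 1, \<dots>\<close>. The value \<open>None\<close> is the
  cemetery, entered at the explosion time (the lifetime) \<open>\<Sum>i. s i\<close> if that is finite.
\<close>

definition jump_path :: "(nat \<Rightarrow> 'v) \<Rightarrow> (nat \<Rightarrow> ennreal) \<Rightarrow> real \<Rightarrow> 'v option" where
  "jump_path y s t =
    (if \<exists>n. ennreal t < (\<Sum>i\<le>n. s i) then Some (y (LEAST n. ennreal t < (\<Sum>i\<le>n. s i))) else None)"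

text \<open>
  \<open>X\<close> under \<open>(P x)\<^sub>x\<close> is (a realisation of) the Hunt process of the regular Dirichlet form
  with conductances \<open>conductance E w d \<alpha>\<close> on \<open>L\<^sup>2(V; \<mu>)\<close>, through its description by jumps: \<open>Y\<close> is
  the sequence of visited vertices and \<open>S\<close> that of the waiting times. The last clause determines
  their joint law under \<open>P x\<close>: \<open>Y\<close> is the Markov chain with kernel \<open>jump_prob\<close> started at
  \<open>x\<close> and, given \<open>Y\<close>, the \<open>S i\<close> are independent and exponential with parameter
  \<open>jump_rate (Y i)\<close>.
\<close>

definition conductance_process ::
    "'v set \<Rightarrow> ('v \<times> 'v) set \<Rightarrow> 'v measure \<Rightarrow> ('v \<Rightarrow> 'v \<Rightarrow> real) \<Rightarrow> real \<Rightarrow> real \<Rightarrow>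
      ('v \<Rightarrow> 'o measure) \<Rightarrow> (real \<Rightarrow> 'o \<Rightarrow> 'v option) \<Rightarrow> bool" where
  "conductance_process V E \<mu> w d \<alpha> P X \<longleftrightarrow>
    (\<forall>x\<in>V. prob_space (P x) \<and>
      (\<exists>(Y :: nat \<Rightarrow> 'o \<Rightarrow> 'v) (S :: nat \<Rightarrow> 'o \<Rightarrow> ennreal).
        (\<forall>n. Y n \<in> measurable (P x) (count_space V) \<and> S n \<in> borel_measurable (P x)) \<and>
        (\<forall>\<omega>\<in>space (P x). \<forall>t\<ge>0. X t \<omega> = jump_path (\<lambda>n. Y n \<omega>) (\<lambda>n. S n \<omega>) t) \<and>
        (\<forall>n y s. (\<forall>i\<le>n. y i \<in> V \<and> 0 \<le> s i) \<longrightarrow>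
          measure (P x) {\<omega> \<in> space (P x). \<forall>i\<le>n. Y i \<omega> = y i \<and> ennreal (s i) < S i \<omega>} =
            of_bool (y 0 = x) *
            (\<Prod>i<n. jump_prob V E \<mu> w d \<alpha> (y i) (y (Suc i))) *
            (\<Prod>i\<le>n. exp (- jump_rate V E \<mu> w d \<alpha> (y i) * s i)))))"

definition exit_time :: "(real \<Rightarrow> 'o \<Rightarrow> 'v option) \<Rightarrow> 'v set \<Rightarrow> 'o \<Rightarrow> ennreal" where
  "exit_time X A \<omega> = Inf {ennreal t |t. t > 0 \<and> X t \<omega> \<notin> Some ` A}"

definition c_star :: "real \<Rightarrow> real \<Rightarrow> real" where
  "c_star c\<^sub>G d = 8 * c\<^sub>G powr (2 / d)"

end

theory Submission
  imports Defs "HOL-Real_Asymp.Real_Asymp"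
begin

text \<open>
  Everything reduces to the chain killed on leaving the finite ball \<open>B\<close> of radius \<open>r\<close> about \<open>x\<close>.
  Let \<open>p t\<close> be the density of the killed chain started at \<open>x\<close>; it solves a finite linear system, and
  the mass it has lost by time \<open>t\<close> bounds the probability of having left \<open>B\<close>. Put
  \<open>N t = (\<Sum>y\<in>B. m y * p t y * \<rho>(x, y)) / r + (1 - \<Sum>y\<in>B. m y * p t y)\<close>, the mean displacement in units
  of \<open>r\<close> when a particle that has left \<open>B\<close> counts as being at distance \<open>r\<close>. It dominates the lost mass.
  There is no pointwise control of the drift of the process, so \<open>N\<close> is bounded by an entropy argument
  in the manner of Nash. The derivative of \<open>N\<close> is a sum of fluxes \<open>(p y - p z) * (\<rho>(x, z) - \<rho>(x, y))\<close>
  over edges, and each flux is at most a multiple \<open>L\<close> of what that edge contributes to the dissipation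
  of an entropy \<open>\<Phi>\<close>, plus \<open>\<rho>(y, z)\<^sup>2 * (p y + p z + u) / (4 * L)\<close>. The second moment hypothesis sums
  the latter, while the tail hypothesis deals with the jumps longer than \<open>2 * r\<close>
  (lemma \<open>distance_flux\<close>). The entropy density has derivative \<open>ln (1 + p / u)\<close> with
  \<open>u = r powr (- d)\<close>: the shift by \<open>u\<close> keeps the cost of edges to the outside, where the density
  vanishes, finite, and it is cheap because \<open>u\<close> times the volume of \<open>B\<close> is bounded.

  With \<open>L\<close> of order \<open>r * sqrt (t / r powr \<alpha>)\<close> the resulting differential inequality integrates to
  \<open>sqrt (t / r powr \<alpha>)\<close> up to a logarithm, provided that \<open>\<Phi> t\<close> is at most of order
  \<open>1 + ln (r powr \<alpha> / t)\<close> (lemma \<open>entropy_flux_integration\<close>). The entropy is controlled by the square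
  norm of \<open>p t\<close> (lemma \<open>entropy_le_l2\<close>), and this decays like \<open>t powr (- d / \<alpha>)\<close> by a Nash inequality
  (lemmas \<open>nash_inequality\<close> and \<open>nash_decay\<close>). The hypotheses say nothing about scales below
  \<open>R powr \<theta> / 2\<close>, so the decay starts only after a burn-in time, taken to be \<open>r powr (\<theta>\<^sub>2 * \<alpha>) / 2\<close> with
  \<open>\<theta> < \<theta>\<^sub>2 < \<theta>'\<close>; for \<open>r \<ge> R powr \<delta>\<close> with \<open>\<delta> * \<theta>\<^sub>2 > \<theta>\<close> it is long enough. During the burn-in only the
  bound \<open>\<Phi> \<le> ln (1 + c\<^sub>M * r powr d)\<close> is at hand; its logarithm of \<open>r\<close> is absorbed by the power of \<open>r\<close>
  between the burn-in time and \<open>t \<ge> r powr (\<theta>' * \<alpha>)\<close>.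

  The bound by \<open>1 / 4\<close> and the lower bound on the mean exit time are the exit probability bound at time
  \<open>C\<^sub>0 * r powr \<alpha>\<close>. For the upper bound on the mean, every vertex of \<open>B\<close> has a rate of jumping out of
  \<open>B\<close> of at least a multiple of \<open>r powr (- \<alpha>)\<close> (lemma \<open>kill_rate_lower_bound\<close>): within distance
  \<open>2 * c_star c\<^sub>G d * r\<close> most vertices with positive weight lie outside \<open>B\<close>, and the bound on the sum of
  inverse weights makes their total weight large.

  The process is known only through the probabilities of finite jump histories. The predicate
  \<open>jump_law\<close> isolates these formulas and is stable under waiting and under jumping. This replaces the
  Markov property, and it suffices to compare survival probabilities with the solution of the backward
  equation (lemma \<open>survival_lower_bound\<close>) and to sum the expected waiting times
  (lemma \<open>killed_time_integral\<close>).
\<close>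

section \<open>Linear flows on a finite set\<close>

primrec matrix_iterate :: "'v set \<Rightarrow> ('v \<Rightarrow> 'v \<Rightarrow> real) \<Rightarrow> ('v \<Rightarrow> real) \<Rightarrow> nat \<Rightarrow> 'v \<Rightarrow> real" where
  "matrix_iterate B a b 0 = b"
| "matrix_iterate B a b (Suc n) = (\<lambda>y. \<Sum>z\<in>B. a y z * matrix_iterate B a b n z)"

text \<open>The flow is the exponential series. Its terms are nonnegative when the matrix and the initial value
  are, and a supersolution inequality for the initial value passes to every iterate; both facts
  therefore survive summation.\<close>

lemma nonneg_linear_flow_exists:
  fixes a :: "'v \<Rightarrow> 'v \<Rightarrow> real"
  assumes fin: "finite B"
    and a: "\<And>y z. y \<in> B \<Longrightarrow> z \<in> B \<Longrightarrow> 0 \<le> a y z"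
    and b: "\<And>y. y \<in> B \<Longrightarrow> 0 \<le> b y"
  shows "\<exists>g :: real \<Rightarrow> 'v \<Rightarrow> real. (\<forall>y. g 0 y = b y) \<and>
    (\<forall>t. \<forall>y\<in>B. ((\<lambda>s. g s y) has_real_derivative (\<Sum>z\<in>B. a y z * g t z)) (at t)) \<and>
    (\<forall>t\<ge>0. \<forall>y\<in>B. 0 \<le> g t y) \<and>
    (\<forall>\<Lambda>. (\<forall>y\<in>B. (\<Sum>z\<in>B. a y z * b z) \<le> \<Lambda> * b y) \<longrightarrow>
       (\<forall>t\<ge>0. \<forall>y\<in>B. (\<Sum>z\<in>B. a y z * g t z) \<le> \<Lambda> * g t y))"
proof -
  define I where "I = matrix_iterate B a b"
  have I0: "I 0 = b" and IS: "\<And>n y. I (Suc n) y = (\<Sum>z\<in>B. a y z * I n z)"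
    by (simp_all add: I_def)
  define K where "K = (\<Sum>y\<in>B. \<Sum>z\<in>B. a y z)"
  have rowK: "(\<Sum>z\<in>B. a y z) \<le> K" if "y \<in> B" for y
    unfolding K_def using that fin a by (intro member_le_sum sum_nonneg) auto
  have K0: "0 \<le> K" unfolding K_def using a by (intro sum_nonneg) auto
  have I_nonneg: "y \<in> B \<Longrightarrow> 0 \<le> I n y" for n y
    by (induction n arbitrary: y) (auto simp: I0 IS b intro!: sum_nonneg mult_nonneg_nonneg a)
  have I_le: "y \<in> B \<Longrightarrow> I n y \<le> (\<Sum>z\<in>B. b z) * K ^ n" for n y
  proof (induction n arbitrary: y)
    case 0
    then show ?case using fin b by (auto simp: I0 intro!: member_le_sum)
  next
    case (Suc n)
    have "I (Suc n) y \<le> (\<Sum>z\<in>B. a y z * ((\<Sum>z\<in>B. b z) * K ^ n))"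
      unfolding IS using Suc by (intro sum_mono mult_left_mono a) auto
    also have "\<dots> = (\<Sum>z\<in>B. a y z) * ((\<Sum>z\<in>B. b z) * K ^ n)"
      by (simp add: sum_distrib_right)
    also have "\<dots> \<le> K * ((\<Sum>z\<in>B. b z) * K ^ n)"
      using rowK[OF Suc.prems] K0 b by (intro mult_right_mono) (auto intro!: sum_nonneg mult_nonneg_nonneg)
    finally show ?case by (simp add: mult_ac)
  qed
  have summ: "summable (\<lambda>n. I n y / fact n * t ^ n)" if "y \<in> B" for y and t :: real
  proof (rule summable_comparison_test')
    show "summable (\<lambda>n. (\<Sum>z\<in>B. b z) * ((K * \<bar>t\<bar>) ^ n /\<^sub>R fact n))"
      by (intro summable_mult summable_exp_generic)
    fix n
    have "norm (I n y / fact n * t ^ n) = I n y * (\<bar>t\<bar> ^ n / fact n)"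
      using I_nonneg[OF that] by (simp add: abs_mult power_abs)
    also have "\<dots> \<le> ((\<Sum>z\<in>B. b z) * K ^ n) * (\<bar>t\<bar> ^ n / fact n)"
      using I_le[OF that] by (intro mult_right_mono) auto
    also have "\<dots> = (\<Sum>z\<in>B. b z) * ((K * \<bar>t\<bar>) ^ n /\<^sub>R fact n)"
      by (simp add: power_mult_distrib divide_inverse mult_ac)
    finally show "norm (I n y / fact n * t ^ n) \<le> (\<Sum>z\<in>B. b z) * ((K * \<bar>t\<bar>) ^ n /\<^sub>R fact n)" .
  qed
  define g where "g = (\<lambda>t y. if y \<in> B then \<Sum>n. I n y / fact n * t ^ n else b y)"
  have gB: "y \<in> B \<Longrightarrow> g t y = (\<Sum>n. I n y / fact n * t ^ n)" for t y by (simp add: g_def)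
  have row: "(\<Sum>z\<in>B. a y z * g t z) = (\<Sum>n. I (Suc n) y / fact n * t ^ n)"
    and row_summ: "summable (\<lambda>n. I (Suc n) y / fact n * t ^ n)" if "y \<in> B" for t y
  proof -
    have eq: "(\<lambda>n. I (Suc n) y / fact n * t ^ n) = (\<lambda>n. \<Sum>z\<in>B. a y z * (I n z / fact n * t ^ n))"
      by (simp add: IS sum_distrib_left sum_distrib_right sum_divide_distrib mult_ac)
    show "summable (\<lambda>n. I (Suc n) y / fact n * t ^ n)"
      unfolding eq by (intro summable_sum summable_mult summ)
    show "(\<Sum>z\<in>B. a y z * g t z) = (\<Sum>n. I (Suc n) y / fact n * t ^ n)"
      unfolding eq
      by (simp only: suminf_sum[OF summable_mult[OF summ]] suminf_mult[OF summ] gB cong: sum.cong)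
  qed
  show ?thesis
  proof (intro exI[of _ g] conjI allI ballI impI)
    show "g 0 y = b y" for y
      unfolding g_def powser_zero by (simp add: I0)
    show "((\<lambda>s. g s y) has_real_derivative (\<Sum>z\<in>B. a y z * g t z)) (at t)" if "y \<in> B" for t y
    proof -
      have "((\<lambda>s. \<Sum>n. I n y / fact n * s ^ n) has_real_derivative
          (\<Sum>n. diffs (\<lambda>n. I n y / fact n) n * t ^ n)) (at t)"
        by (rule termdiffs_strong_converges_everywhere) (use summ[OF that] in auto)
      moreover have "diffs (\<lambda>n. I n y / fact n) = (\<lambda>n. I (Suc n) y / fact n)"
        by (simp add: diffs_def fun_eq_iff divide_simps del: of_nat_Suc)
      ultimately show ?thesis unfolding gB[OF that] row[OF that] by simp
    qed
    show "0 \<le> g t y" if "t \<ge> 0" "y \<in> B" for t y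
      unfolding gB[OF that(2)] using that I_nonneg by (intro suminf_nonneg summ) auto
    show "(\<Sum>z\<in>B. a y z * g t z) \<le> \<Lambda> * g t y"
      if sup: "\<forall>y\<in>B. (\<Sum>z\<in>B. a y z * b z) \<le> \<Lambda> * b y" and "t \<ge> 0" "y \<in> B" for t y \<Lambda>
    proof -
      have I_step: "y \<in> B \<Longrightarrow> I (Suc n) y \<le> \<Lambda> * I n y" for n y
      proof (induction n arbitrary: y)
        case 0
        then show ?case using sup by (simp add: IS I0)
      next
        case (Suc n)
        have "I (Suc (Suc n)) y = (\<Sum>z\<in>B. a y z * I (Suc n) z)" by (rule IS)
        also have "\<dots> \<le> (\<Sum>z\<in>B. a y z * (\<Lambda> * I n z))"
          using Suc by (intro sum_mono mult_left_mono a) auto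
        also have "\<dots> = \<Lambda> * I (Suc n) y" by (simp add: IS sum_distrib_left mult_ac)
        finally show ?case .
      qed
      have "(\<Sum>z\<in>B. a y z * g t z) \<le> (\<Sum>n. \<Lambda> * (I n y / fact n * t ^ n))"
        unfolding row[OF that(3)]
      proof (rule suminf_le)
        show "I (Suc n) y / fact n * t ^ n \<le> \<Lambda> * (I n y / fact n * t ^ n)" for n
          using mult_right_mono[OF I_step[OF that(3), of n], of "t ^ n / fact n"] that(2)
          by (simp add: mult_ac)
      next
        show "summable (\<lambda>n. I (Suc n) y / fact n * t ^ n)" using that(3) by (rule row_summ)
        show "summable (\<lambda>n. \<Lambda> * (I n y / fact n * t ^ n))" using that(3) by (intro summable_mult summ)
      qed
      also have "\<dots> = \<Lambda> * g t y" unfolding gB[OF that(3)] by (rule suminf_mult[OF summ[OF that(3)]])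
      finally show ?thesis .
    qed
  qed
qed

section \<open>The chain killed outside a finite set\<close>

text \<open>The chain on \<open>B\<close> with reversible measure \<open>m\<close>, jump rates \<open>c y z * m z\<close> and killing rates \<open>k y\<close>.\<close>

locale killed_chain =
  fixes B :: "'v set" and m :: "'v \<Rightarrow> real" and c :: "'v \<Rightarrow> 'v \<Rightarrow> real" and k :: "'v \<Rightarrow> real"
  assumes finite_B: "finite B"
    and m_pos: "\<And>y. y \<in> B \<Longrightarrow> 0 < m y"
    and c_nonneg: "\<And>y z. y \<in> B \<Longrightarrow> z \<in> B \<Longrightarrow> 0 \<le> c y z"
    and c_sym: "\<And>y z. y \<in> B \<Longrightarrow> z \<in> B \<Longrightarrow> c y z = c z y"
    and k_nonneg: "\<And>y. y \<in> B \<Longrightarrow> 0 \<le> k y"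
begin

definition gen :: "('v \<Rightarrow> real) \<Rightarrow> 'v \<Rightarrow> real" where
  "gen f y = (\<Sum>z\<in>B. c y z * m z * (f z - f y)) - k y * f y"

text \<open>The Dirichlet form of the chain on functions that vanish outside \<open>B\<close>: an edge leaving \<open>B\<close>
  enters through the killing rate.\<close>

definition energy :: "('v \<Rightarrow> real) \<Rightarrow> ('v \<Rightarrow> real) \<Rightarrow> real" where
  "energy f g = (\<Sum>y\<in>B. \<Sum>z\<in>B. c y z * m y * m z * (f y - f z) * (g y - g z)) / 2
     + (\<Sum>y\<in>B. m y * k y * f y * g y)"

definition flow :: "(real \<Rightarrow> 'v \<Rightarrow> real) \<Rightarrow> bool" where
  "flow p \<longleftrightarrow> (\<forall>t. \<forall>y\<in>B. ((\<lambda>s. p s y) has_real_derivative gen (p t) y) (at t))"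

lemma flowD: "flow p \<Longrightarrow> y \<in> B \<Longrightarrow> ((\<lambda>s. p s y) has_real_derivative gen (p t) y) (at t)"
  by (simp add: flow_def)

lemma green: "(\<Sum>y\<in>B. m y * gen f y * g y) = - energy f g"
proof -
  define S where "S = (\<Sum>y\<in>B. \<Sum>z\<in>B. c y z * m y * m z * (f z - f y) * g y)"
  have "S = (\<Sum>z\<in>B. \<Sum>y\<in>B. c y z * m y * m z * (f z - f y) * g y)"
    unfolding S_def by (rule sum.swap)
  also have "\<dots> = (\<Sum>z\<in>B. \<Sum>y\<in>B. c z y * m z * m y * (f z - f y) * g y)"
    using c_sym by (intro sum.cong refl) (simp add: mult_ac)
  finally have "2 * S = (\<Sum>y\<in>B. \<Sum>z\<in>B. c y z * m y * m z * (f z - f y) * g y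
      + c y z * m y * m z * (f y - f z) * g z)"
    by (simp add: S_def sum.distrib)
  also have "\<dots> = - (\<Sum>y\<in>B. \<Sum>z\<in>B. c y z * m y * m z * (f y - f z) * (g y - g z))"
    unfolding sum_negf[symmetric] by (intro sum.cong refl) (simp add: algebra_simps)
  finally have S: "S = - (\<Sum>y\<in>B. \<Sum>z\<in>B. c y z * m y * m z * (f y - f z) * (g y - g z)) / 2"
    by simp
  have "(\<Sum>y\<in>B. m y * gen f y * g y) = S - (\<Sum>y\<in>B. m y * k y * f y * g y)"
    unfolding S_def sum_subtractf[symmetric]
    by (intro sum.cong refl)
      (simp add: gen_def right_diff_distrib left_diff_distrib sum_distrib_left sum_distrib_right mult_ac)
  then show ?thesis by (simp add: S energy_def)
qed

lemma energy_sym: "energy f g = energy g f"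
  by (simp add: energy_def mult_ac)

lemma energy_const: "energy f (\<lambda>_. a) = (\<Sum>y\<in>B. m y * k y * f y) * a"
  by (simp add: energy_def sum_distrib_right)

lemma energy_nonneg: "0 \<le> energy f f"
proof -
  have "0 \<le> c y z * m y * m z * (f y - f z) * (f y - f z)" "0 \<le> m y * k y * f y * f y"
    if "y \<in> B" "z \<in> B" for y z
    using that m_pos c_nonneg k_nonneg unfolding mult.assoc[of _ "f y - f z"] mult.assoc[of _ "f y"]
    by (auto intro!: mult_nonneg_nonneg simp: less_imp_le)
  then show ?thesis unfolding energy_def by (auto intro!: add_nonneg_nonneg sum_nonneg)
qed

text \<open>Adding a large multiple of the identity to the generator gives a matrix with nonnegative entries,
  and the exponential series of that matrix is multiplied by a decaying exponential.\<close>

lemma flow_exists: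
  assumes b: "\<And>y. y \<in> B \<Longrightarrow> 0 \<le> b y"
  obtains p where "flow p" "\<And>y. p 0 y = b y" "\<And>t y. t \<ge> 0 \<Longrightarrow> y \<in> B \<Longrightarrow> 0 \<le> p t y"
    "\<And>t y. (\<And>y. y \<in> B \<Longrightarrow> gen b y \<le> 0) \<Longrightarrow> t \<ge> 0 \<Longrightarrow> y \<in> B \<Longrightarrow> gen (p t) y \<le> 0"
proof -
  define q where "q y = (\<Sum>z\<in>B. c y z * m z) + k y" for y
  define \<Lambda> where "\<Lambda> = (\<Sum>y\<in>B. q y)"
  have q0: "y \<in> B \<Longrightarrow> 0 \<le> q y" for y
    unfolding q_def using m_pos c_nonneg k_nonneg by (auto intro!: add_nonneg_nonneg sum_nonneg simp: less_imp_le)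
  have q\<Lambda>: "y \<in> B \<Longrightarrow> q y \<le> \<Lambda>" for y
    unfolding \<Lambda>_def using q0 finite_B by (intro member_le_sum) auto
  define a where "a y z = c y z * m z + (if y = z then \<Lambda> - q y else 0)" for y z
  have a_gen: "(\<Sum>z\<in>B. a y z * f z) = gen f y + \<Lambda> * f y" if "y \<in> B" for f y
  proof -
    have "(\<Sum>z\<in>B. a y z * f z) = (\<Sum>z\<in>B. c y z * m z * f z) + (\<Sum>z\<in>B. if y = z then (\<Lambda> - q y) * f z else 0)"
      unfolding sum.distrib[symmetric] by (intro sum.cong refl) (auto simp: a_def algebra_simps)
    also have "\<dots> = (\<Sum>z\<in>B. c y z * m z * f z) + (\<Lambda> - q y) * f y"
      using that finite_B by simp
    also have "\<dots> = gen f y + \<Lambda> * f y"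
    proof -
      have "(\<Sum>z\<in>B. c y z * m z * (f z - f y)) = (\<Sum>z\<in>B. c y z * m z * f z) - (\<Sum>z\<in>B. c y z * m z) * f y"
        by (simp only: right_diff_distrib sum_subtractf sum_distrib_right)
      then show ?thesis by (simp add: gen_def q_def left_diff_distrib distrib_right)
    qed
    finally show ?thesis .
  qed
  have a0: "0 \<le> a y z" if "y \<in> B" "z \<in> B" for y z
    using mult_nonneg_nonneg[OF c_nonneg[OF that] less_imp_le[OF m_pos[OF that(2)]]] q\<Lambda>[OF that(1)]
    by (cases "y = z") (simp_all add: a_def)
  have "\<exists>g :: real \<Rightarrow> 'v \<Rightarrow> real. (\<forall>y. g 0 y = b y) \<and>
    (\<forall>t. \<forall>y\<in>B. ((\<lambda>s. g s y) has_real_derivative (\<Sum>z\<in>B. a y z * g t z)) (at t)) \<and>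
    (\<forall>t\<ge>0. \<forall>y\<in>B. 0 \<le> g t y) \<and>
    (\<forall>\<Lambda>. (\<forall>y\<in>B. (\<Sum>z\<in>B. a y z * b z) \<le> \<Lambda> * b y) \<longrightarrow>
       (\<forall>t\<ge>0. \<forall>y\<in>B. (\<Sum>z\<in>B. a y z * g t z) \<le> \<Lambda> * g t y))"
    by (intro nonneg_linear_flow_exists finite_B a0 b)
  then obtain g where g: "\<forall>y. g 0 y = b y"
    "\<forall>t. \<forall>y\<in>B. ((\<lambda>s. g s y) has_real_derivative (\<Sum>z\<in>B. a y z * g t z)) (at t)"
    "\<forall>t\<ge>0. \<forall>y\<in>B. 0 \<le> g t y"
    "\<forall>\<Lambda>. (\<forall>y\<in>B. (\<Sum>z\<in>B. a y z * b z) \<le> \<Lambda> * b y) \<longrightarrow>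
       (\<forall>t\<ge>0. \<forall>y\<in>B. (\<Sum>z\<in>B. a y z * g t z) \<le> \<Lambda> * g t y)"
    by blast
  define p where "p t y = exp (- \<Lambda> * t) * g t y" for t y
  have gen_p: "gen (p t) y = exp (- \<Lambda> * t) * gen (g t) y" for t y
    by (simp add: gen_def p_def right_diff_distrib sum_distrib_left mult_ac)
  show ?thesis
  proof
    show "flow p" unfolding flow_def
    proof (intro allI ballI)
      fix t y assume y: "y \<in> B"
      have "((\<lambda>s. p s y) has_real_derivative
          exp (- \<Lambda> * t) * (\<Sum>z\<in>B. a y z * g t z) + (- \<Lambda> * exp (- \<Lambda> * t)) * g t y) (at t)"
        unfolding p_def by (auto intro!: derivative_eq_intros g(2)[rule_format] y)
      then show "((\<lambda>s. p s y) has_real_derivative gen (p t) y) (at t)"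
        by (simp add: a_gen[OF y] gen_p algebra_simps)
    qed
    show "p 0 y = b y" for y by (simp add: p_def g)
    show "0 \<le> p t y" if "t \<ge> 0" "y \<in> B" for t y using g(3) that by (simp add: p_def)
    show "gen (p t) y \<le> 0" if "\<And>y. y \<in> B \<Longrightarrow> gen b y \<le> 0" "t \<ge> 0" "y \<in> B" for t y
    proof -
      have "(\<Sum>z\<in>B. a y z * g t z) \<le> \<Lambda> * g t y"
        using that by (intro g(4)[rule_format]) (auto simp: a_gen)
      then have "gen (g t) y \<le> 0" using that by (simp add: a_gen)
      then show ?thesis by (simp add: gen_p mult_nonneg_nonpos)
    qed
  qed
qed

text \<open>Reversibility: the pairing of \<open>p s\<close> with \<open>q (t - s)\<close> does not depend on \<open>s\<close>. With \<open>p\<close> the density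
  started at a point and \<open>q\<close> the backward solution started from \<open>1\<close> it identifies the total mass of the
  former with the value of the latter.\<close>

lemma flow_pairing:
  assumes p: "flow p" and q: "flow q"
  shows "(\<Sum>y\<in>B. m y * p t y * q 0 y) = (\<Sum>y\<in>B. m y * p 0 y * q t y)"
proof -
  define G where "G s = (\<Sum>y\<in>B. m y * p s y * q (t - s) y)" for s
  have "(G has_real_derivative 0) (at s)" for s
  proof -
    have q': "((\<lambda>s. q (t - s) y) has_real_derivative - gen (q (t - s)) y) (at s)" if "y \<in> B" for y
    proof -
      have "((\<lambda>s. t - s) has_real_derivative - 1) (at s)" by (auto intro!: derivative_eq_intros)
      from DERIV_chain2[OF flowD[OF q that] this] show ?thesis by simp
    qed
    have "(G has_real_derivative (\<Sum>y\<in>B. m y * (gen (p s) y * q (t - s) y + - gen (q (t - s)) y * p s y))) (at s)"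
      unfolding G_def mult.assoc by (intro DERIV_sum DERIV_cmult DERIV_mult q' flowD[OF p])
    also have "(\<Sum>y\<in>B. m y * (gen (p s) y * q (t - s) y + - gen (q (t - s)) y * p s y))
       = (\<Sum>y\<in>B. m y * gen (p s) y * q (t - s) y) - (\<Sum>y\<in>B. m y * gen (q (t - s)) y * p s y)"
      unfolding sum_subtractf[symmetric] by (intro sum.cong refl) (simp add: algebra_simps)
    also have "\<dots> = 0" unfolding green by (simp add: energy_sym)
    finally show ?thesis .
  qed
  then have "G t = G 0" by (intro DERIV_isconst_all) auto
  then show ?thesis by (simp add: G_def)
qed

lemma mass_deriv:
  assumes "flow p"
  shows "((\<lambda>t. \<Sum>y\<in>B. m y * p t y * a y) has_real_derivative - energy (p t) a) (at t)"
  unfolding green[symmetric] by (intro DERIV_sum DERIV_cmult_right DERIV_cmult flowD[OF assms])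

lemma l2_deriv:
  assumes "flow p"
  shows "((\<lambda>t. \<Sum>y\<in>B. m y * (p t y)\<^sup>2) has_real_derivative - 2 * energy (p t) (p t)) (at t)"
proof -
  have "((\<lambda>t. \<Sum>y\<in>B. m y * (p t y)\<^sup>2) has_real_derivative
      (\<Sum>y\<in>B. m y * (of_nat 2 * (gen (p t) y * p t y ^ (2 - Suc 0))))) (at t)"
    by (intro DERIV_sum DERIV_cmult DERIV_power flowD[OF assms])
  also have "(\<Sum>y\<in>B. m y * (of_nat 2 * (gen (p t) y * p t y ^ (2 - Suc 0)))) = 2 * (\<Sum>y\<in>B. m y * gen (p t) y * p t y)"
    unfolding sum_distrib_left by (intro sum.cong refl) simp
  finally show ?thesis by (simp add: green)
qed

end

text \<open>The primitive of \<open>ln (1 + a / u)\<close>, a version of \<open>a * ln a\<close> whose derivative is finite at \<open>a = 0\<close>.\<close>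

definition entropy_density :: "real \<Rightarrow> real \<Rightarrow> real" where
  "entropy_density u a = (a + u) * ln (1 + a / u) - a"

lemma entropy_density_deriv:
  assumes "0 < u" "0 \<le> a"
  shows "(entropy_density u has_real_derivative ln (1 + a / u)) (at a)"
proof -
  have pos: "0 < 1 + a / u" using assms by (simp add: add_pos_nonneg)
  have "(entropy_density u has_real_derivative (ln (1 + a / u) + (a + u) * (1 / u / (1 + a / u)) - 1)) (at a)"
    unfolding entropy_density_def[abs_def] using pos assms
    by (auto intro!: derivative_eq_intros)
  moreover have "(a + u) * (1 / u / (1 + a / u)) = 1" using assms pos by (simp add: field_simps add_pos_nonneg)
  ultimately show ?thesis by (simp only: add_diff_cancel_right')
qed

lemma entropy_density_nonneg:
  assumes "0 < u" "0 \<le> a" shows "0 \<le> entropy_density u a"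
proof -
  have "ln (1 / (1 + a / u)) \<le> 1 / (1 + a / u) - 1"
    using assms by (intro ln_le_minus_one) (auto simp: add_pos_nonneg)
  then have "a / (a + u) \<le> ln (1 + a / u)"
    using assms by (simp add: ln_div add_pos_nonneg field_simps add_nonneg_eq_0_iff)
  then have "(a + u) * (a / (a + u)) \<le> (a + u) * ln (1 + a / u)"
    using assms by (intro mult_left_mono) auto
  then show ?thesis using assms by (simp add: entropy_density_def)
qed

lemma entropy_density_le:
  assumes "0 < u" "0 \<le> a" shows "entropy_density u a \<le> a * ln (1 + a / u)"
proof -
  have "ln (1 + a / u) \<le> a / u" using assms by (intro ln_add_one_self_le_self) auto
  then show ?thesis using assms by (simp add: entropy_density_def field_simps)
qed

text \<open>The entropy density has second derivative \<open>1 / (u + a)\<close>.\<close>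

lemma log_slope_lower_bound:
  fixes a b u :: real
  assumes "0 < u" "0 \<le> a" "0 \<le> b"
  shows "(a - b)\<^sup>2 / (a + b + u) \<le> (a - b) * (ln (1 + a / u) - ln (1 + b / u))"
proof -
  have *: "(a - b)\<^sup>2 / (a + b + u) \<le> (a - b) * (ln (1 + a / u) - ln (1 + b / u))"
    if "0 \<le> b" "b \<le> a" for a b
  proof -
    have e: "1 + x / u = (u + x) / u" for x using assms by (simp add: field_simps)
    have "ln ((u + b) / (u + a)) \<le> (u + b) / (u + a) - 1"
      using that assms by (intro ln_le_minus_one) auto
    also have "\<dots> = - ((a - b) / (u + a))" using that assms by (simp add: field_simps)
    finally have "(a - b) / (u + a) \<le> ln (1 + a / u) - ln (1 + b / u)"
      using that assms unfolding e by (simp add: ln_div)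
    moreover have "(a - b) / (a + b + u) \<le> (a - b) / (u + a)"
      using that assms by (intro divide_left_mono) auto
    ultimately have "(a - b) * ((a - b) / (a + b + u)) \<le> (a - b) * (ln (1 + a / u) - ln (1 + b / u))"
      using that by (intro mult_left_mono) auto
    then show ?thesis by (simp add: power2_eq_square)
  qed
  show ?thesis
  proof (cases "b \<le> a")
    case True then show ?thesis using * assms by blast
  next
    case False
    then have "(b - a)\<^sup>2 / (b + a + u) \<le> (b - a) * (ln (1 + b / u) - ln (1 + a / u))"
      using *[of a b] assms by simp
    also have "\<dots> = (a - b) * (ln (1 + a / u) - ln (1 + b / u))" by (simp add: algebra_simps)
    finally show ?thesis by (simp only: power2_commute[of b a] add.commute[of b a])
  qed
qed

text \<open>The geometric mean of the dissipation of an edge and of the second moment it carries dominates its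
  flux. The case \<open>b = 0\<close> covers edges that leave the set.\<close>

lemma edge_flux_bound:
  fixes a b u x l L :: real
  assumes "0 < u" "0 \<le> a" "0 \<le> b" "\<bar>x\<bar> \<le> l" "0 < L"
  shows "(a - b) * x \<le> L * ((a - b) * (ln (1 + a / u) - ln (1 + b / u))) + l\<^sup>2 * (a + b + u) / (4 * L)"
proof -
  define s where "s = a + b + u"
  have s: "0 < s" using assms by (simp add: s_def)
  have "(a - b) * x \<le> L * ((a - b)\<^sup>2 / s) + x\<^sup>2 * s / (4 * L)"
  proof -
    \<comment> \<open>The optimal split of the product, by the inequality of arithmetic and geometric means.\<close>
    have "L * ((a - b)\<^sup>2 / s) + x\<^sup>2 * s / (4 * L) - (a - b) * x = (2 * L * (a - b) - x * s)\<^sup>2 / (4 * L * s)"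
      using s assms by (simp add: field_simps power2_eq_square)
    also have "\<dots> \<ge> 0" using s assms by simp
    finally show ?thesis by simp
  qed
  also have "L * ((a - b)\<^sup>2 / s) \<le> L * ((a - b) * (ln (1 + a / u) - ln (1 + b / u)))"
    using log_slope_lower_bound[of u a b] assms by (intro mult_left_mono) (auto simp: s_def)
  also have "x\<^sup>2 * s / (4 * L) \<le> l\<^sup>2 * s / (4 * L)"
    using s assms power_mono[of "\<bar>x\<bar>" l 2] by (intro divide_right_mono mult_right_mono) auto
  finally show ?thesis by (simp add: s_def)
qed

context killed_chain begin

lemma entropy_deriv:
  assumes p: "flow p" and u: "0 < u" and t: "0 \<le> t" and nn: "\<And>y. y \<in> B \<Longrightarrow> 0 \<le> p t y"
  shows "((\<lambda>t. \<Sum>y\<in>B. m y * entropy_density u (p t y)) has_real_derivative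
     - energy (p t) (\<lambda>y. ln (1 + p t y / u))) (at t)"
proof -
  have "((\<lambda>t. entropy_density u (p t y)) has_real_derivative gen (p t) y * ln (1 + p t y / u)) (at t)"
    if "y \<in> B" for y
    using DERIV_chain2[OF entropy_density_deriv[OF u nn[OF that]] flowD[OF p that]]
    by (simp add: mult_ac)
  then show ?thesis unfolding green[symmetric] mult.assoc
    by (intro DERIV_sum DERIV_cmult)
qed

text \<open>The left-hand side is the derivative of the mean displacement, where lost particles sit at distance
  \<open>r\<close>. Edges inside \<open>B\<close> and short edges out of it are estimated by \<open>edge_flux_bound\<close>; \<open>N y\<close> is the
  set of outside neighbours reached from \<open>y\<close> by short edges, \<open>kf y\<close> the rate of long jumps, each of
  which costs at most \<open>r\<close>.\<close>

lemma distance_flux: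
  assumes "B \<noteq> {}" and r: "0 < r" and u: "0 < u" and L: "0 < L"
    and p: "\<And>y. y \<in> B \<Longrightarrow> 0 \<le> p y" and mass: "(\<Sum>y\<in>B. m y * p y) \<le> 1"
    and k_split: "\<And>y. y \<in> B \<Longrightarrow> k y = (\<Sum>z\<in>N y. c y z * m z) + kf y"
    and N_nonneg: "\<And>y z. y \<in> B \<Longrightarrow> z \<in> N y \<Longrightarrow> 0 \<le> c y z * m z"
    and kf: "\<And>y. y \<in> B \<Longrightarrow> 0 \<le> kf y" "\<And>y. y \<in> B \<Longrightarrow> r * kf y \<le> F"
    and D: "\<And>y. y \<in> B \<Longrightarrow> 0 \<le> D y" "\<And>y. y \<in> B \<Longrightarrow> D y \<le> r"
    and \<rho>_sym: "\<And>y z. y \<in> B \<Longrightarrow> z \<in> B \<Longrightarrow> \<rho> y z = \<rho> z y"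
    and D_lip: "\<And>y z. y \<in> B \<Longrightarrow> z \<in> B \<Longrightarrow> \<bar>D y - D z\<bar> \<le> \<rho> y z"
    and D_out: "\<And>y z. y \<in> B \<Longrightarrow> z \<in> N y \<Longrightarrow> r - D y \<le> \<rho> y z"
    and moment: "\<And>y. y \<in> B \<Longrightarrow>
       (\<Sum>z\<in>B. c y z * m z * (\<rho> y z)\<^sup>2) + (\<Sum>z\<in>N y. c y z * m z * (\<rho> y z)\<^sup>2) \<le> K"
  shows "- energy p D + r * (\<Sum>y\<in>B. m y * k y * p y)
    \<le> L * energy p (\<lambda>y. ln (1 + p y / u)) + K * (1 + u * (\<Sum>y\<in>B. m y)) / (4 * L) + F"
proof -
  define l where "l y = ln (1 + p y / u)" for y
  have l0: "0 \<le> l y" if "y \<in> B" for y using p[OF that] u by (simp add: l_def)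
  have F0: "0 \<le> F" if "y \<in> B" for y using order_trans[OF _ kf(2)[OF that]] kf(1)[OF that] r by simp
  have inner: "- (\<Sum>y\<in>B. \<Sum>z\<in>B. c y z * m y * m z * (p y - p z) * (D y - D z)) / 2
    \<le> L * ((\<Sum>y\<in>B. \<Sum>z\<in>B. c y z * m y * m z * (p y - p z) * (l y - l z)) / 2)
      + (\<Sum>y\<in>B. m y * (p y + u) * (\<Sum>z\<in>B. c y z * m z * (\<rho> y z)\<^sup>2)) / (4 * L)"
  proof -
    define Q where "Q y z = c y z * m y * m z * (\<rho> y z)\<^sup>2" for y z
    have "- (\<Sum>y\<in>B. \<Sum>z\<in>B. c y z * m y * m z * (p y - p z) * (D y - D z))
      = (\<Sum>y\<in>B. \<Sum>z\<in>B. c y z * m y * m z * ((p y - p z) * (D z - D y)))"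
      unfolding sum_negf[symmetric] by (intro sum.cong refl) (simp add: algebra_simps)
    also have "\<dots> \<le> (\<Sum>y\<in>B. \<Sum>z\<in>B. c y z * m y * m z *
        (L * ((p y - p z) * (l y - l z)) + (\<rho> y z)\<^sup>2 * ((p y + u) + (p z + u)) / (4 * L)))"
    proof (intro sum_mono mult_left_mono)
      fix y z assume yz: "y \<in> B" "z \<in> B"
      show "0 \<le> c y z * m y * m z" using yz c_nonneg m_pos by (simp add: less_imp_le)
      have "(p y - p z) * (D z - D y) \<le> L * ((p y - p z) * (l y - l z)) + (\<rho> y z)\<^sup>2 * (p y + p z + u) / (4 * L)"
        unfolding l_def using yz p u L D_lip[of z y] \<rho>_sym by (intro edge_flux_bound) auto
      also have "(\<rho> y z)\<^sup>2 * (p y + p z + u) / (4 * L) \<le> (\<rho> y z)\<^sup>2 * ((p y + u) + (p z + u)) / (4 * L)"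
        using u L by (intro divide_right_mono mult_left_mono) auto
      finally show "(p y - p z) * (D z - D y) \<le> L * ((p y - p z) * (l y - l z)) + (\<rho> y z)\<^sup>2 * ((p y + u) + (p z + u)) / (4 * L)"
        by simp
    qed
    also have "\<dots> = (\<Sum>y\<in>B. \<Sum>z\<in>B. L * (c y z * m y * m z * (p y - p z) * (l y - l z))
      + (Q y z * (p y + u) + Q y z * (p z + u)) / (4 * L))"
      using L by (intro sum.cong refl) (simp add: Q_def divide_simps, simp add: algebra_simps)
    also have "\<dots> = L * (\<Sum>y\<in>B. \<Sum>z\<in>B. c y z * m y * m z * (p y - p z) * (l y - l z))
      + ((\<Sum>y\<in>B. \<Sum>z\<in>B. Q y z * (p y + u)) + (\<Sum>y\<in>B. \<Sum>z\<in>B. Q y z * (p z + u))) / (4 * L)"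
      by (simp only: sum.distrib sum_distrib_left sum_divide_distrib add_divide_distrib)
    also have "(\<Sum>y\<in>B. \<Sum>z\<in>B. Q y z * (p z + u)) = (\<Sum>z\<in>B. \<Sum>y\<in>B. Q y z * (p z + u))"
      by (rule sum.swap)
    also have "\<dots> = (\<Sum>y\<in>B. \<Sum>z\<in>B. Q y z * (p y + u))"
      using c_sym \<rho>_sym by (intro sum.cong refl) (simp add: Q_def mult_ac)
    also have "(\<Sum>y\<in>B. \<Sum>z\<in>B. Q y z * (p y + u)) = (\<Sum>y\<in>B. m y * (p y + u) * (\<Sum>z\<in>B. c y z * m z * (\<rho> y z)\<^sup>2))"
      by (simp add: Q_def sum_distrib_left mult_ac)
    finally show ?thesis by simp
  qed
  define T where "T y = (\<Sum>z\<in>N y. c y z * m z * (\<rho> y z)\<^sup>2)" for y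
  have outer: "(\<Sum>y\<in>B. m y * k y * p y * (r - D y)) \<le> L * (\<Sum>y\<in>B. m y * k y * p y * l y)
      + (\<Sum>y\<in>B. m y * (p y + u) * T y) / (4 * L) + (\<Sum>y\<in>B. m y * p y) * F"
  proof -
    have "m y * k y * p y * (r - D y) \<le> L * (m y * k y * p y * l y)
      + m y * (p y + u) * T y / (4 * L) + m y * p y * F" if y: "y \<in> B" for y
    proof -
      define n where "n = (\<Sum>z\<in>N y. c y z * m z)"
      have k: "k y = n + kf y" using k_split[OF y] by (simp add: n_def)
      have "n * (p y * (r - D y)) = (\<Sum>z\<in>N y. c y z * m z * (p y * (r - D y)))"
        by (simp add: n_def sum_distrib_right)
      also have "\<dots> \<le> (\<Sum>z\<in>N y. c y z * m z * (L * (p y * l y) + (\<rho> y z)\<^sup>2 * (p y + u) / (4 * L)))"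
      proof (intro sum_mono mult_left_mono N_nonneg y)
        fix z assume z: "z \<in> N y"
        show "p y * (r - D y) \<le> L * (p y * l y) + (\<rho> y z)\<^sup>2 * (p y + u) / (4 * L)"
          using edge_flux_bound[of u "p y" 0 "r - D y" "\<rho> y z" L] u p[OF y] L D_out[OF y z] D(2)[OF y]
          by (simp add: l_def)
      qed
      also have "\<dots> = (\<Sum>z\<in>N y. c y z * m z * (L * (p y * l y))
          + (c y z * m z * (\<rho> y z)\<^sup>2) * ((p y + u) / (4 * L)))"
        by (intro sum.cong refl) (simp add: distrib_left mult_ac)
      also have "\<dots> = n * (L * (p y * l y)) + T y * ((p y + u) / (4 * L))"
        by (simp only: n_def T_def sum.distrib sum_distrib_right)
      also have "n * (L * (p y * l y)) \<le> k y * (L * (p y * l y))"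
        using k kf(1)[OF y] l0[OF y] p[OF y] L by (intro mult_right_mono) auto
      finally have 1: "n * (p y * (r - D y)) \<le> k y * (L * (p y * l y)) + T y * ((p y + u) / (4 * L))"
        by simp
      have "kf y * (p y * (r - D y)) \<le> kf y * (p y * r)"
        using kf(1)[OF y] p[OF y] D(1)[OF y] by (intro mult_left_mono) auto
      also have "\<dots> \<le> p y * F"
        using mult_left_mono[OF kf(2)[OF y] p[OF y]] by (simp add: mult_ac)
      finally have "k y * (p y * (r - D y)) \<le> k y * (L * (p y * l y)) + T y * ((p y + u) / (4 * L)) + p y * F"
        using 1 by (simp only: k distrib_right)
      from mult_left_mono[OF this less_imp_le[OF m_pos[OF y]]] show ?thesis
        by (simp add: distrib_left distrib_right mult_ac)
    qed
    from sum_mono[OF this] show ?thesis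
      by (simp only: sum.distrib sum_distrib_left sum_distrib_right sum_divide_distrib)
  qed
  have massF: "(\<Sum>y\<in>B. m y * p y) * F \<le> F"
  proof -
    have "0 \<le> F" using F0 \<open>B \<noteq> {}\<close> by blast
    then show ?thesis using mult_right_mono[OF mass, of F] by simp
  qed
  have "(\<Sum>y\<in>B. m y * (p y + u) * (\<Sum>z\<in>B. c y z * m z * (\<rho> y z)\<^sup>2))
     + (\<Sum>y\<in>B. m y * (p y + u) * T y)
     = (\<Sum>y\<in>B. m y * (p y + u) * ((\<Sum>z\<in>B. c y z * m z * (\<rho> y z)\<^sup>2) + T y))"
    by (simp only: sum.distrib distrib_left)
  also have "\<dots> \<le> (\<Sum>y\<in>B. m y * (p y + u) * K)"
    using moment p m_pos u unfolding T_def by (intro sum_mono mult_left_mono) (auto simp: less_imp_le)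
  also have "\<dots> = K * ((\<Sum>y\<in>B. m y * p y) + u * (\<Sum>y\<in>B. m y))"
    by (simp add: sum_distrib_left sum.distrib distrib_left mult_ac)
  also have "\<dots> \<le> K * (1 + u * (\<Sum>y\<in>B. m y))"
  proof -
    obtain y where y: "y \<in> B" using \<open>B \<noteq> {}\<close> by blast
    have "0 \<le> (\<Sum>z\<in>B. c y z * m z * (\<rho> y z)\<^sup>2) + (\<Sum>z\<in>N y. c y z * m z * (\<rho> y z)\<^sup>2)"
      using y c_nonneg m_pos N_nonneg by (intro add_nonneg_nonneg sum_nonneg) (auto simp: less_imp_le)
    then have "0 \<le> K" using moment[OF y] by simp
    then show ?thesis using mass by (intro mult_left_mono) auto
  qed
  finally have sum_K: "((\<Sum>y\<in>B. m y * (p y + u) * (\<Sum>z\<in>B. c y z * m z * (\<rho> y z)\<^sup>2))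
     + (\<Sum>y\<in>B. m y * (p y + u) * T y)) / (4 * L) \<le> K * (1 + u * (\<Sum>y\<in>B. m y)) / (4 * L)"
    using L by (intro divide_right_mono) auto
  have eq1: "- energy p D + r * (\<Sum>y\<in>B. m y * k y * p y) =
     - (\<Sum>y\<in>B. \<Sum>z\<in>B. c y z * m y * m z * (p y - p z) * (D y - D z)) / 2
     + (r * (\<Sum>y\<in>B. m y * k y * p y) - (\<Sum>y\<in>B. m y * k y * p y * D y))"
    by (simp add: energy_def)
  have eq2: "r * (\<Sum>y\<in>B. m y * k y * p y) - (\<Sum>y\<in>B. m y * k y * p y * D y) = (\<Sum>y\<in>B. m y * k y * p y * (r - D y))"
    unfolding sum_distrib_left sum_subtractf[symmetric] by (intro sum.cong refl) (simp add: algebra_simps)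
  have "- energy p D + r * (\<Sum>y\<in>B. m y * k y * p y) \<le> L * energy p l + K * (1 + u * (\<Sum>y\<in>B. m y)) / (4 * L) + F"
    unfolding eq1 eq2 using add_mono[OF inner outer] massF sum_K
    unfolding energy_def distrib_left[of L] add_divide_distrib by linarith
  then show ?thesis unfolding l_def .
qed

end

lemma ln_one_plus_tangent:
  assumes "0 \<le> a" "0 \<le> b" shows "ln (1 + a) \<le> ln (1 + b) + (a - b) / (1 + b :: real)"
proof -
  have "ln ((1 + a) / (1 + b)) \<le> (1 + a) / (1 + b) - 1" using assms by (intro ln_le_minus_one) auto
  also have "\<dots> = (a - b) / (1 + b)" using assms by (simp add: field_simps)
  finally show ?thesis using assms by (simp add: ln_div)
qed

context killed_chain begin

text \<open>Jensen's inequality for the logarithm and the measure with weights \<open>m y * p y\<close>, in the form of its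
  tangent at the mean of \<open>p / u\<close>. The summand \<open>1\<close> pays for this measure not being normalised.\<close>

lemma entropy_le_l2:
  assumes u: "0 < u" and p: "\<And>y. y \<in> B \<Longrightarrow> 0 \<le> p y" and mass: "(\<Sum>y\<in>B. m y * p y) \<le> 1"
  shows "(\<Sum>y\<in>B. m y * entropy_density u (p y)) \<le> ln (1 + (\<Sum>y\<in>B. m y * (p y)\<^sup>2) / u) + 1"
proof -
  define b where "b = (\<Sum>y\<in>B. m y * (p y)\<^sup>2) / u"
  have b: "0 \<le> b" unfolding b_def using u m_pos by (intro divide_nonneg_pos sum_nonneg) (auto simp: less_imp_le)
  have "m y * entropy_density u (p y) \<le> m y * p y * ln (1 + b) + m y * (p y)\<^sup>2 / u / (1 + b)" if y: "y \<in> B" for y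
  proof -
    have "entropy_density u (p y) \<le> p y * ln (1 + p y / u)" by (rule entropy_density_le[OF u p[OF y]])
    also have "\<dots> \<le> p y * (ln (1 + b) + (p y / u - b) / (1 + b))"
      using p[OF y] u b by (intro mult_left_mono ln_one_plus_tangent) auto
    also have "\<dots> \<le> p y * (ln (1 + b) + p y / u / (1 + b))"
      using p[OF y] b by (intro mult_left_mono add_left_mono divide_right_mono) auto
    finally have "m y * entropy_density u (p y) \<le> m y * (p y * (ln (1 + b) + p y / u / (1 + b)))"
      using m_pos[OF y] by simp
    then show ?thesis by (simp add: distrib_left power2_eq_square mult_ac)
  qed
  from sum_mono[OF this] have "(\<Sum>y\<in>B. m y * entropy_density u (p y))
      \<le> (\<Sum>y\<in>B. m y * p y) * ln (1 + b) + b / (1 + b)"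
    by (simp only: b_def sum.distrib sum_distrib_right sum_divide_distrib)
  also have "\<dots> \<le> 1 * ln (1 + b) + 1"
    using mass b by (intro add_mono mult_right_mono) auto
  finally show ?thesis by (simp add: b_def)
qed

lemma mass_le_1:
  assumes p: "flow p" "\<And>t y. 0 \<le> t \<Longrightarrow> y \<in> B \<Longrightarrow> 0 \<le> p t y" and init: "(\<Sum>y\<in>B. m y * p 0 y) \<le> 1" and t: "0 \<le> t"
  shows "(\<Sum>y\<in>B. m y * p t y) \<le> 1"
proof -
  have "(\<Sum>y\<in>B. m y * p t y * 1) \<le> (\<Sum>y\<in>B. m y * p 0 y * 1)"
  proof (rule DERIV_nonpos_imp_nonincreasing[where f = "\<lambda>t. \<Sum>y\<in>B. m y * p t y * 1", OF t])
    fix s :: real assume s: "0 \<le> s"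
    have "0 \<le> energy (p s) (\<lambda>_. 1)"
      unfolding energy_const using s p(2) m_pos k_nonneg by (auto intro!: sum_nonneg mult_nonneg_nonneg simp: less_imp_le)
    then show "\<exists>D. ((\<lambda>t. \<Sum>y\<in>B. m y * p t y * 1) has_real_derivative D) (at s) \<and> D \<le> 0"
      using mass_deriv[OF p(1), of "\<lambda>_. 1" s] by (intro exI conjI) auto
  qed
  then show ?thesis using init by simp
qed

end

section \<open>Two differential inequalities\<close>

definition nash_constant :: "real \<Rightarrow> real \<Rightarrow> real \<Rightarrow> real" where
  "nash_constant A \<alpha> d = max (2 * A) ((\<alpha> / d * (2 * A) powr (- \<alpha> / d) / A / 2) powr (- d / \<alpha>))"

text \<open>As long as \<open>u\<close> is so large that the scale \<open>\<sigma>\<close> with \<open>2 * A * \<sigma> powr (- d) = u\<close> is below \<open>a\<close>, the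
  inequality at scale \<open>a\<close> gives exponential decay, and the burn-in hypothesis says that this regime is
  over at time \<open>s\<^sub>0\<close>. After that the optimal scale is available and \<open>u powr (- \<alpha> / d)\<close> grows at least
  linearly. If the optimal scale ever exceeds \<open>b\<close>, then \<open>u\<close> is already smaller than claimed, because
  \<open>s \<le> b powr \<alpha>\<close>.\<close>

lemma nash_decay:
  fixes u e :: "real \<Rightarrow> real" and A \<alpha> d a b s s\<^sub>0 :: real
  assumes A: "0 < A" and \<alpha>: "0 < \<alpha>" and d: "0 < d" and a: "0 < a" and ab: "a \<le> b"
    and deriv: "\<And>t. 0 \<le> t \<Longrightarrow> (u has_real_derivative - 2 * e t) (at t)"
    and e_nonneg: "\<And>t. 0 \<le> t \<Longrightarrow> 0 \<le> e t"
    and nash: "\<And>t \<sigma>. 0 \<le> t \<Longrightarrow> a \<le> \<sigma> \<Longrightarrow> \<sigma> \<le> b \<Longrightarrow> u t \<le> A * (\<sigma> powr \<alpha> * e t + \<sigma> powr (- d))"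
    and burn_in: "u 0 * exp (- s\<^sub>0 / (A * a powr \<alpha>)) \<le> 2 * A * a powr (- d)"
    and s0: "0 < s\<^sub>0" "2 * s\<^sub>0 \<le> s" and s: "s \<le> b powr \<alpha>"
  shows "u s \<le> nash_constant A \<alpha> d * s powr (- d / \<alpha>)"
proof (rule ccontr)
  assume neg: "\<not> ?thesis"
  have s_pos: "0 < s" using s0 by simp
  have mono: "u t' \<le> u t" if "0 \<le> t" "t \<le> t'" for t t'
  proof (rule DERIV_nonpos_imp_nonincreasing[OF that(2)])
    fix x assume "t \<le> x"
    then have "0 \<le> x" using that by simp
    from deriv[OF this] e_nonneg[OF this] show "\<exists>y. (u has_real_derivative y) (at x) \<and> y \<le> 0" by force
  qed
  have "b powr (- d) \<le> s powr (- d / \<alpha>)"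
  proof -
    have "b powr (- d) = (b powr \<alpha>) powr (- d / \<alpha>)" using \<alpha> by (simp add: powr_powr)
    also have "\<dots> \<le> s powr (- d / \<alpha>)"
      using s s_pos \<alpha> d by (intro powr_mono2') auto
    finally show ?thesis .
  qed
  then have "2 * A * b powr (- d) \<le> nash_constant A \<alpha> d * s powr (- d / \<alpha>)"
    using A unfolding nash_constant_def by (intro mult_mono) auto
  then have big: "2 * A * b powr (- d) < u s" using neg by simp
  have u_s: "u s \<le> u t" if "0 \<le> t" "t \<le> s" for t using mono that by blast
  have u_pos: "0 < u t" if "0 \<le> t" "t \<le> s" for t
  proof -
    have "0 \<le> 2 * A * b powr (- d)" using A by simp
    then show ?thesis using u_s[OF that] big by linarith
  qed
  have dissipation: "u t / (A * \<sigma> powr \<alpha>) \<le> 2 * e t"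
    if "0 \<le> t" "a \<le> \<sigma>" "\<sigma> \<le> b" "2 * A * \<sigma> powr (- d) \<le> u t" for t \<sigma>
  proof -
    have "0 < \<sigma>" using that a by simp
    have "u t \<le> A * \<sigma> powr \<alpha> * e t + A * \<sigma> powr (- d)"
      using nash[OF that(1-3)] by (simp add: distrib_left)
    then have "u t \<le> 2 * (A * \<sigma> powr \<alpha> * e t)" using that by simp
    then show ?thesis using A \<open>0 < \<sigma>\<close> by (simp add: pos_divide_le_eq mult_ac)
  qed
  have small: "u s\<^sub>0 \<le> 2 * A * a powr (- d)"
  proof (rule ccontr)
    assume large: "\<not> u s\<^sub>0 \<le> 2 * A * a powr (- d)"
    define q where "q = A * a powr \<alpha>"
    have q: "0 < q" using A a by (simp add: q_def)
    have "u s\<^sub>0 * exp (s\<^sub>0 / q) \<le> u 0 * exp (0 / q)"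
    proof (rule DERIV_nonpos_imp_nonincreasing[where f = "\<lambda>t. u t * exp (t / q)"])
      fix t assume t: "0 \<le> t" "t \<le> s\<^sub>0"
      have "2 * A * a powr (- d) \<le> u t" using large mono[OF t] by simp
      then have "u t / q \<le> 2 * e t" unfolding q_def using t ab by (intro dissipation) auto
      then have "(- 2 * e t + u t / q) * exp (t / q) \<le> 0" by (intro mult_nonpos_nonneg) auto
      moreover have "((\<lambda>t. u t * exp (t / q)) has_real_derivative
          (- 2 * e t + u t / q) * exp (t / q)) (at t)"
        using q by (auto intro!: derivative_eq_intros deriv t simp: algebra_simps)
      ultimately show "\<exists>y. ((\<lambda>t. u t * exp (t / q)) has_real_derivative y) (at t) \<and> y \<le> 0"
        by blast
    qed (use s0 in simp)
    then have "u s\<^sub>0 \<le> u 0 * exp (- s\<^sub>0 / q)"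
      by (simp add: exp_minus field_simps)
    then show False using burn_in large by (simp add: q_def)
  qed
  define \<kappa> where "\<kappa> = \<alpha> / d * (2 * A) powr (- \<alpha> / d) / A"
  have \<kappa>: "0 < \<kappa>" using A \<alpha> d by (simp add: \<kappa>_def)
  have "u s\<^sub>0 powr (- \<alpha> / d) - \<kappa> * s\<^sub>0 \<le> u s powr (- \<alpha> / d) - \<kappa> * s"
  proof (rule DERIV_nonneg_imp_nondecreasing[where f = "\<lambda>t. u t powr (- \<alpha> / d) - \<kappa> * t"])
    show "s\<^sub>0 \<le> s" using s0 by simp
    fix t assume t: "s\<^sub>0 \<le> t" "t \<le> s"
    then have t0: "0 \<le> t" using s0 by simp
    define \<sigma> where "\<sigma> = (u t / (2 * A)) powr (- 1 / d)"
    have ut: "0 < u t" using u_pos t0 t by simp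
    have \<sigma>d: "\<sigma> powr (- d) = u t / (2 * A)"
      using ut A d by (simp add: \<sigma>_def powr_powr)
    have \<sigma>0: "0 < \<sigma>" using ut A by (simp add: \<sigma>_def)
    have "\<sigma> powr (- d) \<le> a powr (- d)"
      unfolding \<sigma>d using small mono[of s\<^sub>0 t] s0 t A by (simp add: field_simps)
    then have 1: "a \<le> \<sigma>" using d a \<sigma>0 by (metis linorder_not_le neg_less_0_iff_less powr_less_mono2_neg)
    have "b powr (- d) \<le> \<sigma> powr (- d)"
      unfolding \<sigma>d using big u_s[OF t0] t A by (simp add: field_simps)
    then have 2: "\<sigma> \<le> b" using d a ab \<sigma>0 by (metis linorder_not_le neg_less_0_iff_less powr_less_mono2_neg less_le_trans)
    have diss: "u t / (A * \<sigma> powr \<alpha>) \<le> 2 * e t"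
      by (rule dissipation[OF t0 1 2]) (use \<sigma>d A in simp)
    have \<sigma>\<alpha>: "\<sigma> powr \<alpha> = (u t) powr (- \<alpha> / d) * (2 * A) powr (\<alpha> / d)"
    proof -
      have "\<sigma> powr \<alpha> = (u t / (2 * A)) powr (- \<alpha> / d)" by (simp add: \<sigma>_def powr_powr)
      also have "\<dots> = (u t) powr (- \<alpha> / d) / (2 * A) powr (- \<alpha> / d)"
        using ut A by (simp add: powr_divide)
      finally show ?thesis by (simp add: powr_minus_divide)
    qed
    have "\<kappa> = \<alpha> / d * u t powr (- \<alpha> / d - 1) * (u t / (A * \<sigma> powr \<alpha>))"
    proof -
      define U W where "U = u t powr (- \<alpha> / d)" and "W = (2 * A) powr (\<alpha> / d)"
      have UW: "0 < U" "0 < W" using ut A by (auto simp: U_def W_def)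
      have "u t powr (- \<alpha> / d - 1) = U / u t" using ut by (simp add: U_def powr_diff)
      moreover have "(2 * A) powr (- \<alpha> / d) = 1 / W" by (simp add: W_def powr_minus_divide)
      ultimately show ?thesis
        unfolding \<sigma>\<alpha> \<kappa>_def U_def[symmetric] W_def[symmetric] using UW ut A d by (simp add: field_simps)
    qed
    also have "\<dots> \<le> \<alpha> / d * u t powr (- \<alpha> / d - 1) * (2 * e t)"
      using diss \<alpha> d by (intro mult_left_mono) auto
    finally have "0 \<le> (- \<alpha> / d) * u t powr (- \<alpha> / d - 1) * (- 2 * e t) - \<kappa>"
      by (simp add: mult_ac)
    moreover have "((\<lambda>t. u t powr (- \<alpha> / d) - \<kappa> * t) has_real_derivative
        (- \<alpha> / d) * u t powr (- \<alpha> / d - 1) * (- 2 * e t) - \<kappa>) (at t)"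
    proof -
      have "((\<lambda>t. \<kappa> * t) has_real_derivative \<kappa>) (at t)" by (auto intro!: derivative_eq_intros)
      from DERIV_diff[OF DERIV_fun_powr[OF deriv[OF t0] ut, of "- \<alpha> / d"] this] show ?thesis by simp
    qed
    ultimately show "\<exists>y. ((\<lambda>t. u t powr (- \<alpha> / d) - \<kappa> * t) has_real_derivative y) (at t) \<and> 0 \<le> y"
      by blast
  qed
  moreover have "0 \<le> u s\<^sub>0 powr (- \<alpha> / d)" by simp
  moreover have "\<kappa> * s\<^sub>0 \<le> \<kappa> * (s / 2)" using \<kappa> s0 by (intro mult_left_mono) auto
  ultimately have "\<kappa> / 2 * s \<le> u s powr (- \<alpha> / d)" by linarith
  then have pw: "(u s powr (- \<alpha> / d)) powr (- d / \<alpha>) \<le> (\<kappa> / 2 * s) powr (- d / \<alpha>)"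
    using \<kappa> s_pos \<alpha> d by (intro powr_mono2') auto
  have "u s \<le> (\<kappa> / 2) powr (- d / \<alpha>) * s powr (- d / \<alpha>)"
  proof -
    have "(u s powr (- \<alpha> / d)) powr (- d / \<alpha>) = u s"
      using u_pos[of s] s_pos \<alpha> d by (simp add: powr_powr)
    moreover have "(\<kappa> / 2 * s) powr (- d / \<alpha>) = (\<kappa> / 2) powr (- d / \<alpha>) * s powr (- d / \<alpha>)"
      by (rule powr_mult)
    ultimately show ?thesis using pw by simp
  qed
  also have "\<dots> \<le> nash_constant A \<alpha> d * s powr (- d / \<alpha>)"
    by (intro mult_right_mono) (auto simp: nash_constant_def \<kappa>_def)
  finally show False using neg by simp
qed

text \<open>Up to time \<open>s\<^sub>1\<close> the weight \<open>L\<close> is constant and only the initial entropy is used. Afterwards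
  \<open>L = sqrt (t / T)\<close>; the growth of \<open>L\<close> costs \<open>\<Phi>\<close> times the derivative of \<open>L\<close>, which is integrable
  against the logarithmic bound on \<open>\<Phi>\<close>. The function subtracted in the second stage is the
  explicit primitive of these costs. A constant \<open>L\<close> throughout would leave a logarithm of \<open>T / s\<^sub>1\<close>.\<close>

lemma entropy_flux_integration:
  fixes N N' \<Phi> \<Phi>' :: "real \<Rightarrow> real"
  assumes N: "\<And>t. 0 \<le> t \<Longrightarrow> (N has_real_derivative N' t) (at t)"
    and \<Phi>: "\<And>t. 0 \<le> t \<Longrightarrow> (\<Phi> has_real_derivative - \<Phi>' t) (at t)"
    and flux: "\<And>t L. 0 \<le> t \<Longrightarrow> 0 < L \<Longrightarrow> N' t \<le> L * \<Phi>' t + k / (L * T) + k / T"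
    and N0: "N 0 = 0" and \<Phi>0: "\<Phi> 0 \<le> \<Phi>\<^sub>0" and \<Phi>_nonneg: "\<And>t. 0 \<le> t \<Longrightarrow> 0 \<le> \<Phi> t"
    and \<Phi>_log: "\<And>t. s\<^sub>1 \<le> t \<Longrightarrow> t \<le> T \<Longrightarrow> \<Phi> t \<le> a + b * ln (T / t)"
    and k: "0 \<le> k" and b: "0 \<le> b" and s1: "0 < s\<^sub>1" and t: "s\<^sub>1 \<le> t" "t \<le> T"
  shows "N t \<le> sqrt (s\<^sub>1 / T) * (\<Phi>\<^sub>0 + 2 * k) + sqrt (t / T) * (a + b * ln (T / t) + 2 * b + 2 * k) + k * (t / T)"
proof -
  have T: "0 < T" using s1 t by simp
  define L where "L = sqrt (s\<^sub>1 / T)"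
  have L: "0 < L" "L \<le> 1" "L * L = s\<^sub>1 / T" using s1 T t by (auto simp: L_def)
  have "N s\<^sub>1 + L * \<Phi> s\<^sub>1 - (k / (L * T) + k / T) * s\<^sub>1 \<le> N 0 + L * \<Phi> 0 - (k / (L * T) + k / T) * 0"
  proof (rule DERIV_nonpos_imp_nonincreasing[where f = "\<lambda>x. N x + L * \<Phi> x - (k / (L * T) + k / T) * x"])
    fix x assume x: "0 \<le> x" "x \<le> s\<^sub>1"
    have "((\<lambda>x. N x + L * \<Phi> x - (k / (L * T) + k / T) * x) has_real_derivative
        (N' x + L * - \<Phi>' x - (k / (L * T) + k / T))) (at x)"
      by (auto intro!: derivative_eq_intros N \<Phi> x)
    moreover have "N' x + L * - \<Phi>' x - (k / (L * T) + k / T) \<le> 0" using flux[OF x(1) L(1)] by simp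
    ultimately show "\<exists>y. ((\<lambda>x. N x + L * \<Phi> x - (k / (L * T) + k / T) * x) has_real_derivative y) (at x) \<and> y \<le> 0"
      by blast
  qed (use s1 in simp)
  moreover have "(k / (L * T) + k / T) * s\<^sub>1 = k * L + k * (L * L)"
  proof -
    have e: "s\<^sub>1 = L * L * T" using L T by simp
    show ?thesis unfolding e using L(1) T by (simp add: field_simps)
  qed
  moreover have "k * (L * L) \<le> k * L"
    using mult_left_le[OF L(2) less_imp_le[OF L(1)]] k by (intro mult_left_mono) auto
  moreover have "L * \<Phi> 0 \<le> L * \<Phi>\<^sub>0" using L \<Phi>0 by (intro mult_left_mono) auto
  moreover have "0 \<le> L * \<Phi> s\<^sub>1" using L \<Phi>_nonneg s1 by simp
  ultimately have N1: "N s\<^sub>1 \<le> L * \<Phi>\<^sub>0 + 2 * (k * L)" using N0 by linarith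
  define H where "H x = sqrt (x / T) * (a + b * ln (T / x) + 2 * b + 2 * k) + k * (x / T)" for x
  have "N t + sqrt (t / T) * \<Phi> t - H t \<le> N s\<^sub>1 + sqrt (s\<^sub>1 / T) * \<Phi> s\<^sub>1 - H s\<^sub>1"
  proof (rule DERIV_nonpos_imp_nonincreasing[where f = "\<lambda>x. N x + sqrt (x / T) * \<Phi> x - H x", OF t(1)])
    fix x assume x: "s\<^sub>1 \<le> x" "x \<le> t"
    then have x0: "0 < x" "0 \<le> x" "x \<le> T" using s1 t by auto
    define q where "q = sqrt (x / T)"
    have q: "0 < q" "q * q = x / T" using x0 T by (auto simp: q_def)
    have dq: "((\<lambda>x. sqrt (x / T)) has_real_derivative 1 / (2 * T * q)) (at x)"
      using x0 T by (auto intro!: derivative_eq_intros simp: q_def divide_simps)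
    have dl: "((\<lambda>x. ln (T / x)) has_real_derivative - 1 / x) (at x)"
      using x0 T by (auto intro!: derivative_eq_intros simp: divide_simps)
    have qx: "q / x = 1 / (T * q)" using q x0 T by (simp add: field_simps)
    have dH: "(H has_real_derivative
        (1 / (2 * T * q)) * (a + b * ln (T / x) + 2 * b + 2 * k) + (b * (- 1 / x)) * q + k * (1 / T)) (at x)"
    proof -
      have "((\<lambda>x. b * ln (T / x) + (a + 2 * b + 2 * k)) has_real_derivative b * (- 1 / x) + 0) (at x)"
        by (intro DERIV_add DERIV_cmult dl DERIV_const)
      note D2 = this
      have D3: "((\<lambda>x. x / T) has_real_derivative 1 / T) (at x)"
        using T by (auto intro!: derivative_eq_intros)
      from DERIV_add[OF DERIV_mult[OF dq D2] DERIV_cmult[OF D3, of k]]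
      show ?thesis unfolding H_def q_def by (simp add: add_ac)
    qed
    have "(N has_real_derivative N' x) (at x)" "(\<Phi> has_real_derivative - \<Phi>' x) (at x)"
      using N \<Phi> x0 by auto
    from DERIV_diff[OF DERIV_add[OF this(1) DERIV_mult[OF dq this(2)]] dH]
    have D: "((\<lambda>x. N x + sqrt (x / T) * \<Phi> x - H x) has_real_derivative
      N' x + (1 / (2 * T * q) * \<Phi> x + - \<Phi>' x * q) -
      ((1 / (2 * T * q)) * (a + b * ln (T / x) + 2 * b + 2 * k) + (b * (- 1 / x)) * q + k * (1 / T))) (at x)"
      by (simp add: q_def)
    have bq: "(b * (- 1 / x)) * q = - (1 / (2 * T * q)) * (2 * b)"
    proof -
      have "(b * (- 1 / x)) * q = - b * (q / x)" by simp
      also have "\<dots> = - (1 / (2 * T * q)) * (2 * b)" unfolding qx using T q by (simp add: field_simps)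
      finally show ?thesis .
    qed
    have "1 / (2 * T * q) * \<Phi> x \<le> 1 / (2 * T * q) * (a + b * ln (T / x))"
      using \<Phi>_log[of x] x x0 T q by (intro mult_left_mono) auto
    moreover have "N' x \<le> q * \<Phi>' x + k / (q * T) + k / T" using flux x0 q by auto
    moreover have "k / (q * T) = 1 / (2 * T * q) * (2 * k)" using q T by (simp add: field_simps)
    ultimately have "N' x + (1 / (2 * T * q) * \<Phi> x + - \<Phi>' x * q) -
      ((1 / (2 * T * q)) * (a + b * ln (T / x) + 2 * b + 2 * k) + (b * (- 1 / x)) * q + k * (1 / T)) \<le> 0"
      unfolding bq by (simp only: distrib_left minus_mult_left[symmetric]) (simp add: mult_ac)
    then show "\<exists>y. ((\<lambda>x. N x + sqrt (x / T) * \<Phi> x - H x) has_real_derivative y) (at x) \<and> y \<le> 0"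
      using D by blast
  qed
  moreover have "sqrt (s\<^sub>1 / T) * \<Phi> s\<^sub>1 \<le> H s\<^sub>1"
  proof -
    have "sqrt (s\<^sub>1 / T) * \<Phi> s\<^sub>1 \<le> sqrt (s\<^sub>1 / T) * (a + b * ln (T / s\<^sub>1) + 2 * b + 2 * k)"
      using \<Phi>_log[of s\<^sub>1] t s1 T b k by (intro mult_left_mono) auto
    then show ?thesis using k s1 T by (simp add: H_def add_increasing2)
  qed
  moreover have "0 \<le> sqrt (t / T) * \<Phi> t" using \<Phi>_nonneg[of t] s1 t T by simp
  ultimately show ?thesis using N1 by (simp add: H_def L_def distrib_left mult_ac)
qed

section \<open>Jump chains with exponential waiting times\<close>

text \<open>A rate \<open>l\<close> and a stochastic kernel \<open>p\<close>. Total mass one is expressed by finite partial sums, so that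
  no countability of \<open>V\<close> is involved.\<close>

locale jump_chain = finite_measure M for M :: "'o measure" +
  fixes V :: "'v set" and l :: "'v \<Rightarrow> real" and p :: "'v \<Rightarrow> 'v \<Rightarrow> real"
  assumes l_nonneg: "\<And>x. x \<in> V \<Longrightarrow> 0 \<le> l x"
    and p_nonneg: "\<And>x z. x \<in> V \<Longrightarrow> z \<in> V \<Longrightarrow> 0 \<le> p x z"
    and p_le_1: "\<And>x F. x \<in> V \<Longrightarrow> finite F \<Longrightarrow> F \<subseteq> V \<Longrightarrow> (\<Sum>z\<in>F. p x z) \<le> 1"
    and p_total: "\<And>x e. x \<in> V \<Longrightarrow> 0 < e \<Longrightarrow> \<exists>F\<subseteq>V. finite F \<and> 1 - e < (\<Sum>z\<in>F. p x z)"
begin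

text \<open>On the event \<open>A\<close>, up to the factor \<open>c\<close>, the sequences \<open>Y\<close> and \<open>S\<close> have the law of the jump chain
  started at \<open>x\<close>. Working with an event of a fixed measure, not with conditional measures, lets the
  same probability space serve for all restarted chains.\<close>

definition jump_law :: "'o set \<Rightarrow> (nat \<Rightarrow> 'o \<Rightarrow> 'v) \<Rightarrow> (nat \<Rightarrow> 'o \<Rightarrow> ennreal) \<Rightarrow> 'v \<Rightarrow> real \<Rightarrow> bool" where
  "jump_law A Y S x c \<longleftrightarrow> A \<in> sets M \<and>
    (\<forall>n. Y n \<in> measurable M (count_space V)) \<and> (\<forall>n. S n \<in> borel_measurable M) \<and>
    (\<forall>n y s. (\<forall>i\<le>n. y i \<in> V \<and> 0 \<le> s i) \<longrightarrow>
      measure M {\<omega> \<in> A. \<forall>i\<le>n. Y i \<omega> = y i \<and> ennreal (s i) < S i \<omega>} =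
        c * of_bool (y 0 = x) * (\<Prod>i<n. p (y i) (y (Suc i))) * (\<Prod>i\<le>n. exp (- l (y i) * s i)))"

lemma jump_lawD:
  assumes "jump_law A Y S x c"
  shows "A \<in> sets M" "Y n \<in> measurable M (count_space V)" "S n \<in> borel_measurable M"
    "(\<And>i. i \<le> n \<Longrightarrow> y i \<in> V) \<Longrightarrow> (\<And>i. i \<le> n \<Longrightarrow> 0 \<le> s i) \<Longrightarrow>
      measure M {\<omega> \<in> A. \<forall>i\<le>n. Y i \<omega> = y i \<and> ennreal (s i) < S i \<omega>} =
        c * of_bool (y 0 = x) * (\<Prod>i<n. p (y i) (y (Suc i))) * (\<Prod>i\<le>n. exp (- l (y i) * s i))"
  using assms unfolding jump_law_def by blast+

lemma sets_visit:
  assumes "jump_law A Y S x c" "D \<in> sets M"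
  shows "{\<omega> \<in> D. Y i \<omega> = y} \<in> sets M"
proof -
  have sp: "\<And>\<omega>. \<omega> \<in> D \<Longrightarrow> \<omega> \<in> space M" using sets.sets_into_space[OF assms(2)] by auto
  have "{\<omega> \<in> D. Y i \<omega> = y} = D \<inter> (Y i -` ({y} \<inter> V) \<inter> space M)"
    using measurable_space[OF jump_lawD(2)[OF assms(1)]] sp by auto
  also have "\<dots> \<in> sets M"
    by (rule sets.Int[OF assms(2) measurable_sets[OF jump_lawD(2)[OF assms(1)]]]) simp
  finally show ?thesis .
qed

lemma sets_wait:
  assumes "jump_law A Y S x c" "D \<in> sets M"
  shows "{\<omega> \<in> D. a < S i \<omega>} \<in> sets M"
proof -
  note [measurable] = jump_lawD[OF assms(1)] assms(2)
  have sp: "\<And>\<omega>. \<omega> \<in> D \<Longrightarrow> \<omega> \<in> space M" using sets.sets_into_space[OF assms(2)] by auto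
  have "{\<omega> \<in> D. a < S i \<omega>} = D \<inter> {\<omega> \<in> space M. a < S i \<omega>}"
    using sp by auto
  also have "\<dots> \<in> sets M" by measurable
  finally show ?thesis .
qed

lemma first_wait:
  assumes "jump_law A Y S x c" "x \<in> V" "0 \<le> a"
  shows "measure M {\<omega> \<in> A. Y 0 \<omega> = x \<and> ennreal a < S 0 \<omega>} = c * exp (- l x * a)"
  using jump_lawD(4)[OF assms(1), of 0 "\<lambda>_. x" "\<lambda>_. a"] assms by simp

lemma mass_nonneg:
  assumes "jump_law A Y S x c" "x \<in> V" shows "0 \<le> c"
proof -
  have "c = measure M {\<omega> \<in> A. Y 0 \<omega> = x \<and> ennreal 0 < S 0 \<omega>}"
    using first_wait[OF assms, of 0] by simp
  then show ?thesis by (simp only: measure_nonneg)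
qed

text \<open>Lack of memory of the first waiting time.\<close>

lemma jump_law_wait:
  assumes J: "jump_law A Y S x c" and x: "x \<in> V" and h: "0 \<le> h"
  shows "jump_law {\<omega> \<in> A. ennreal h < S 0 \<omega>} Y (S(0 := \<lambda>\<omega>. S 0 \<omega> - ennreal h)) x (c * exp (- l x * h))"
  unfolding jump_law_def
proof (intro conjI allI impI)
  show "{\<omega> \<in> A. ennreal h < S 0 \<omega>} \<in> sets M" by (rule sets_wait[OF J jump_lawD(1)[OF J]])
  show "Y n \<in> measurable M (count_space V)" for n by (rule jump_lawD[OF J])
  note [measurable] = jump_lawD(3)[OF J]
  show "(S(0 := \<lambda>\<omega>. S 0 \<omega> - ennreal h)) n \<in> borel_measurable M" for n
    by (cases n) auto
  fix n y and s :: "nat \<Rightarrow> real" assume ys: "\<forall>i\<le>n. y i \<in> V \<and> 0 \<le> s i"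
  define s' where "s' = s(0 := s 0 + h)"
  have "{\<omega> \<in> {\<omega> \<in> A. ennreal h < S 0 \<omega>}. \<forall>i\<le>n. Y i \<omega> = y i \<and> ennreal (s i) < (S(0 := \<lambda>\<omega>. S 0 \<omega> - ennreal h)) i \<omega>}
    = {\<omega> \<in> A. \<forall>i\<le>n. Y i \<omega> = y i \<and> ennreal (s' i) < S i \<omega>}"
  proof -
    have "ennreal (s 0) < S 0 \<omega> - ennreal h \<and> ennreal h < S 0 \<omega> \<longleftrightarrow> ennreal (s 0 + h) < S 0 \<omega>" for \<omega>
    proof -
      have s0: "0 \<le> s 0" using ys by auto
      then have "ennreal h \<le> ennreal (s 0 + h)" by (simp add: ennreal_leI)
      then show ?thesis using s0 h
          le_less_trans[OF \<open>ennreal h \<le> ennreal (s 0 + h)\<close>, of "S 0 \<omega>"]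
        by (auto simp: less_diff_eq_ennreal ennreal_plus[symmetric] simp del: ennreal_plus)
    qed
    then show ?thesis by (auto simp: s'_def)
  qed
  moreover have "measure M {\<omega> \<in> A. \<forall>i\<le>n. Y i \<omega> = y i \<and> ennreal (s' i) < S i \<omega>} =
      c * of_bool (y 0 = x) * (\<Prod>i<n. p (y i) (y (Suc i))) * (\<Prod>i\<le>n. exp (- l (y i) * s' i))"
    using ys h by (intro jump_lawD(4)[OF J]) (auto simp: s'_def)
  moreover have "(\<Prod>i\<le>n. exp (- l (y i) * s' i)) = exp (- l (y 0) * h) * (\<Prod>i\<le>n. exp (- l (y i) * s i))"
    by (simp add: prod.atMost_shift s'_def exp_add[symmetric] algebra_simps)
  ultimately show "measure M {\<omega> \<in> {\<omega> \<in> A. ennreal h < S 0 \<omega>}. \<forall>i\<le>n. Y i \<omega> = y i \<and> ennreal (s i) < (S(0 := \<lambda>\<omega>. S 0 \<omega> - ennreal h)) i \<omega>}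
    = c * exp (- l x * h) * of_bool (y 0 = x) * (\<Prod>i<n. p (y i) (y (Suc i))) * (\<Prod>i\<le>n. exp (- l (y i) * s i))"
    by simp
qed

text \<open>The Markov property at the first jump. Fixing a lower bound for the first waiting time merely
  prepends one factor to the product formula.\<close>

lemma jump_law_step:
  assumes J: "jump_law A Y S x c" and x: "x \<in> V" "z \<in> V" and a: "0 \<le> a"
  shows "jump_law {\<omega> \<in> A. Y 0 \<omega> = x \<and> ennreal a < S 0 \<omega> \<and> Y 1 \<omega> = z}
    (\<lambda>n. Y (Suc n)) (\<lambda>n. S (Suc n)) z (c * exp (- l x * a) * p x z)"
  unfolding jump_law_def
proof (intro conjI allI impI)
  have "{\<omega> \<in> A. Y 0 \<omega> = x \<and> ennreal a < S 0 \<omega> \<and> Y 1 \<omega> = z}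
     = {\<omega> \<in> {\<omega> \<in> {\<omega> \<in> A. Y 0 \<omega> = x}. ennreal a < S 0 \<omega>}. Y 1 \<omega> = z}" by auto
  also have "\<dots> \<in> sets M"
    by (intro sets_visit[OF J] sets_wait[OF J] jump_lawD(1)[OF J])
  finally show "{\<omega> \<in> A. Y 0 \<omega> = x \<and> ennreal a < S 0 \<omega> \<and> Y 1 \<omega> = z} \<in> sets M" .
  show "Y (Suc n) \<in> measurable M (count_space V)" "S (Suc n) \<in> borel_measurable M" for n
    by (rule jump_lawD[OF J])+
  fix n y and s :: "nat \<Rightarrow> real" assume ys: "\<forall>i\<le>n. y i \<in> V \<and> 0 \<le> s i"
  define y' where "y' = case_nat x y"
  define s' where "s' = case_nat a s"
  let ?E = "{\<omega> \<in> {\<omega> \<in> A. Y 0 \<omega> = x \<and> ennreal a < S 0 \<omega> \<and> Y 1 \<omega> = z}.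
    \<forall>i\<le>n. Y (Suc i) \<omega> = y i \<and> ennreal (s i) < S (Suc i) \<omega>}"
  show "measure M ?E = c * exp (- l x * a) * p x z * of_bool (y 0 = z) *
      (\<Prod>i<n. p (y i) (y (Suc i))) * (\<Prod>i\<le>n. exp (- l (y i) * s i))"
  proof (cases "y 0 = z")
    case True
    have all: "(\<forall>i\<le>Suc n. P i) \<longleftrightarrow> P 0 \<and> (\<forall>i\<le>n. P (Suc i))" for P
      by (simp add: less_Suc_eq_le[symmetric] All_less_Suc2)
    have "?E = {\<omega> \<in> A. \<forall>i\<le>Suc n. Y i \<omega> = y' i \<and> ennreal (s' i) < S i \<omega>}"
      unfolding all using True by (auto simp: y'_def s'_def)
    moreover have "measure M {\<omega> \<in> A. \<forall>i\<le>Suc n. Y i \<omega> = y' i \<and> ennreal (s' i) < S i \<omega>} =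
      c * of_bool (y' 0 = x) * (\<Prod>i<Suc n. p (y' i) (y' (Suc i))) * (\<Prod>i\<le>Suc n. exp (- l (y' i) * s' i))"
      using ys x a by (intro jump_lawD(4)[OF J]) (auto simp: y'_def s'_def split: nat.split)
    moreover have "(\<Prod>i<Suc n. p (y' i) (y' (Suc i))) = p x z * (\<Prod>i<n. p (y i) (y (Suc i)))"
      using True by (simp add: prod.lessThan_Suc_shift y'_def del: prod.lessThan_Suc)
    moreover have "(\<Prod>i\<le>Suc n. exp (- l (y' i) * s' i)) = exp (- l x * a) * (\<Prod>i\<le>n. exp (- l (y i) * s i))"
      by (simp add: prod.atMost_Suc_shift y'_def s'_def del: prod.atMost_Suc)
    ultimately show ?thesis using True by (simp add: y'_def)
  next
    case False
    then have e: "?E = {}" by auto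
    show ?thesis unfolding e using False by simp
  qed
qed

lemma jump_law_diff:
  assumes 1: "jump_law A Y S x c" and 2: "jump_law A' Y S x c'" and sub: "A' \<subseteq> A"
  shows "jump_law (A - A') Y S x (c - c')"
  unfolding jump_law_def
proof (intro conjI allI impI)
  show "A - A' \<in> sets M" using jump_lawD(1)[OF 1] jump_lawD(1)[OF 2] by auto
  show "Y n \<in> measurable M (count_space V)" "S n \<in> borel_measurable M" for n
    by (rule jump_lawD[OF 1])+
  fix n y and s :: "nat \<Rightarrow> real" assume ys: "\<forall>i\<le>n. y i \<in> V \<and> 0 \<le> s i"
  let ?E = "\<lambda>A. {\<omega> \<in> A. \<forall>i\<le>n. Y i \<omega> = y i \<and> ennreal (s i) < S i \<omega>}"
  have sets: "?E A \<in> sets M" if "jump_law A Y S x c" for A c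
  proof -
    have "?E A = A \<inter> (\<Inter>i\<in>{..n}. {\<omega> \<in> {\<omega> \<in> A. Y i \<omega> = y i}. ennreal (s i) < S i \<omega>})" by auto
    also have "\<dots> \<in> sets M"
      by (intro sets.Int jump_lawD(1)[OF that] sets.finite_INT sets_visit[OF that] sets_wait[OF that]) auto
    finally show ?thesis .
  qed
  have m: "measure M (?E A) = c * of_bool (y 0 = x) * (\<Prod>i<n. p (y i) (y (Suc i))) * (\<Prod>i\<le>n. exp (- l (y i) * s i))"
    by (rule jump_lawD(4)[OF 1]) (use ys in auto)
  have m': "measure M (?E A') = c' * of_bool (y 0 = x) * (\<Prod>i<n. p (y i) (y (Suc i))) * (\<Prod>i\<le>n. exp (- l (y i) * s i))"
    by (rule jump_lawD(4)[OF 2]) (use ys in auto)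
  have e: "?E (A - A') = ?E A - ?E A'" by auto
  have "measure M (?E A - ?E A') = measure M (?E A) - measure M (?E A')"
    by (rule finite_measure_Diff[OF sets[OF 1] sets[OF 2]]) (use sub in auto)
  then show "measure M (?E (A - A')) = (c - c') * of_bool (y 0 = x) * (\<Prod>i<n. p (y i) (y (Suc i))) * (\<Prod>i\<le>n. exp (- l (y i) * s i))"
    by (simp only: e m m' left_diff_distrib)
qed

text \<open>The difference of two instances of \<open>jump_law_step\<close>: the first jump happens in a given time interval.\<close>

lemma jump_law_early_step:
  assumes J: "jump_law A Y S x c" and x: "x \<in> V" "z \<in> V" and h: "0 \<le> h"
  shows "jump_law {\<omega> \<in> A. Y 0 \<omega> = x \<and> 0 < S 0 \<omega> \<and> S 0 \<omega> \<le> ennreal h \<and> Y 1 \<omega> = z}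
    (\<lambda>n. Y (Suc n)) (\<lambda>n. S (Suc n)) z (c * (1 - exp (- l x * h)) * p x z)"
proof -
  have "jump_law ({\<omega> \<in> A. Y 0 \<omega> = x \<and> ennreal 0 < S 0 \<omega> \<and> Y 1 \<omega> = z} - {\<omega> \<in> A. Y 0 \<omega> = x \<and> ennreal h < S 0 \<omega> \<and> Y 1 \<omega> = z})
    (\<lambda>n. Y (Suc n)) (\<lambda>n. S (Suc n)) z (c * exp (- l x * 0) * p x z - c * exp (- l x * h) * p x z)"
    by (intro jump_law_diff jump_law_step[OF J] x h) (auto simp: zero_less_iff_neq_zero)
  also have "{\<omega> \<in> A. Y 0 \<omega> = x \<and> ennreal 0 < S 0 \<omega> \<and> Y 1 \<omega> = z} - {\<omega> \<in> A. Y 0 \<omega> = x \<and> ennreal h < S 0 \<omega> \<and> Y 1 \<omega> = z}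
    = {\<omega> \<in> A. Y 0 \<omega> = x \<and> 0 < S 0 \<omega> \<and> S 0 \<omega> \<le> ennreal h \<and> Y 1 \<omega> = z}" by auto
  finally show ?thesis by (simp add: algebra_simps)
qed

text \<open>The event that \<open>Y\<close> is still in \<open>B\<close> at time \<open>t\<close> and has never been outside, expressed by a finite
  number of jumps.\<close>

definition survival :: "'v set \<Rightarrow> (nat \<Rightarrow> 'o \<Rightarrow> 'v) \<Rightarrow> (nat \<Rightarrow> 'o \<Rightarrow> ennreal) \<Rightarrow> real \<Rightarrow> 'o set \<Rightarrow> 'o set" where
  "survival B Y S t A = {\<omega> \<in> A. \<exists>n. (\<forall>i\<le>n. Y i \<omega> \<in> B) \<and> ennreal t < (\<Sum>i\<le>n. S i \<omega>)}"

lemma sets_survival: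
  assumes J: "jump_law A Y S x c" and B: "B \<subseteq> V"
  shows "survival B Y S t A \<in> sets M"
proof -
  note [measurable] = jump_lawD[OF J]
  have sub: "A \<subseteq> space M" using jump_lawD(1)[OF J] by (rule sets.sets_into_space)
  have [measurable]: "{\<omega> \<in> space M. Y i \<omega> \<in> B} \<in> sets M" for i
  proof -
    have "Y i -` B \<inter> space M \<in> sets M" by (rule measurable_sets[OF jump_lawD(2)[OF J]]) (use B in simp)
    then show ?thesis by (simp add: vimage_def Int_def conj_commute)
  qed
  have "survival B Y S t A = A \<inter> {\<omega> \<in> space M. \<exists>n. (\<forall>i\<le>n. \<omega> \<in> {\<omega> \<in> space M. Y i \<omega> \<in> B}) \<and> ennreal t < (\<Sum>i\<le>n. S i \<omega>)}"
    using sub by (auto simp: survival_def)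
  also have "\<dots> \<in> sets M" by measurable
  finally show ?thesis .
qed

lemma survival_wait:
  assumes "0 \<le> t" "0 \<le> h"
  shows "survival B Y (S(0 := \<lambda>\<omega>. S 0 \<omega> - ennreal h)) t {\<omega> \<in> A. ennreal h < S 0 \<omega>} \<subseteq> survival B Y S (t + h) A"
proof
  fix \<omega> assume "\<omega> \<in> survival B Y (S(0 := \<lambda>\<omega>. S 0 \<omega> - ennreal h)) t {\<omega> \<in> A. ennreal h < S 0 \<omega>}"
  then obtain n where n: "\<omega> \<in> A" "ennreal h < S 0 \<omega>" "\<forall>i\<le>n. Y i \<omega> \<in> B"
    "ennreal t < (\<Sum>i\<le>n. (S(0 := \<lambda>\<omega>. S 0 \<omega> - ennreal h)) i \<omega>)"
    by (auto simp: survival_def)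
  have "ennreal (t + h) < (\<Sum>i\<le>n. (S(0 := \<lambda>\<omega>. S 0 \<omega> - ennreal h)) i \<omega>) + ennreal h"
    using n(4) assms by (simp add: ennreal_plus add.commute[of _ "ennreal h"] ennreal_add_left_cancel_less)
  also have "\<dots> = (\<Sum>i\<le>n. S i \<omega>)"
    using n(2) by (simp add: sum.atMost_shift add_ac diff_add_cancel_ennreal less_imp_le)
  finally show "\<omega> \<in> survival B Y S (t + h) A" using n by (auto simp: survival_def)
qed

text \<open>Until time \<open>h\<close> either nothing happens, or the chain jumps to some \<open>z\<close>. In the second case the
  chain is asked to survive for a further \<open>t + h\<close>, which is longer than necessary by at most \<open>h\<close>; as the
  case itself has probability of order \<open>h\<close>, the loss is of second order.\<close>

lemma survival_step:
  assumes J: "jump_law A Y S x c" and x: "x \<in> B" and B: "B \<subseteq> V" "finite B" and t: "0 \<le> t" "0 \<le> h"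
  shows "measure M (survival B Y (S(0 := \<lambda>\<omega>. S 0 \<omega> - ennreal h)) t {\<omega> \<in> A. ennreal h < S 0 \<omega>})
    + (\<Sum>z\<in>B. measure M (survival B (\<lambda>n. Y (Suc n)) (\<lambda>n. S (Suc n)) (t + h)
         {\<omega> \<in> A. Y 0 \<omega> = x \<and> 0 < S 0 \<omega> \<and> S 0 \<omega> \<le> ennreal h \<and> Y 1 \<omega> = z}))
    \<le> measure M (survival B Y S (t + h) A)"
proof -
  define W where "W = survival B Y (S(0 := \<lambda>\<omega>. S 0 \<omega> - ennreal h)) t {\<omega> \<in> A. ennreal h < S 0 \<omega>}"
  define Z where "Z z = survival B (\<lambda>n. Y (Suc n)) (\<lambda>n. S (Suc n)) (t + h)
         {\<omega> \<in> A. Y 0 \<omega> = x \<and> 0 < S 0 \<omega> \<and> S 0 \<omega> \<le> ennreal h \<and> Y 1 \<omega> = z}" for z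
  have xV: "x \<in> V" using x B by auto
  have W: "W \<in> sets M" unfolding W_def by (rule sets_survival[OF jump_law_wait[OF J xV t(2)] B(1)])
  have Z: "Z z \<in> sets M" if "z \<in> B" for z
    unfolding Z_def using that B by (intro sets_survival[OF jump_law_early_step[OF J xV _ t(2)] B(1)]) auto
  have UZ: "(\<Union>z\<in>B. Z z) \<in> sets M" using Z B by auto
  have "Z z \<subseteq> survival B Y S (t + h) A" if "z \<in> B" for z
  proof
    fix \<omega> assume "\<omega> \<in> Z z"
    then obtain n where n: "\<omega> \<in> A" "Y 0 \<omega> = x" "\<forall>i\<le>n. Y (Suc i) \<omega> \<in> B" "ennreal (t + h) < (\<Sum>i\<le>n. S (Suc i) \<omega>)"
      by (auto simp: Z_def survival_def)
    have "\<forall>i\<le>Suc n. Y i \<omega> \<in> B"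
      unfolding less_Suc_eq_le[symmetric] All_less_Suc2 using n x by (auto simp: less_Suc_eq_le)
    moreover have "(\<Sum>i\<le>n. S (Suc i) \<omega>) \<le> (\<Sum>i\<le>Suc n. S i \<omega>)"
      by (simp add: sum.atMost_Suc_shift add_increasing del: sum.atMost_Suc)
    then have "ennreal (t + h) < (\<Sum>i\<le>Suc n. S i \<omega>)" using n(4) by (rule less_le_trans[rotated])
    ultimately show "\<omega> \<in> survival B Y S (t + h) A" using n(1) unfolding survival_def by blast
  qed
  then have sub: "W \<union> (\<Union>z\<in>B. Z z) \<subseteq> survival B Y S (t + h) A"
    using survival_wait[OF t, of B Y S A] by (auto simp: W_def)
  have "measure M W + (\<Sum>z\<in>B. measure M (Z z)) = measure M W + measure M (\<Union>z\<in>B. Z z)"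
    using Z B by (subst finite_measure_finite_Union) (auto simp: disjoint_family_on_def Z_def survival_def)
  also have "\<dots> = measure M (W \<union> (\<Union>z\<in>B. Z z))"
    using W UZ by (intro finite_measure_Union[symmetric]) (auto simp: W_def Z_def survival_def)
  also have "\<dots> \<le> measure M (survival B Y S (t + h) A)"
    by (rule finite_measure_mono[OF sub sets_survival[OF J B(1)]])
  finally show ?thesis by (simp add: W_def Z_def)
qed

text \<open>The restarted chains satisfy the same hypotheses, so an induction over the time steps shows that
  survival dominates any \<open>f\<close> that grows no faster than one step of the backward equation permits. The
  error \<open>(\<Lambda> * h)\<^sup>2\<close> of one step is of the order of the probability of two jumps.\<close>

lemma survival_euler:
  fixes f :: "nat \<Rightarrow> 'v \<Rightarrow> real"
  assumes B: "B \<subseteq> V" "finite B" and h: "0 \<le> h"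
    and rate: "\<And>z. z \<in> B \<Longrightarrow> l z \<le> \<Lambda>"
    and f: "\<And>k z. z \<in> B \<Longrightarrow> 0 \<le> f k z" "\<And>k z. z \<in> B \<Longrightarrow> f k z \<le> 1"
    and f_step: "\<And>k y. y \<in> B \<Longrightarrow> f (Suc k) y \<le> exp (- l y * h) * f k y
       + (1 - exp (- l y * h)) * (\<Sum>z\<in>B. p y z * f k z)"
  shows "jump_law A Y S x c \<Longrightarrow> x \<in> B \<Longrightarrow>
    c * (f k x - real k * (\<Lambda> * h)\<^sup>2) \<le> measure M (survival B Y S (real k * h) A)"
proof (induction k arbitrary: A Y S x c)
  case 0
  then have xV: "x \<in> V" using B by auto
  have c0: "0 \<le> c" by (rule mass_nonneg[OF 0(1) xV])
  have "c * f 0 x \<le> c * 1" using c0 f(2)[OF 0(2)] by (intro mult_left_mono)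
  also have "c * 1 = measure M {\<omega> \<in> A. Y 0 \<omega> = x \<and> ennreal 0 < S 0 \<omega>}"
    using first_wait[OF 0(1) xV, of 0] by simp
  also have "\<dots> \<le> measure M (survival B Y S 0 A)"
    using 0(2) by (intro finite_measure_mono sets_survival[OF 0(1) B(1)]) (auto simp: survival_def intro!: exI[of _ 0])
  finally show ?case by simp
next
  case (Suc k)
  note J = Suc.prems(1) and x = Suc.prems(2)
  have xV: "x \<in> V" using x B by auto
  have c0: "0 \<le> c" by (rule mass_nonneg[OF J xV])
  define e where "e z = exp (- l z * h)" for z
  define E where "E = real k * (\<Lambda> * h)\<^sup>2"
  have E: "0 \<le> E" by (simp add: E_def)
  have e: "0 \<le> e z" "e z \<le> 1" "1 - e z \<le> \<Lambda> * h" if "z \<in> B" for z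
  proof -
    have l: "0 \<le> l z" "l z \<le> \<Lambda>" using l_nonneg rate that B by auto
    show "0 \<le> e z" by (simp add: e_def)
    show "e z \<le> 1" using l h by (simp add: e_def)
    have "1 - l z * h \<le> e z" using exp_ge_add_one_self[of "- l z * h"] by (simp add: e_def)
    moreover have "l z * h \<le> \<Lambda> * h" using l h by (intro mult_right_mono) auto
    ultimately show "1 - e z \<le> \<Lambda> * h" by simp
  qed
  define J1 where "J1 z = {\<omega> \<in> A. Y 0 \<omega> = x \<and> 0 < S 0 \<omega> \<and> S 0 \<omega> \<le> ennreal h \<and> Y 1 \<omega> = z}" for z
  have kh: "0 \<le> real k * h" using h by simp
  have first: "c * e x * (f k x - E) \<le> measure M (survival B Y (S(0 := \<lambda>\<omega>. S 0 \<omega> - ennreal h)) (real k * h) {\<omega> \<in> A. ennreal h < S 0 \<omega>})"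
    unfolding e_def E_def by (rule Suc.IH[OF jump_law_wait[OF J xV h] x])
  have later: "c * (1 - e x) * p x z * (f k z - \<Lambda> * h - E) \<le>
      measure M (survival B (\<lambda>n. Y (Suc n)) (\<lambda>n. S (Suc n)) (real k * h + h) (J1 z))" if z: "z \<in> B" for z
  proof -
    have zV: "z \<in> V" using z B by auto
    have J1: "jump_law (J1 z) (\<lambda>n. Y (Suc n)) (\<lambda>n. S (Suc n)) z (c * (1 - e x) * p x z)"
      unfolding J1_def e_def by (rule jump_law_early_step[OF J xV zV h])
    have "f k z - \<Lambda> * h - E \<le> e z * (f k z - E)"
    proof -
      have "(1 - e z) * f k z \<le> (\<Lambda> * h) * 1"
        using e[OF z] f[OF z] by (intro mult_mono) auto
      moreover have "e z * E \<le> E" using e[OF z] E by (simp add: mult_left_le_one_le)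
      ultimately show ?thesis by (simp add: algebra_simps)
    qed
    then have "c * (1 - e x) * p x z * (f k z - \<Lambda> * h - E) \<le> c * (1 - e x) * p x z * (e z * (f k z - E))"
      using c0 e[OF x] p_nonneg[OF xV zV] by (intro mult_left_mono) auto
    also have "\<dots> = c * (1 - e x) * p x z * exp (- l z * h) * (f k z - real k * (\<Lambda> * h)\<^sup>2)"
      by (simp add: e_def E_def)
    also have "\<dots> \<le> measure M (survival B (\<lambda>n. Y (Suc n)) ((\<lambda>n. S (Suc n))(0 := \<lambda>\<omega>. S (Suc 0) \<omega> - ennreal h)) (real k * h) {\<omega> \<in> J1 z. ennreal h < S (Suc 0) \<omega>})"
      by (rule Suc.IH[OF jump_law_wait[OF J1 zV h] z])
    also have "\<dots> \<le> measure M (survival B (\<lambda>n. Y (Suc n)) (\<lambda>n. S (Suc n)) (real k * h + h) (J1 z))"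
      using survival_wait[OF kh h, of B "\<lambda>n. Y (Suc n)" "\<lambda>n. S (Suc n)" "J1 z"]
      by (intro finite_measure_mono sets_survival[OF J1 B(1)]) auto
    finally show ?thesis .
  qed
  have P: "(\<Sum>z\<in>B. p x z) \<le> 1" using p_le_1 xV B by auto
  have "f (Suc k) x - real (Suc k) * (\<Lambda> * h)\<^sup>2 \<le> e x * (f k x - E) + (1 - e x) * (\<Sum>z\<in>B. p x z * (f k z - \<Lambda> * h - E))"
  proof -
    define P' Q where "P' = (\<Sum>z\<in>B. p x z)" and "Q = (\<Sum>z\<in>B. p x z * f k z)"
    have s: "(\<Sum>z\<in>B. p x z * (f k z - \<Lambda> * h - E)) = Q - P' * (\<Lambda> * h + E)"
      unfolding P'_def Q_def sum_distrib_right sum_subtractf[symmetric]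
      by (intro sum.cong refl) (simp add: algebra_simps)
    have P': "0 \<le> P'" "P' \<le> 1" using P p_nonneg[OF xV] B by (auto simp: P'_def intro!: sum_nonneg)
    have "0 \<le> \<Lambda> * h" using e[OF x] by linarith
    then have 1: "(1 - e x) * (P' * (\<Lambda> * h + E)) \<le> (1 - e x) * (\<Lambda> * h + E)"
      using P' e[OF x] E by (intro mult_left_mono mult_left_le_one_le) auto
    have 2: "(1 - e x) * (\<Lambda> * h) \<le> (\<Lambda> * h) * (\<Lambda> * h)"
      using e[OF x] \<open>0 \<le> \<Lambda> * h\<close> by (intro mult_right_mono) auto
    have 3: "real (Suc k) * (\<Lambda> * h)\<^sup>2 = E + (\<Lambda> * h) * (\<Lambda> * h)"
      by (simp add: E_def algebra_simps power2_eq_square)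
    have "f (Suc k) x \<le> e x * f k x + (1 - e x) * Q"
      using f_step[OF x, of k] by (simp add: e_def Q_def)
    then show ?thesis using 1 2 unfolding s 3 by (simp add: algebra_simps)
  qed
  then have "c * (f (Suc k) x - real (Suc k) * (\<Lambda> * h)\<^sup>2)
     \<le> c * (e x * (f k x - E) + (1 - e x) * (\<Sum>z\<in>B. p x z * (f k z - \<Lambda> * h - E)))"
    using c0 by (rule mult_left_mono)
  also have "\<dots> = c * e x * (f k x - E) + (\<Sum>z\<in>B. c * (1 - e x) * p x z * (f k z - \<Lambda> * h - E))"
    by (simp add: distrib_left sum_distrib_left mult.assoc)
  also have "\<dots> \<le> measure M (survival B Y S (real k * h + h) A)"
    using add_mono[OF first sum_mono[OF later]] survival_step[OF J x B kh h]
    unfolding J1_def by (rule order_trans)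
  also have "real k * h + h = real (Suc k) * h" by (simp add: algebra_simps)
  finally show ?case .
qed

lemma survival_lower_bound:
  fixes f :: "real \<Rightarrow> 'v \<Rightarrow> real"
  assumes B: "B \<subseteq> V" "finite B"
    and f: "\<And>t z. 0 \<le> t \<Longrightarrow> z \<in> B \<Longrightarrow> 0 \<le> f t z" "\<And>t z. 0 \<le> t \<Longrightarrow> z \<in> B \<Longrightarrow> f t z \<le> 1"
    and f_step: "\<And>t h y. 0 \<le> t \<Longrightarrow> 0 \<le> h \<Longrightarrow> y \<in> B \<Longrightarrow> f (t + h) y \<le> exp (- l y * h) * f t y
       + (1 - exp (- l y * h)) * (\<Sum>z\<in>B. p y z * f t z)"
    and J: "jump_law A Y S x c" and x: "x \<in> B" and t: "0 \<le> t"
  shows "c * f t x \<le> measure M (survival B Y S t A)"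
proof -
  define \<Lambda> where "\<Lambda> = (\<Sum>z\<in>B. l z)"
  have rate: "l z \<le> \<Lambda>" if "z \<in> B" for z
    unfolding \<Lambda>_def using that B l_nonneg by (intro member_le_sum) auto
  have "c * f t x - c * (\<Lambda> * t)\<^sup>2 / real (Suc n) \<le> measure M (survival B Y S t A)" for n
  proof -
    define h where "h = t / real (Suc n)"
    have h: "0 \<le> h" using t by (simp add: h_def)
    have th: "real (Suc n) * h = t" by (simp add: h_def)
    have "c * (f (real (Suc n) * h) x - real (Suc n) * (\<Lambda> * h)\<^sup>2) \<le> measure M (survival B Y S (real (Suc n) * h) A)"
    proof (rule survival_euler[where f = "\<lambda>k. f (real k * h)", OF B h rate _ _ _ J x])
      show "f (real (Suc k) * h) y \<le> exp (- l y * h) * f (real k * h) y + (1 - exp (- l y * h)) * (\<Sum>z\<in>B. p y z * f (real k * h) z)"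
        if "y \<in> B" for k y
        using f_step[of "real k * h" h y] that h by (simp add: algebra_simps)
    qed (use f h in auto)
    moreover have "real (Suc n) * (\<Lambda> * h)\<^sup>2 = (\<Lambda> * t)\<^sup>2 / real (Suc n)"
      by (simp add: h_def power2_eq_square del: of_nat_Suc)
    ultimately show ?thesis unfolding th by (simp add: right_diff_distrib)
  qed
  moreover have "(\<lambda>n. c * f t x - c * (\<Lambda> * t)\<^sup>2 / real (Suc n)) \<longlonglongrightarrow> c * f t x - 0"
    by (intro tendsto_intros LIMSEQ_Suc[OF lim_const_over_n])
  ultimately show ?thesis by (intro LIMSEQ_le_const2[of _ "c * f t x"]) auto
qed

lemma sets_all_positive:
  assumes J: "jump_law A Y S x c" and D: "D \<in> sets M"
  shows "{\<omega> \<in> D. \<forall>i. 0 < S i \<omega>} \<in> sets M"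
proof -
  have "{\<omega> \<in> D. \<forall>i. 0 < S i \<omega>} = (\<Inter>i. {\<omega> \<in> D. 0 < S i \<omega>})" by auto
  also have "\<dots> \<in> sets M" by (intro sets.countable_INT) (use sets_wait[OF J D] in auto)
  finally show ?thesis .
qed

text \<open>The product formula speaks about strictly positive waiting times only. Since the kernel is
  stochastic, such histories exhaust the mass.\<close>

lemma waits_positive:
  "jump_law A Y S x c \<Longrightarrow> x \<in> V \<Longrightarrow> c \<le> measure M {\<omega> \<in> A. Y 0 \<omega> = x \<and> (\<forall>i\<le>n. 0 < S i \<omega>)}"
proof (induction n arbitrary: A Y S x c)
  case 0
  then show ?case using first_wait[OF 0, of 0] by simp
next
  case (Suc n)
  note J = Suc.prems(1) and x = Suc.prems(2)
  have c0: "0 \<le> c" by (rule mass_nonneg[OF J x])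
  define E where "E z = {\<omega> \<in> A. Y 0 \<omega> = x \<and> ennreal 0 < S 0 \<omega> \<and> Y 1 \<omega> = z}" for z
  define G where "G z = {\<omega> \<in> E z. Y (Suc 0) \<omega> = z \<and> (\<forall>i\<le>n. 0 < S (Suc i) \<omega>)}" for z
  let ?T = "{\<omega> \<in> A. Y 0 \<omega> = x \<and> (\<forall>i\<le>Suc n. 0 < S i \<omega>)}"
  have meas: "{\<omega> \<in> D. Y 0 \<omega> = z \<and> (\<forall>i\<le>n. 0 < S i \<omega>)} \<in> sets M" if "jump_law D Y S z c" for D Y S z c n
  proof -
    have "{\<omega> \<in> D. Y 0 \<omega> = z \<and> (\<forall>i\<le>n. 0 < S i \<omega>)} = (\<Inter>i\<in>{..n}. {\<omega> \<in> {\<omega> \<in> D. Y 0 \<omega> = z}. 0 < S i \<omega>})" by auto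
    also have "\<dots> \<in> sets M"
      by (intro sets.finite_INT sets_wait[OF that] sets_visit[OF that] jump_lawD(1)[OF that]) auto
    finally show ?thesis .
  qed
  have E: "jump_law (E z) (\<lambda>n. Y (Suc n)) (\<lambda>n. S (Suc n)) z (c * p x z)" if "z \<in> V" for z
    using jump_law_step[OF J x that, of 0] by (simp add: E_def)
  have finite_part: "c * (\<Sum>z\<in>F. p x z) \<le> measure M ?T" if F: "F \<subseteq> V" "finite F" for F
  proof -
    have "c * (\<Sum>z\<in>F. p x z) = (\<Sum>z\<in>F. c * p x z)" by (simp add: sum_distrib_left)
    also have "\<dots> \<le> (\<Sum>z\<in>F. measure M (G z))"
      unfolding G_def using F by (intro sum_mono Suc.IH E) auto
    also have "\<dots> = measure M (\<Union>z\<in>F. G z)"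
      using F meas[OF E] by (intro finite_measure_finite_Union[symmetric]) (auto simp: disjoint_family_on_def G_def)
    also have "\<dots> \<le> measure M ?T"
    proof (rule finite_measure_mono)
      show "(\<Union>z\<in>F. G z) \<subseteq> ?T"
        unfolding less_Suc_eq_le[symmetric] All_less_Suc2 by (auto simp: G_def E_def less_Suc_eq_le)
      show "?T \<in> sets M" by (rule meas[OF J])
    qed
    finally show ?thesis .
  qed
  show ?case
  proof (rule field_le_epsilon)
    fix e :: real assume e: "0 < e"
    obtain F where F: "F \<subseteq> V" "finite F" "1 - e / (c + 1) < (\<Sum>z\<in>F. p x z)"
      using p_total[OF x, of "e / (c + 1)"] e c0 by auto
    have "c * (1 - e / (c + 1)) \<le> c * (\<Sum>z\<in>F. p x z)" using F c0 by (intro mult_left_mono) auto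
    also have "\<dots> \<le> measure M ?T" by (rule finite_part[OF F(1,2)])
    finally have "c \<le> measure M ?T + c * (e / (c + 1))" by (simp add: right_diff_distrib)
    also have "c * (e / (c + 1)) \<le> e" using e c0 by (simp add: field_simps)
    finally show "c \<le> measure M ?T + e" by simp
  qed
qed

text \<open>The expectation is \<open>c / l x\<close>; a sum over the multiples of \<open>1 / l x\<close> loses less than a factor \<open>2\<close> and
  needs only the tail probabilities.\<close>

lemma first_wait_integral:
  assumes J: "jump_law A Y S x c" and x: "x \<in> V" and l: "0 < l x"
  shows "(\<integral>\<^sup>+\<omega>. S 0 \<omega> * indicator {\<omega> \<in> A. Y 0 \<omega> = x} \<omega> \<partial>M) \<le> ennreal (2 * c / l x)"
proof -
  define h where "h = 1 / l x"
  have h: "0 < h" using l by (simp add: h_def)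
  have c0: "0 \<le> c" by (rule mass_nonneg[OF J x])
  define G where "G k = {\<omega> \<in> A. Y 0 \<omega> = x \<and> ennreal (real k * h) < S 0 \<omega>}" for k :: nat
  have G: "G k \<in> sets M" for k
  proof -
    have "G k = {\<omega> \<in> {\<omega> \<in> A. Y 0 \<omega> = x}. ennreal (real k * h) < S 0 \<omega>}" by (auto simp: G_def)
    then show ?thesis using sets_wait[OF J sets_visit[OF J jump_lawD(1)[OF J]]] by simp
  qed
  have bound: "s \<le> (\<Sum>k. ennreal h * of_bool (ennreal (real k * h) < s))" for s :: ennreal
  proof (cases s)
    case (real r)
    define N where "N = nat \<lceil>r / h\<rceil>"
    have "r / h \<le> real N" by (simp add: N_def real_nat_ceiling_ge)
    then have "r \<le> h * real N" using h by (simp add: pos_divide_le_eq mult.commute)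
    then have "s \<le> ennreal (h * real N)" using real by (simp add: ennreal_leI)
    also have "\<dots> = (\<Sum>k<N. ennreal h)" using h by (simp add: ennreal_mult ennreal_of_nat_eq_real_of_nat mult.commute)
    also have "\<dots> = (\<Sum>k<N. ennreal h * of_bool (ennreal (real k * h) < s))"
    proof (intro sum.cong refl)
      fix k assume "k \<in> {..<N}"
      then have "real k < r / h" unfolding N_def by (simp add: zless_nat_eq_int_zless less_ceiling_iff)
      then have "real k * h < r" using h by (simp add: pos_less_divide_eq)
      then have "ennreal (real k * h) < s" using real h by (simp add: ennreal_less_iff)
      then show "ennreal h = ennreal h * of_bool (ennreal (real k * h) < s)" by simp
    qed
    also have "\<dots> \<le> (\<Sum>k. ennreal h * of_bool (ennreal (real k * h) < s))"
      by (intro sum_le_suminf) auto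
    finally show ?thesis .
  next
    case top
    have "(\<Sum>k. ennreal h) = (top :: ennreal)"
    proof (rule ccontr)
      assume "(\<Sum>k. ennreal h) \<noteq> (top :: ennreal)"
      then have "summable (\<lambda>k::nat. h)"
        using h by (intro summable_suminf_not_top) auto
      then show False using h by (simp add: summable_const_iff)
    qed
    then show ?thesis using top by simp
  qed
  have "(\<integral>\<^sup>+\<omega>. S 0 \<omega> * indicator {\<omega> \<in> A. Y 0 \<omega> = x} \<omega> \<partial>M) \<le> (\<integral>\<^sup>+\<omega>. (\<Sum>k. ennreal h * indicator (G k) \<omega>) \<partial>M)"
  proof (rule nn_integral_mono)
    fix \<omega>
    show "S 0 \<omega> * indicator {\<omega> \<in> A. Y 0 \<omega> = x} \<omega> \<le> (\<Sum>k. ennreal h * indicator (G k) \<omega>)"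
    proof (cases "\<omega> \<in> A \<and> Y 0 \<omega> = x")
      case True
      then have "indicator (G k) \<omega> = (of_bool (ennreal (real k * h) < S 0 \<omega>) :: ennreal)" for k
        by (simp add: G_def indicator_def)
      then show ?thesis using bound[of "S 0 \<omega>"] True by simp
    qed simp
  qed
  also have "\<dots> = (\<Sum>k. ennreal h * emeasure M (G k))"
    using G by (subst nn_integral_suminf) (auto simp: nn_integral_cmult_indicator)
  also have "\<dots> = (\<Sum>k. ennreal (h * c * exp (- 1) ^ k))"
  proof (rule suminf_cong)
    fix k
    have "measure M (G k) = c * exp (- l x * (real k * h))"
      unfolding G_def using h by (intro first_wait[OF J x]) auto
    also have "\<dots> = c * exp (- 1) ^ k" using l by (simp add: h_def exp_of_nat_mult[symmetric])
    finally show "ennreal h * emeasure M (G k) = ennreal (h * c * exp (- 1) ^ k)"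
      using h c0 by (simp add: emeasure_eq_measure ennreal_mult[symmetric] mult.assoc)
  qed
  also have "\<dots> = ennreal (\<Sum>k. h * c * exp (- 1) ^ k)"
    using h c0 by (intro suminf_ennreal2 summable_mult summable_geometric) auto
  also have "(\<Sum>k. h * c * exp (- 1) ^ k) = h * c * (1 / (1 - exp (- 1)))"
    by (subst suminf_mult) (auto intro!: summable_geometric simp: suminf_geometric)
  also have "ennreal (h * c * (1 / (1 - exp (- 1)))) \<le> ennreal (h * c * 2)"
  proof (intro ennreal_leI mult_left_mono)
    have "2 \<le> exp (1 :: real)" using exp_ge_add_one_self[of 1] by simp
    then have "exp (- 1 :: real) \<le> 1 / 2" by (simp add: exp_minus field_simps)
    then show "1 / (1 - exp (- 1 :: real)) \<le> 2" by (simp add: field_simps)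
  qed (use h c0 in simp)
  finally show ?thesis by (simp add: h_def mult.commute)
qed

lemma measurable_killed_clock:
  assumes J: "jump_law A Y S x c" and B: "B \<subseteq> V"
  shows "(\<lambda>\<omega>. (\<Sum>i<n. S i \<omega> * of_bool (\<forall>j\<le>i. Y j \<omega> \<in> B))
    * indicator {\<omega> \<in> A. Y 0 \<omega> = x \<and> (\<forall>i. 0 < S i \<omega>)} \<omega>) \<in> borel_measurable M"
proof -
  have stay: "{\<omega> \<in> space M. \<forall>j\<le>i. Y j \<omega> \<in> B} \<in> sets M" for i
  proof -
    have "{\<omega> \<in> space M. \<forall>j\<le>i. Y j \<omega> \<in> B} = (\<Inter>j\<in>{..i}. Y j -` B \<inter> space M)" by auto
    also have "\<dots> \<in> sets M"
      by (intro sets.finite_INT measurable_sets[OF jump_lawD(2)[OF J]]) (use B in auto)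
    finally show ?thesis .
  qed
  have stay': "(\<lambda>\<omega>. of_bool (\<forall>j\<le>i. Y j \<omega> \<in> B) :: ennreal) \<in> borel_measurable M" for i
  proof -
    have "(\<lambda>\<omega>. of_bool (\<forall>j\<le>i. Y j \<omega> \<in> B) :: ennreal) \<in> borel_measurable M \<longleftrightarrow>
        (\<lambda>\<omega>. indicator {\<omega> \<in> space M. \<forall>j\<le>i. Y j \<omega> \<in> B} \<omega> :: ennreal) \<in> borel_measurable M"
      by (rule measurable_cong) (simp only: indicator_def mem_Collect_eq simp_thms of_bool_def)
    then show ?thesis using borel_measurable_indicator[OF stay[of i]] by (rule iffD2)
  qed
  have e: "{\<omega> \<in> A. Y 0 \<omega> = x \<and> (\<forall>i. 0 < S i \<omega>)} = {\<omega> \<in> {\<omega> \<in> A. Y 0 \<omega> = x}. \<forall>i. 0 < S i \<omega>}" by auto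
  have "{\<omega> \<in> A. Y 0 \<omega> = x \<and> (\<forall>i. 0 < S i \<omega>)} \<in> sets M" unfolding e
    by (rule sets_all_positive[OF J sets_visit[OF J jump_lawD(1)[OF J]]])
  then show ?thesis
    by (intro borel_measurable_times_ennreal borel_measurable_sum borel_measurable_indicator
        jump_lawD(3)[OF J] stay')
qed

text \<open>A potential argument: the hypothesis says that the constant \<open>K\<close> dominates twice the mean waiting time
  at \<open>y\<close> plus the value of the same constant after a jump that stays in \<open>B\<close>.\<close>

lemma killed_time_integral:
  assumes B: "B \<subseteq> V" "finite B" and K: "0 \<le> K"
    and l: "\<And>y. y \<in> B \<Longrightarrow> 0 < l y" "\<And>y. y \<in> B \<Longrightarrow> 2 / l y + K * (\<Sum>z\<in>B. p y z) \<le> K"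
  shows "jump_law A Y S x c \<Longrightarrow> x \<in> B \<Longrightarrow>
    (\<integral>\<^sup>+\<omega>. (\<Sum>i<n. S i \<omega> * of_bool (\<forall>j\<le>i. Y j \<omega> \<in> B)) * indicator {\<omega> \<in> A. Y 0 \<omega> = x \<and> (\<forall>i. 0 < S i \<omega>)} \<omega> \<partial>M)
      \<le> ennreal (K * c)"
proof (induction n arbitrary: A Y S x c)
  case 0
  then show ?case by simp
next
  case (Suc n)
  note J = Suc.prems(1) and x = Suc.prems(2)
  have xV: "x \<in> V" using x B by auto
  have c0: "0 \<le> c" by (rule mass_nonneg[OF J xV])
  define E where "E z = {\<omega> \<in> A. Y 0 \<omega> = x \<and> ennreal 0 < S 0 \<omega> \<and> Y 1 \<omega> = z}" for z
  define F where "F z \<omega> = (\<Sum>i<n. S (Suc i) \<omega> * of_bool (\<forall>j\<le>i. Y (Suc j) \<omega> \<in> B))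
      * indicator {\<omega> \<in> E z. Y (Suc 0) \<omega> = z \<and> (\<forall>i. 0 < S (Suc i) \<omega>)} \<omega>" for z \<omega>
  have E: "jump_law (E z) (\<lambda>n. Y (Suc n)) (\<lambda>n. S (Suc n)) z (c * p x z)" if "z \<in> B" for z
    using jump_law_step[OF J xV, of z 0] that B by (auto simp: E_def)
  have F_int: "(\<integral>\<^sup>+\<omega>. F z \<omega> \<partial>M) \<le> ennreal (K * (c * p x z))" if "z \<in> B" for z
    unfolding F_def by (rule Suc.IH[OF E[OF that] that])
  have F_meas: "F z \<in> borel_measurable M" if z: "z \<in> B" for z
    unfolding F_def by (rule measurable_killed_clock[OF E[OF z] B(1)])
  have "(\<integral>\<^sup>+\<omega>. (\<Sum>i<Suc n. S i \<omega> * of_bool (\<forall>j\<le>i. Y j \<omega> \<in> B)) * indicator {\<omega> \<in> A. Y 0 \<omega> = x \<and> (\<forall>i. 0 < S i \<omega>)} \<omega> \<partial>M)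
    \<le> (\<integral>\<^sup>+\<omega>. S 0 \<omega> * indicator {\<omega> \<in> A. Y 0 \<omega> = x} \<omega> + (\<Sum>z\<in>B. F z \<omega>) \<partial>M)"
  proof (rule nn_integral_mono)
    fix \<omega>
    show "(\<Sum>i<Suc n. S i \<omega> * of_bool (\<forall>j\<le>i. Y j \<omega> \<in> B)) * indicator {\<omega> \<in> A. Y 0 \<omega> = x \<and> (\<forall>i. 0 < S i \<omega>)} \<omega>
      \<le> S 0 \<omega> * indicator {\<omega> \<in> A. Y 0 \<omega> = x} \<omega> + (\<Sum>z\<in>B. F z \<omega>)"
    proof (cases "\<omega> \<in> A \<and> Y 0 \<omega> = x \<and> (\<forall>i. 0 < S i \<omega>)")
      case True
      have later: "(\<Sum>i<n. S (Suc i) \<omega> * of_bool (\<forall>j\<le>Suc i. Y j \<omega> \<in> B)) \<le> (\<Sum>z\<in>B. F z \<omega>)"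
      proof (cases "Y 1 \<omega> \<in> B")
        case in_B: True
        have "(\<forall>j\<le>Suc i. Y j \<omega> \<in> B) \<longleftrightarrow> (\<forall>j\<le>i. Y (Suc j) \<omega> \<in> B)" for i
          unfolding less_Suc_eq_le[symmetric] All_less_Suc2 using True x by auto
        then have "(\<Sum>i<n. S (Suc i) \<omega> * of_bool (\<forall>j\<le>Suc i. Y j \<omega> \<in> B)) = F (Y 1 \<omega>) \<omega>"
          using True by (simp add: F_def E_def)
        also have "\<dots> \<le> (\<Sum>z\<in>B. F z \<omega>)" using in_B B by (intro member_le_sum) auto
        finally show ?thesis .
      next
        case False
        then have nb: "(\<forall>j\<le>Suc i. Y j \<omega> \<in> B) = False" for i by (auto intro!: exI[of _ 1])
        show ?thesis unfolding nb by simp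
      qed
      have "(\<Sum>i<Suc n. S i \<omega> * of_bool (\<forall>j\<le>i. Y j \<omega> \<in> B)) =
        S 0 \<omega> + (\<Sum>i<n. S (Suc i) \<omega> * of_bool (\<forall>j\<le>Suc i. Y j \<omega> \<in> B))"
        using True x by (simp add: sum.lessThan_Suc_shift del: sum.lessThan_Suc)
      then show ?thesis using True later by (simp add: add_left_mono)
    qed simp
  qed
  also have "\<dots> = (\<integral>\<^sup>+\<omega>. S 0 \<omega> * indicator {\<omega> \<in> A. Y 0 \<omega> = x} \<omega> \<partial>M) + (\<Sum>z\<in>B. \<integral>\<^sup>+\<omega>. F z \<omega> \<partial>M)"
  proof -
    have "(\<lambda>\<omega>. S 0 \<omega> * indicator {\<omega> \<in> A. Y 0 \<omega> = x} \<omega>) \<in> borel_measurable M"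
      using jump_lawD(3)[OF J] sets_visit[OF J jump_lawD(1)[OF J]] by auto
    then show ?thesis using F_meas by (subst nn_integral_add) (auto simp: nn_integral_sum)
  qed
  also have "\<dots> \<le> ennreal (2 * c / l x) + (\<Sum>z\<in>B. ennreal (K * (c * p x z)))"
    by (intro add_mono sum_mono F_int first_wait_integral[OF J xV l(1)[OF x]])
  also have "\<dots> = ennreal (2 * c / l x + (\<Sum>z\<in>B. K * (c * p x z)))"
    using c0 K l(1)[OF x] p_nonneg[OF xV] B by (subst sum_ennreal) (auto intro!: ennreal_plus[symmetric] sum_nonneg)
  also have "2 * c / l x + (\<Sum>z\<in>B. K * (c * p x z)) = c * (2 / l x + K * (\<Sum>z\<in>B. p x z))"
    by (simp add: sum_distrib_left distrib_left mult_ac)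
  also have "ennreal \<dots> \<le> ennreal (c * K)"
    using l(2)[OF x] c0 by (intro ennreal_leI mult_left_mono)
  finally show ?case by (simp add: mult.commute)
qed

end

section \<open>The exit time of the conductance process\<close>

lemma exit_time_after_survival:
  assumes X: "\<And>t. 0 \<le> t \<Longrightarrow> X t \<omega> = jump_path y s t"
    and n: "\<forall>i\<le>n. y i \<in> B" "ennreal t < (\<Sum>i\<le>n. s i)"
  shows "ennreal t < exit_time X B \<omega>"
proof -
  have "(\<Sum>i\<le>n. s i) \<le> exit_time X B \<omega>"
    unfolding exit_time_def
  proof (rule Inf_greatest)
    fix e assume "e \<in> {ennreal u |u. u > 0 \<and> X u \<omega> \<notin> Some ` B}"
    then obtain u where u: "e = ennreal u" "0 < u" "X u \<omega> \<notin> Some ` B" by auto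
    show "(\<Sum>i\<le>n. s i) \<le> e"
    proof (rule ccontr)
      assume "\<not> (\<Sum>i\<le>n. s i) \<le> e"
      then have lt: "ennreal u < (\<Sum>i\<le>n. s i)" using u by simp
      then have "(LEAST n. ennreal u < (\<Sum>i\<le>n. s i)) \<le> n" by (rule Least_le)
      then have "X u \<omega> \<in> Some ` B"
        using X[of u] u(2) n(1) lt by (auto simp: jump_path_def)
      then show False using u by simp
    qed
  qed
  then show ?thesis using n(2) by (rule less_le_trans[rotated])
qed

text \<open>At the time given by the sum the path is either at its first vertex outside \<open>B\<close>, or, if there is no
  such vertex, in the cemetery. Positivity of the waiting times rules out that the vertex outside \<open>B\<close>
  is skipped.\<close>

lemma exit_time_le_killed_time:
  assumes X: "\<And>t. 0 \<le> t \<Longrightarrow> X t \<omega> = jump_path y s t"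
    and s: "\<And>i. 0 < s i" and y0: "y 0 \<in> B"
  shows "exit_time X B \<omega> \<le> (\<Sum>i. s i * of_bool (\<forall>j\<le>i. y j \<in> B))"
proof (cases "\<Sum>i. s i * of_bool (\<forall>j\<le>i. y j \<in> B)")
  case top
  then show ?thesis by simp
next
  case (real T)
  define g where "g i = s i * of_bool (\<forall>j\<le>i. y j \<in> B)" for i
  have T: "(\<Sum>i. g i) = ennreal T" using real by (simp add: g_def)
  have "g 0 \<le> (\<Sum>i. g i)" using sum_le_suminf[of g "{0}"] by auto
  moreover have "0 < g 0" using s[of 0] y0 by (simp add: g_def)
  ultimately have "0 < ennreal T" unfolding T by (rule less_le_trans[rotated])
  then have T0: "0 < T" by simp
  have "X T \<omega> \<notin> Some ` B"
  proof (cases "\<exists>N. y N \<notin> B")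
    case True
    define N where "N = (LEAST N. y N \<notin> B)"
    have N: "y N \<notin> B" unfolding N_def using True by (rule LeastI_ex)
    have below: "y j \<in> B" if "j < N" for j using not_less_Least[of j "\<lambda>N. y N \<notin> B"] that by (auto simp: N_def)
    have "g i = 0" if "i \<notin> {..<N}" for i
      using that N by (auto simp: g_def)
    then have "(\<Sum>i. g i) = (\<Sum>i<N. g i)" by (intro suminf_finite) auto
    also have "\<dots> = (\<Sum>i<N. s i)" using below by (intro sum.cong) (auto simp: g_def)
    finally have sum_N: "(\<Sum>i<N. s i) = ennreal T" using T by simp
    have iff: "ennreal T < (\<Sum>i\<le>n. s i) \<longleftrightarrow> N \<le> n" for n
    proof
      assume "N \<le> n"
      have "ennreal T + 0 < (\<Sum>i<N. s i) + s N" unfolding sum_N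
        using s[of N] by (simp add: ennreal_add_left_cancel_less)
      also have "\<dots> = (\<Sum>i\<le>N. s i)" by (simp add: lessThan_Suc_atMost[symmetric])
      also have "\<dots> \<le> (\<Sum>i\<le>n. s i)" using \<open>N \<le> n\<close> by (intro sum_mono2) auto
      finally show "ennreal T < (\<Sum>i\<le>n. s i)" by simp
    next
      assume *: "ennreal T < (\<Sum>i\<le>n. s i)"
      show "N \<le> n"
      proof (rule ccontr)
        assume "\<not> N \<le> n"
        then have "(\<Sum>i\<le>n. s i) \<le> (\<Sum>i<N. s i)" by (intro sum_mono2) auto
        then show False using * sum_N by simp
      qed
    qed
    have "(LEAST n. N \<le> n) = N" by (rule Least_equality) auto
    then have "X T \<omega> = Some (y N)"
      using X[of T] T0 by (auto simp: jump_path_def iff)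
    then show ?thesis using N by auto
  next
    case False
    then have "g = s" by (auto simp: g_def)
    then have "\<not> ennreal T < (\<Sum>i\<le>n. s i)" for n
      using sum_le_suminf[of s "{..n}"] T by (auto simp: not_less)
    then have "X T \<omega> = None" using X[of T] T0 by (simp add: jump_path_def)
    then show ?thesis by auto
  qed
  then have "exit_time X B \<omega> \<le> ennreal T"
    unfolding exit_time_def using T0 by (intro Inf_lower) auto
  then show ?thesis using T by (simp add: g_def)
qed

context weighted_graph begin

lemma gdist_commute: "gdist E x y = gdist E y x"
proof -
  have rev: "(y, x) \<in> E ^^ n" if "(x, y) \<in> E ^^ n" for x y n
    using that
  proof (induction n arbitrary: y)
    case (Suc n)
    then obtain z where "(x, z) \<in> E ^^ n" "(z, y) \<in> E" by auto
    then show ?case using Suc.IH edges(2) by (meson relpow_Suc_I2 symD)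
  qed simp
  have "(x, y) \<in> E ^^ n \<longleftrightarrow> (y, x) \<in> E ^^ n" for n using rev by blast
  then show ?thesis by (simp add: gdist_def)
qed

abbreviation "C \<equiv> conductance E w d \<alpha>"
abbreviation "rate \<equiv> jump_rate V E \<mu> w d \<alpha>"
abbreviation "jprob \<equiv> jump_prob V E \<mu> w d \<alpha>"
abbreviation "m \<equiv> \<lambda>x. measure \<mu> {x}"

lemma m_pos: "x \<in> V \<Longrightarrow> 0 < m x"
  using atoms[of x] c_M by (auto intro: less_le_trans[of _ "1 / c\<^sub>M"])

lemma w_nonneg: "x \<in> V \<Longrightarrow> y \<in> V \<Longrightarrow> 0 \<le> w x y"
  using w_sym[of x y] w_diag[of x] by (cases "x = y") auto

lemma w_commute: "x \<in> V \<Longrightarrow> y \<in> V \<Longrightarrow> w x y = w y x"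
  using w_sym[of x y] by (cases "x = y") auto

lemma C_nonneg: "x \<in> V \<Longrightarrow> y \<in> V \<Longrightarrow> 0 \<le> C x y"
  by (simp add: conductance_def w_nonneg)

lemma C_summable: "x \<in> V \<Longrightarrow> (\<lambda>y. C x y * m y) summable_on V"
  using w_summable by (simp add: conductance_def)

lemma rate_nonneg: "x \<in> V \<Longrightarrow> 0 \<le> rate x"
  unfolding jump_rate_def by (intro infsum_nonneg) (simp add: C_nonneg)

lemma sum_le_rate:
  assumes "x \<in> V" "finite F" "F \<subseteq> V" shows "(\<Sum>z\<in>F. C x z * m z) \<le> rate x"
  unfolding jump_rate_def using assms C_summable C_nonneg by (intro finite_sum_le_infsum) auto

text \<open>At a vertex of rate \<open>0\<close> all conductances vanish, so the artificial loop of the kernel does no harm.\<close>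

lemma rate_times_prob:
  assumes "x \<in> V" "z \<in> V" shows "rate x * jprob x z = C x z * m z"
proof (cases "rate x = 0")
  case True
  have "C x z * m z \<le> 0" using sum_le_rate[of x "{z}"] assms True by simp
  moreover have "0 \<le> C x z * m z" using assms C_nonneg by simp
  ultimately show ?thesis using True by simp
qed (simp add: jump_prob_def)

lemma jump_chain_interp:
  assumes "finite_measure M" shows "jump_chain M V rate jprob"
proof -
  interpret finite_measure M by fact
  show ?thesis
  proof
    show "0 \<le> rate x" if "x \<in> V" for x using that by (rule rate_nonneg)
    show "0 \<le> jprob x z" if "x \<in> V" "z \<in> V" for x z
      using that C_nonneg rate_nonneg by (simp add: jump_prob_def)
    show "(\<Sum>z\<in>F. jprob x z) \<le> 1" if "x \<in> V" "finite F" "F \<subseteq> V" for x F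
    proof (cases "rate x = 0")
      case True
      then show ?thesis using that by (simp add: jump_prob_def of_bool_def sum.delta)
    next
      case False
      then have "0 < rate x" using rate_nonneg[OF that(1)] by simp
      moreover have "rate x * (\<Sum>z\<in>F. jprob x z) = (\<Sum>z\<in>F. C x z * m z)"
        using that rate_times_prob by (auto simp: sum_distrib_left intro!: sum.cong)
      ultimately show ?thesis using sum_le_rate[OF that] by (metis mult_le_cancel_left_pos mult.right_neutral)
    qed
    show "\<exists>F\<subseteq>V. finite F \<and> 1 - e < (\<Sum>z\<in>F. jprob x z)" if x: "x \<in> V" and e: "0 < e" for x e
    proof (cases "rate x = 0")
      case True
      then show ?thesis using that by (intro exI[of _ "{x}"]) (simp add: jump_prob_def)
    next
      case False
      then have r: "0 < rate x" using rate_nonneg[OF x] by simp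
      have "((\<lambda>y. C x y * m y) has_sum rate x) V"
        unfolding jump_rate_def using C_summable[OF x] by (rule has_sum_infsum)
      from has_sum_finite_approximation[OF this, of "rate x * e / 2"] r e
      obtain F where F: "finite F" "F \<subseteq> V" "dist (\<Sum>y\<in>F. C x y * m y) (rate x) \<le> rate x * e / 2" by auto
      have "(\<Sum>y\<in>F. C x y * m y) = rate x * (\<Sum>z\<in>F. jprob x z)"
        unfolding sum_distrib_left using F x rate_times_prob by (intro sum.cong) auto
      then have "rate x * (1 - e / 2) \<le> rate x * (\<Sum>z\<in>F. jprob x z)"
        using F(3) abs_ge_minus_self[of "rate x * (\<Sum>z\<in>F. jprob x z) - rate x"]
        by (simp add: dist_real_def algebra_simps)
      then have "1 - e / 2 \<le> (\<Sum>z\<in>F. jprob x z)" using r by (simp add: mult_le_cancel_left_pos)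
      then show ?thesis using F e by (intro exI[of _ F]) auto
    qed
  qed
qed

definition kill_rate :: "'v set \<Rightarrow> 'v \<Rightarrow> real" where
  "kill_rate B y = rate y - (\<Sum>z\<in>B. C y z * m z)"

lemma killed_chain_interp:
  assumes B: "B \<subseteq> V" "finite B"
  shows "killed_chain B m C (kill_rate B)"
proof
  show "C y z = C z y" if "y \<in> B" "z \<in> B" for y z
    using that B w_commute gdist_commute by (auto simp: conductance_def subset_iff)
qed (use B m_pos C_nonneg sum_le_rate in \<open>auto simp: kill_rate_def subset_iff\<close>)

lemma process_realisation:
  fixes P :: "'v \<Rightarrow> 'o measure"
  assumes "conductance_process V E \<mu> w d \<alpha> P X" "x \<in> V"
  shows "\<exists>Y S. prob_space (P x) \<and> jump_chain.jump_law (P x) V rate jprob (space (P x)) Y S x 1 \<and>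
    (\<forall>\<omega>\<in>space (P x). \<forall>t\<ge>0. X t \<omega> = jump_path (\<lambda>n. Y n \<omega>) (\<lambda>n. S n \<omega>) t)"
proof -
  have *: "prob_space (P x)" using assms unfolding conductance_process_def by blast
  have "\<exists>(Y :: nat \<Rightarrow> 'o \<Rightarrow> 'v) (S :: nat \<Rightarrow> 'o \<Rightarrow> ennreal).
        (\<forall>n. Y n \<in> measurable (P x) (count_space V) \<and> S n \<in> borel_measurable (P x)) \<and>
        (\<forall>\<omega>\<in>space (P x). \<forall>t\<ge>0. X t \<omega> = jump_path (\<lambda>n. Y n \<omega>) (\<lambda>n. S n \<omega>) t) \<and>
        (\<forall>n y s. (\<forall>i\<le>n. y i \<in> V \<and> 0 \<le> s i) \<longrightarrow>
          measure (P x) {\<omega> \<in> space (P x). \<forall>i\<le>n. Y i \<omega> = y i \<and> ennreal (s i) < S i \<omega>} =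
            of_bool (y 0 = x) * (\<Prod>i<n. jprob (y i) (y (Suc i))) * (\<Prod>i\<le>n. exp (- rate (y i) * s i)))"
    using assms unfolding conductance_process_def by (elim ballE[of _ _ x] conjE) simp_all
  then obtain Y :: "nat \<Rightarrow> 'o \<Rightarrow> 'v" and S :: "nat \<Rightarrow> 'o \<Rightarrow> ennreal" where YS:
        "\<forall>n. Y n \<in> measurable (P x) (count_space V) \<and> S n \<in> borel_measurable (P x)"
        "\<forall>\<omega>\<in>space (P x). \<forall>t\<ge>0. X t \<omega> = jump_path (\<lambda>n. Y n \<omega>) (\<lambda>n. S n \<omega>) t"
        "\<forall>n y s. (\<forall>i\<le>n. y i \<in> V \<and> 0 \<le> s i) \<longrightarrow>
          measure (P x) {\<omega> \<in> space (P x). \<forall>i\<le>n. Y i \<omega> = y i \<and> ennreal (s i) < S i \<omega>} =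
            of_bool (y 0 = x) * (\<Prod>i<n. jprob (y i) (y (Suc i))) * (\<Prod>i\<le>n. exp (- rate (y i) * s i))"
    by blast
  interpret prob_space "P x" by fact
  interpret jump_chain "P x" V rate jprob by (rule jump_chain_interp) unfold_locales
  show ?thesis
  proof (intro exI conjI)
    show "jump_law (space (P x)) Y S x 1"
      unfolding jump_law_def mult_1 using YS(1,3) by (intro conjI sets.top) (assumption | blast)+
  qed (use YS(2) * in auto)
qed

context
  fixes B :: "'v set" and P :: "'v \<Rightarrow> 'o measure" and X x
  assumes X: "conductance_process V E \<mu> w d \<alpha> P X" and B: "B \<subseteq> V" "finite B" and x: "x \<in> B"
begin

interpretation killed: killed_chain B m C "kill_rate B" by (rule killed_chain_interp[OF B])

text \<open>The event \<open>D\<close> also yields a lower bound on the expectation of the exit time. The probability that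
  the exit time is at most \<open>t\<close> would not, as that set may fail to be measurable. That \<open>f\<close> decreases
  in time makes one step of the backward equation an upper bound, as required for the comparison
  with the survival probability.\<close>

lemma exit_survival:
  assumes p: "killed.flow p" "\<And>y. p 0 y = of_bool (y = x) / m x" and t: "0 \<le> t"
  shows "\<exists>D\<in>sets (P x). D \<subseteq> {\<omega> \<in> space (P x). ennreal t < exit_time X B \<omega>} \<and>
    (\<Sum>y\<in>B. m y * p t y) \<le> measure (P x) D"
proof -
  have xV: "x \<in> V" using x B by auto
  obtain Y S where YS: "prob_space (P x)" "jump_chain.jump_law (P x) V rate jprob (space (P x)) Y S x 1"
    "\<forall>\<omega>\<in>space (P x). \<forall>t\<ge>0. X t \<omega> = jump_path (\<lambda>n. Y n \<omega>) (\<lambda>n. S n \<omega>) t"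
    using process_realisation[OF X xV] by blast
  interpret prob_space "P x" by fact
  interpret jump_chain "P x" V rate jprob by (rule jump_chain_interp) unfold_locales
  note J = YS(2)
  have gen_rate: "killed.gen f y = (\<Sum>z\<in>B. C y z * m z * f z) - rate y * f y" for f y
    by (simp add: killed.gen_def kill_rate_def right_diff_distrib left_diff_distrib sum_subtractf sum_distrib_right)
  obtain f where f: "killed.flow f" "\<And>y. f 0 y = 1" "\<And>t y. t \<ge> 0 \<Longrightarrow> y \<in> B \<Longrightarrow> 0 \<le> f t y"
    "\<And>t y. (\<And>y. y \<in> B \<Longrightarrow> killed.gen (\<lambda>_. 1) y \<le> 0) \<Longrightarrow> t \<ge> 0 \<Longrightarrow> y \<in> B \<Longrightarrow> killed.gen (f t) y \<le> 0"
    by (rule killed.flow_exists[of "\<lambda>_. 1"]) auto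
  have gen_f: "killed.gen (f t) y \<le> 0" if "0 \<le> t" "y \<in> B" for t y
    using that killed.k_nonneg by (intro f(4)) (auto simp: killed.gen_def)
  have f_mono: "f t' y \<le> f t y" if "0 \<le> t" "t \<le> t'" "y \<in> B" for t t' y
  proof (rule DERIV_nonpos_imp_nonincreasing[where f = "\<lambda>s. f s y", OF that(2)])
    fix s assume "t \<le> s"
    then show "\<exists>D. ((\<lambda>s. f s y) has_real_derivative D) (at s) \<and> D \<le> 0"
      using killed.flowD[OF f(1) that(3), of s] gen_f[of s y] that by auto
  qed
  have f_step: "f (t + h) y \<le> exp (- rate y * h) * f t y + (1 - exp (- rate y * h)) * (\<Sum>z\<in>B. jprob y z * f t z)"
    if "0 \<le> t" "0 \<le> h" "y \<in> B" for t h y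
  proof -
    define a where "a = (\<Sum>z\<in>B. jprob y z * f t z)"
    have yV: "y \<in> V" using that B by auto
    have ra: "rate y * a = (\<Sum>z\<in>B. C y z * m z * f t z)"
      unfolding a_def sum_distrib_left using yV B rate_times_prob[OF yV]
      by (intro sum.cong refl) (simp add: mult.assoc[symmetric] subset_iff)
    \<comment> \<open>Variation of constants, with \<open>f (t + u) z\<close> replaced by the larger \<open>f t z\<close>.\<close>
    have "exp (rate y * h) * (f (t + h) y - a) \<le> exp (rate y * 0) * (f (t + 0) y - a)"
    proof (rule DERIV_nonpos_imp_nonincreasing[where f = "\<lambda>u. exp (rate y * u) * (f (t + u) y - a)", OF that(2)])
      fix u :: real assume u: "0 \<le> u"
      have "((\<lambda>u. t + u) has_real_derivative 1) (at u)" by (auto intro!: derivative_eq_intros)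
      from DERIV_chain2[OF killed.flowD[OF f(1) that(3)] this]
      have "((\<lambda>u. f (t + u) y) has_real_derivative killed.gen (f (t + u)) y) (at u)" by simp
      moreover have "((\<lambda>u. exp (rate y * u)) has_real_derivative rate y * exp (rate y * u)) (at u)"
        by (auto intro!: derivative_eq_intros)
      ultimately have "((\<lambda>u. exp (rate y * u) * (f (t + u) y - a)) has_real_derivative
          rate y * exp (rate y * u) * (f (t + u) y - a) + (killed.gen (f (t + u)) y - 0) * exp (rate y * u)) (at u)"
        by (intro DERIV_mult DERIV_diff DERIV_const)
      moreover have "rate y * exp (rate y * u) * (f (t + u) y - a) + (killed.gen (f (t + u)) y - 0) * exp (rate y * u)
         = exp (rate y * u) * ((\<Sum>z\<in>B. C y z * m z * f (t + u) z) - (\<Sum>z\<in>B. C y z * m z * f t z))"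
        unfolding gen_rate ra[symmetric] by (simp add: algebra_simps)
      moreover have "(\<Sum>z\<in>B. C y z * m z * f (t + u) z) \<le> (\<Sum>z\<in>B. C y z * m z * f t z)"
        using u that yV B C_nonneg by (intro sum_mono mult_left_mono f_mono) auto
      ultimately show "\<exists>D. ((\<lambda>u. exp (rate y * u) * (f (t + u) y - a)) has_real_derivative D) (at u) \<and> D \<le> 0"
        by (auto intro!: exI[of _ "exp (rate y * u) * ((\<Sum>z\<in>B. C y z * m z * f (t + u) z) - (\<Sum>z\<in>B. C y z * m z * f t z))"]
            mult_nonneg_nonpos)
    qed
    then have "exp (- rate y * h) * (exp (rate y * h) * (f (t + h) y - a)) \<le> exp (- rate y * h) * (f t y - a)"
      by (intro mult_left_mono) auto
    then have "f (t + h) y - a \<le> exp (- rate y * h) * (f t y - a)"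
      by (simp add: mult.assoc[symmetric] exp_add[symmetric])
    then show ?thesis by (simp add: a_def algebra_simps)
  qed
  have f_le: "f t z \<le> 1" if "0 \<le> t" "z \<in> B" for t z using f_mono[of 0 t z] that f(2) by simp
  let ?D = "survival B Y S t (space (P x))"
  have D: "?D \<in> sets (P x)" by (rule sets_survival[OF J B(1)])
  have "(\<Sum>y\<in>B. m y * p t y * f 0 y) = (\<Sum>y\<in>B. m y * p 0 y * f t y)"
    by (rule killed.flow_pairing[OF p(1) f(1)])
  moreover have "(\<Sum>y\<in>B. m y * p 0 y * f t y) = (\<Sum>y\<in>B. if y = x then f t x else 0)"
    using p(2) m_pos[OF xV] by (intro sum.cong refl) auto
  ultimately have fx: "(\<Sum>y\<in>B. m y * p t y) = f t x" using x B f(2) by simp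
  have fD: "f t x \<le> measure (P x) ?D"
    using survival_lower_bound[OF B f(3) f_le f_step J x t] by simp
  have "?D \<subseteq> {\<omega> \<in> space (P x). ennreal t < exit_time X B \<omega>}"
  proof
    fix \<omega> assume "\<omega> \<in> ?D"
    then obtain n where n: "\<omega> \<in> space (P x)" "\<forall>i\<le>n. Y i \<omega> \<in> B" "ennreal t < (\<Sum>i\<le>n. S i \<omega>)"
      by (auto simp: survival_def)
    have "ennreal t < exit_time X B \<omega>"
      using n YS(3) by (intro exit_time_after_survival[of X \<omega> "\<lambda>n. Y n \<omega>" "\<lambda>n. S n \<omega>" n]) auto
    then show "\<omega> \<in> {\<omega> \<in> space (P x). ennreal t < exit_time X B \<omega>}" using n by simp
  qed
  then show ?thesis using D fx fD by (intro bexI[of _ ?D]) auto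
qed

text \<open>The killed clock is the increasing limit of its partial sums, which \<open>killed_time_integral\<close> bounds.\<close>

lemma mean_exit_time_le:
  assumes K: "0 \<le> K" "\<And>y. y \<in> B \<Longrightarrow> 2 \<le> K * kill_rate B y"
  shows "(\<integral>\<^sup>+\<omega>. exit_time X B \<omega> \<partial>P x) \<le> ennreal K"
proof -
  have xV: "x \<in> V" using x B by auto
  obtain Y S where YS: "prob_space (P x)" "jump_chain.jump_law (P x) V rate jprob (space (P x)) Y S x 1"
    "\<forall>\<omega>\<in>space (P x). \<forall>t\<ge>0. X t \<omega> = jump_path (\<lambda>n. Y n \<omega>) (\<lambda>n. S n \<omega>) t"
    using process_realisation[OF X xV] by blast
  interpret prob_space "P x" by fact
  interpret jump_chain "P x" V rate jprob by (rule jump_chain_interp) unfold_locales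
  note J = YS(2)
  let ?G = "{\<omega> \<in> space (P x). Y 0 \<omega> = x \<and> (\<forall>i. 0 < S i \<omega>)}"
  have "AE \<omega> in P x. Y 0 \<omega> = x \<and> (\<forall>i\<le>n. 0 < S i \<omega>)" for n
  proof -
    have m: "{\<omega> \<in> space (P x). Y 0 \<omega> = x \<and> (\<forall>i\<le>n. 0 < S i \<omega>)} \<in> sets (P x)"
    proof -
      have e: "{\<omega> \<in> space (P x). Y 0 \<omega> = x \<and> (\<forall>i\<le>n. 0 < S i \<omega>)} =
        (\<Inter>i\<in>{..n}. {\<omega> \<in> {\<omega> \<in> space (P x). Y 0 \<omega> = x}. 0 < S i \<omega>})" by auto
      show ?thesis unfolding e
        by (intro sets.finite_INT sets_wait[OF J] sets_visit[OF J] sets.top) auto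
    qed
    have "Sigma_Algebra.measure (P x) {\<omega> \<in> space (P x). Y 0 \<omega> = x \<and> (\<forall>i\<le>n. 0 < S i \<omega>)} = 1"
      using waits_positive[OF J xV, of n] by (intro antisym) simp_all
    from this[THEN AE_prob_1] show ?thesis by (rule eventually_mono) auto
  qed
  then have "AE \<omega> in P x. \<forall>n. Y 0 \<omega> = x \<and> (\<forall>i\<le>n. 0 < S i \<omega>)" by (simp add: AE_all_countable)
  then have good: "AE \<omega> in P x. \<omega> \<in> ?G" using AE_space by eventually_elim auto
  define T where "T n \<omega> = (\<Sum>i<n. S i \<omega> * of_bool (\<forall>j\<le>i. Y j \<omega> \<in> B)) * indicator ?G \<omega>" for n \<omega>
  have T: "(\<integral>\<^sup>+\<omega>. T n \<omega> \<partial>P x) \<le> ennreal K" for n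
  proof -
    have "(\<integral>\<^sup>+\<omega>. T n \<omega> \<partial>P x) \<le> ennreal (K * 1)"
      unfolding T_def
    proof (rule killed_time_integral[OF B K(1) _ _ J x])
      fix y assume y: "y \<in> B"
      then have yV: "y \<in> V" using B by auto
      have le: "kill_rate B y \<le> rate y"
        unfolding kill_rate_def using C_nonneg yV B by (auto intro!: sum_nonneg)
      show r: "0 < rate y"
      proof (rule ccontr)
        assume "\<not> 0 < rate y"
        then have "kill_rate B y \<le> 0" using le by simp
        then have "K * kill_rate B y \<le> 0" using K(1) by (simp add: mult_nonneg_nonpos)
        then show False using K(2)[OF y] by simp
      qed
      have "rate y * (\<Sum>z\<in>B. jprob y z) = (\<Sum>z\<in>B. C y z * m z)"
        unfolding sum_distrib_left using yV B rate_times_prob by (intro sum.cong) auto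
      then have "2 + K * (rate y * (\<Sum>z\<in>B. jprob y z)) \<le> K * rate y"
        using K(2)[OF y] by (simp add: kill_rate_def algebra_simps)
      then show "2 / rate y + K * (\<Sum>z\<in>B. jprob y z) \<le> K" using r by (simp add: field_simps)
    qed
    then show ?thesis by simp
  qed
  have T_meas: "T n \<in> borel_measurable (P x)" for n
    unfolding T_def by (rule measurable_killed_clock[OF J B(1)])
  have "(\<integral>\<^sup>+\<omega>. exit_time X B \<omega> \<partial>P x) \<le> (\<integral>\<^sup>+\<omega>. (SUP n. T n \<omega>) \<partial>P x)"
  proof (rule nn_integral_mono_AE)
    show "AE \<omega> in P x. exit_time X B \<omega> \<le> (SUP n. T n \<omega>)"
      using good
    proof eventually_elim
      case (elim \<omega>)
      then have "exit_time X B \<omega> \<le> (\<Sum>i. S i \<omega> * of_bool (\<forall>j\<le>i. Y j \<omega> \<in> B))"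
        using x YS(3) by (intro exit_time_le_killed_time[of X \<omega> "\<lambda>n. Y n \<omega>" "\<lambda>n. S n \<omega>"]) auto
      also have "\<dots> = (SUP n. T n \<omega>)"
        using elim by (simp add: suminf_eq_SUP T_def)
      finally show ?case .
    qed
  qed
  also have "\<dots> = (SUP n. \<integral>\<^sup>+\<omega>. T n \<omega> \<partial>P x)"
  proof (rule nn_integral_monotone_convergence_SUP)
    show "incseq T" by (intro incseq_SucI le_funI) (simp add: T_def distrib_right)
  qed (rule T_meas)
  also have "\<dots> \<le> ennreal K" by (intro SUP_least T)
  finally show ?thesis .
qed

end
end

section \<open>Balls of the graph and a local Nash inequality\<close>

context weighted_graph begin

lemma gdist_path: "x \<in> V \<Longrightarrow> y \<in> V \<Longrightarrow> (x, y) \<in> E ^^ gdist E x y"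
  unfolding gdist_def using connected[of x y] by (auto simp: rtrancl_power intro: LeastI_ex)

lemma gdist_le: "(x, y) \<in> E ^^ n \<Longrightarrow> gdist E x y \<le> n"
  unfolding gdist_def by (rule Least_le)

lemma gdist_triangle:
  assumes "x \<in> V" "y \<in> V" "z \<in> V" shows "gdist E x z \<le> gdist E x y + gdist E y z"
  using gdist_path[OF assms(1,2)] gdist_path[OF assms(2,3)]
  by (intro gdist_le) (auto simp: relpow_add)

lemma gdist_self [simp]: "gdist E x x = 0"
  using gdist_le[of x x 0] by simp

lemma gdist_eq_0: "x \<in> V \<Longrightarrow> y \<in> V \<Longrightarrow> gdist E x y = 0 \<longleftrightarrow> x = y"
  using gdist_path[of x y] by auto

lemma gball_subset: "gball V E x r \<subseteq> V" by (auto simp: gball_def)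

lemma finite_gball: assumes "x \<in> V" shows "finite (gball V E x r)"
proof -
  have fin: "finite {y. (x, y) \<in> E ^^ n}" for n
  proof (induction n)
    case (Suc n)
    have "{y. (x, y) \<in> E ^^ Suc n} \<subseteq> (\<Union>z\<in>{z. (x, z) \<in> E ^^ n}. {y. (z, y) \<in> E})" by auto
    moreover have "finite {y. (z, y) \<in> E}" for z
    proof (cases "z \<in> V")
      case False
      then have "{y. (z, y) \<in> E} = {}" using edges(1) by auto
      then show ?thesis by simp
    qed (rule locally_finite)
    ultimately show ?case using Suc finite_subset by blast
  qed simp
  have "gball V E x r \<subseteq> (\<Union>n\<le>nat \<lfloor>r\<rfloor>. {y. (x, y) \<in> E ^^ n})"
  proof
    fix y assume "y \<in> gball V E x r"
    then have y: "y \<in> V" "real (gdist E x y) \<le> r" by (auto simp: gball_def)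
    have "gdist E x y \<le> nat \<lfloor>r\<rfloor>" using y(2) by linarith
    then show "y \<in> (\<Union>n\<le>nat \<lfloor>r\<rfloor>. {y. (x, y) \<in> E ^^ n})" using gdist_path[OF assms y(1)] by blast
  qed
  then show ?thesis using fin finite_subset by blast
qed

lemma measure_finite: assumes "finite F" "F \<subseteq> V" shows "measure \<mu> F = (\<Sum>y\<in>F. m y)"
proof (rule measure_eq_sum_singleton[OF assms(1)])
  fix y assume "y \<in> F"
  then have y: "y \<in> V" using assms by auto
  then show "{y} \<in> sets \<mu>" using measure_on_V by auto
  show "emeasure \<mu> {y} \<noteq> \<infinity>" using m_pos[OF y] by (auto simp: measure_def)
qed

lemma gball_mono: "r \<le> r' \<Longrightarrow> gball V E x r \<subseteq> gball V E x r'" by (auto simp: gball_def)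

lemma gball_shift:
  assumes "x \<in> V" "y \<in> V" "real (gdist E y x) + r \<le> r'" shows "gball V E x r \<subseteq> gball V E y r'"
proof
  fix z assume "z \<in> gball V E x r"
  then have z: "z \<in> V" "real (gdist E x z) \<le> r" by (auto simp: gball_def)
  have "real (gdist E y z) \<le> real (gdist E y x) + real (gdist E x z)"
    using gdist_triangle[OF assms(2,1) z(1)] by linarith
  then show "z \<in> gball V E y r'" using z assms by (auto simp: gball_def)
qed

lemma m_bounds: "x \<in> V \<Longrightarrow> m x \<le> c\<^sub>M" "x \<in> V \<Longrightarrow> 1 \<le> c\<^sub>M * m x" "x \<in> V \<Longrightarrow> 1 / m x \<le> c\<^sub>M"
  using atoms[of x] c_M m_pos[of x] by (auto simp: field_simps)

lemma w_le_C:
  assumes "x \<in> V" "y \<in> V" "real (gdist E x y) \<le> s" shows "w x y \<le> C x y * s powr (d + \<alpha>)"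
proof (cases "x = y")
  case True
  then show ?thesis using assms w_diag by (simp add: conductance_def)
next
  case False
  define g where "g = real (gdist E x y)"
  have g: "0 < g" using False gdist_eq_0[OF assms(1,2)] by (simp add: g_def)
  have "w x y = C x y * g powr (d + \<alpha>)" using g by (simp add: conductance_def g_def)
  also have "\<dots> \<le> C x y * s powr (d + \<alpha>)"
    using assms g d alpha C_nonneg[OF assms(1,2)] by (intro mult_left_mono powr_mono2) (auto simp: g_def)
  finally show ?thesis .
qed

lemma C_times_square:
  assumes "x \<in> V" "y \<in> V"
  shows "C x y * (real (gdist E x y))\<^sup>2 = w x y / real (gdist E x y) powr (d + \<alpha> - 2)"
proof (cases "x = y")
  case True
  then show ?thesis using assms w_diag by (simp add: conductance_def)
next
  case False
  define g where "g = real (gdist E x y)"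
  have g: "0 < g" using False gdist_eq_0[OF assms] by (simp add: g_def)
  have "g powr (d + \<alpha>) = g powr (d + \<alpha> - 2) * g powr 2" by (subst powr_add[symmetric]) simp
  then have "g powr (d + \<alpha>) = g powr (d + \<alpha> - 2) * g\<^sup>2" using g by (simp only: powr_numeral)
  then show ?thesis using g by (simp add: conductance_def g_def[symmetric])
qed

lemma kill_rate_ge:
  assumes B: "finite B" "B \<subseteq> V" and y: "y \<in> V" and F: "finite F" "F \<subseteq> V" "F \<inter> B = {}"
  shows "(\<Sum>z\<in>F. C y z * m z) \<le> kill_rate B y"
  using sum_le_rate[OF y, of "F \<union> B"] B F by (simp add: kill_rate_def sum.union_disjoint)

lemma wball_neighbours:
  assumes y: "y \<in> V"
  shows "wball V E w y y s \<subseteq> V" "finite (wball V E w y y s)"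
    "z \<in> wball V E w y y s \<Longrightarrow> 0 < w y z" "z \<in> wball V E w y y s \<Longrightarrow> real (gdist E y z) \<le> s"
proof -
  have sub: "wball V E w y y s \<subseteq> gball V E y s" by (auto simp: wball_def)
  then show V: "wball V E w y y s \<subseteq> V" "finite (wball V E w y y s)"
    using gball_subset finite_gball[OF y] finite_subset by blast+
  show "0 < w y z" if "z \<in> wball V E w y y s"
    using that w_commute[OF y, of z] V by (auto simp: wball_def)
  show "real (gdist E y z) \<le> s" if "z \<in> wball V E w y y s" using that sub by (auto simp: gball_def)
qed

text \<open>Averaging \<open>f y\<close> over the neighbours \<open>z\<close> with \<open>w y z > 0\<close> in the ball of radius \<open>s\<close> splits it into an
  average of \<open>f y - f z\<close> and an average of \<open>f\<close>. Cauchy--Schwarz with the weights \<open>w y z\<close> turns the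
  first into energy, at the price of the sum of inverse weights. The second is
  at every point at most a multiple of \<open>s powr (- d)\<close> times the sum of \<open>f\<close>, and its sum over \<open>B\<close> is at
  most a multiple of the sum of \<open>f\<close>, which bounds the sum of its squares. Vertices outside \<open>B\<close> take
  part as neighbours where \<open>f\<close> counts as \<open>0\<close>.\<close>

lemma nash_inequality:
  fixes f :: "'v \<Rightarrow> real"
  assumes B: "finite B" "B \<subseteq> V"
    and s: "1 \<le> s" "ereal s < r\<^sub>G" and c0: "0 < c\<^sub>0" and C0: "0 \<le> C\<^sub>w"
    and thick: "\<And>y. y \<in> B \<Longrightarrow> c\<^sub>0 * measure \<mu> (gball V E y s) \<le> measure \<mu> (wball V E w y y s)"
    and inv: "\<And>y. y \<in> B \<Longrightarrow> (\<Sum>z\<in>wball V E w y y s. inverse (w y z)) \<le> C\<^sub>w * s powr d"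
    and f: "\<And>y. y \<in> B \<Longrightarrow> 0 \<le> f y"
  shows "(\<Sum>y\<in>B. m y * (f y)\<^sup>2) \<le> ((4 * c\<^sub>M ^ 3 * C\<^sub>w + 2 * c\<^sub>G) / (c\<^sub>0 / c\<^sub>G)\<^sup>2) *
    (s powr \<alpha> * killed_chain.energy B m C (kill_rate B) f f + s powr (- d) * (\<Sum>y\<in>B. m y * f y)\<^sup>2)"
proof -
  interpret killed: killed_chain B m C "kill_rate B" by (rule killed_chain_interp[OF B(2,1)])
  define W where "W y = wball V E w y y s" for y
  define g where "g z = (if z \<in> B then f z else 0)" for z
  define q where "q = c\<^sub>0 / c\<^sub>G"
  have q: "0 < q" using c0 c_G by (simp add: q_def)
  have s0: "0 < s" using s by simp
  have W: "W y \<subseteq> V" "finite (W y)" "\<And>z. z \<in> W y \<Longrightarrow> 0 < w y z" "\<And>z. z \<in> W y \<Longrightarrow> real (gdist E y z) \<le> s"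
    if "y \<in> B" for y
    unfolding W_def using that B by (auto intro: wball_neighbours subsetD[OF wball_neighbours(1)])
  have mW: "q * s powr d \<le> (\<Sum>z\<in>W y. m z)" if y: "y \<in> B" for y
  proof -
    have yV: "y \<in> V" using y B by auto
    have "c\<^sub>0 * (1 / c\<^sub>G * s powr d) \<le> c\<^sub>0 * measure \<mu> (gball V E y s)"
      using volume[OF yV s] c0 by (intro mult_left_mono) auto
    also have "\<dots> \<le> measure \<mu> (W y)" unfolding W_def by (rule thick[OF y])
    also have "\<dots> = (\<Sum>z\<in>W y. m z)" using W(1,2)[OF y] by (rule measure_finite[rotated])
    finally show ?thesis by (simp add: q_def)
  qed
  define b where "b y = (\<Sum>z\<in>W y. m z * g z)" for y
  define G where "G y = (\<Sum>z\<in>W y. C y z * m z * (f y - g z)\<^sup>2)" for y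
  define M1 where "M1 = (\<Sum>y\<in>B. m y * f y)"
  have b_nonneg: "0 \<le> b y" if "y \<in> B" for y
    unfolding b_def g_def using W(1)[OF that] m_pos f by (intro sum_nonneg) (auto simp: less_imp_le)
  have b_le: "b y \<le> M1" if "y \<in> B" for y
  proof -
    have "b y = (\<Sum>z\<in>W y \<inter> B. m z * f z)"
      unfolding b_def g_def using W(2)[OF that] by (simp add: sum.inter_restrict if_distrib cong: if_cong)
    also have "\<dots> \<le> M1" unfolding M1_def using B f m_pos
      by (intro sum_mono2) (auto simp: less_imp_le subset_iff)
    finally show ?thesis .
  qed
  have pointwise: "(q * s powr d)\<^sup>2 * (f y)\<^sup>2 \<le> 2 * (c\<^sub>M\<^sup>2 * C\<^sub>w * s powr d * s powr (d + \<alpha>)) * G y + 2 * M1 * b y"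
    if y: "y \<in> B" for y
  proof -
    have yV: "y \<in> V" using y B by auto
    define a where "a = (\<Sum>z\<in>W y. m z * \<bar>f y - g z\<bar>)"
    have "q * s powr d * f y \<le> (\<Sum>z\<in>W y. m z) * f y" using mW[OF y] f[OF y] by (rule mult_right_mono)
    also have "\<dots> = (\<Sum>z\<in>W y. m z * (f y - g z)) + b y"
      by (simp add: b_def sum_distrib_right right_diff_distrib sum_subtractf)
    also have "(\<Sum>z\<in>W y. m z * (f y - g z)) \<le> a"
      unfolding a_def using W(1)[OF y] m_pos by (intro sum_mono mult_left_mono) (auto simp: less_imp_le)
    finally have 1: "q * s powr d * f y \<le> a + b y" by simp
    have "(q * s powr d * f y)\<^sup>2 \<le> (a + b y)\<^sup>2"
      using 1 q f[OF y] by (intro power_mono) auto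
    also have "\<dots> \<le> 2 * a\<^sup>2 + 2 * (b y)\<^sup>2"
      using sum_squares_bound[of a "b y"] by (simp add: power2_sum)
    also have "(b y)\<^sup>2 \<le> M1 * b y"
      using b_le[OF y] b_nonneg[OF y] by (simp add: power2_eq_square mult_right_mono)
    also have "a\<^sup>2 \<le> (c\<^sub>M\<^sup>2 * C\<^sub>w * s powr d * s powr (d + \<alpha>)) * G y"
    proof -
      have "a\<^sup>2 = (\<Sum>z\<in>W y. (sqrt (m z * w y z) * \<bar>f y - g z\<bar>) * sqrt (m z * inverse (w y z)))\<^sup>2"
      proof (intro arg_cong[of _ _ "\<lambda>x. x\<^sup>2"], unfold a_def, intro sum.cong refl)
        fix z assume z: "z \<in> W y"
        then have "0 < m z" "0 < w y z" using W(1,3)[OF y] m_pos by auto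
        then have "sqrt (m z * w y z) * sqrt (m z * inverse (w y z)) = m z"
          by (simp add: real_sqrt_mult[symmetric] power2_eq_square[symmetric] field_simps)
        then show "m z * \<bar>f y - g z\<bar> = sqrt (m z * w y z) * \<bar>f y - g z\<bar> * sqrt (m z * inverse (w y z))"
          by (simp add: mult_ac)
      qed
      also have "\<dots> \<le> (\<Sum>z\<in>W y. (sqrt (m z * w y z) * \<bar>f y - g z\<bar>)\<^sup>2) * (\<Sum>z\<in>W y. (sqrt (m z * inverse (w y z)))\<^sup>2)"
        by (rule Cauchy_Schwarz_ineq_sum)
      also have "\<dots> \<le> (s powr (d + \<alpha>) * G y) * (c\<^sub>M * (C\<^sub>w * s powr d))"
      proof (intro mult_mono)
        have "(\<Sum>z\<in>W y. (sqrt (m z * w y z) * \<bar>f y - g z\<bar>)\<^sup>2) \<le> (\<Sum>z\<in>W y. s powr (d + \<alpha>) * (C y z * m z * (f y - g z)\<^sup>2))"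
        proof (intro sum_mono)
          fix z assume z: "z \<in> W y"
          then have zz: "0 < m z" "0 < w y z" "z \<in> V" using W(1,3)[OF y] m_pos by auto
          have "(sqrt (m z * w y z) * \<bar>f y - g z\<bar>)\<^sup>2 = w y z * (m z * (f y - g z)\<^sup>2)"
            using zz by (simp add: power_mult_distrib)
          also have "\<dots> \<le> (C y z * s powr (d + \<alpha>)) * (m z * (f y - g z)\<^sup>2)"
            using w_le_C[OF yV zz(3) W(4)[OF y z]] zz by (intro mult_right_mono) auto
          finally show "(sqrt (m z * w y z) * \<bar>f y - g z\<bar>)\<^sup>2 \<le> s powr (d + \<alpha>) * (C y z * m z * (f y - g z)\<^sup>2)"
            by (simp add: mult_ac)
        qed
        then show "(\<Sum>z\<in>W y. (sqrt (m z * w y z) * \<bar>f y - g z\<bar>)\<^sup>2) \<le> s powr (d + \<alpha>) * G y"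
          by (simp add: G_def sum_distrib_left)
        have "(\<Sum>z\<in>W y. (sqrt (m z * inverse (w y z)))\<^sup>2) \<le> (\<Sum>z\<in>W y. c\<^sub>M * inverse (w y z))"
        proof (intro sum_mono)
          fix z assume z: "z \<in> W y"
          then have zz: "0 < m z" "0 < w y z" "z \<in> V" using W(1,3)[OF y] m_pos by auto
          then show "(sqrt (m z * inverse (w y z)))\<^sup>2 \<le> c\<^sub>M * inverse (w y z)"
            using m_bounds(1)[OF zz(3)] by (simp add: mult_right_mono)
        qed
        also have "\<dots> \<le> c\<^sub>M * (C\<^sub>w * s powr d)"
          using inv[OF y] c_M by (simp add: sum_distrib_left[symmetric] W_def mult_left_mono)
        finally show "(\<Sum>z\<in>W y. (sqrt (m z * inverse (w y z)))\<^sup>2) \<le> c\<^sub>M * (C\<^sub>w * s powr d)" .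
        show "0 \<le> s powr (d + \<alpha>) * G y"
          unfolding G_def using C_nonneg[OF yV] m_pos W(1)[OF y]
          by (intro mult_nonneg_nonneg sum_nonneg) (auto simp: less_imp_le subset_iff)
      qed (auto intro!: sum_nonneg)
      also have "\<dots> \<le> (c\<^sub>M\<^sup>2 * C\<^sub>w * s powr d * s powr (d + \<alpha>)) * G y"
      proof -
        have "0 \<le> G y" unfolding G_def using C_nonneg[OF yV] m_pos W(1)[OF y]
          by (intro sum_nonneg) (auto simp: less_imp_le subset_iff)
        then have "0 \<le> C\<^sub>w * s powr d * s powr (d + \<alpha>) * G y" using C0 by simp
        from mult_right_mono[OF _ this, of "c\<^sub>M" "c\<^sub>M\<^sup>2"] show ?thesis
          using c_M by (simp add: power2_eq_square mult_ac)
      qed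
      finally show ?thesis .
    qed
    finally show ?thesis using c_M by (simp add: power_mult_distrib algebra_simps)
  qed
  have sumG: "(\<Sum>y\<in>B. m y * G y) \<le> 2 * killed.energy f f"
  proof -
    have "m y * G y \<le> (\<Sum>z\<in>B. C y z * m y * m z * (f y - f z) * (f y - f z)) + m y * kill_rate B y * f y * f y"
      if y: "y \<in> B" for y
    proof -
      have yV: "y \<in> V" using y B by auto
      have "G y = (\<Sum>z\<in>W y \<inter> B. C y z * m z * (f y - g z)\<^sup>2) + (\<Sum>z\<in>W y - B. C y z * m z * (f y - g z)\<^sup>2)"
        unfolding G_def using W(2)[OF y] by (simp add: sum.Int_Diff)
      also have "(\<Sum>z\<in>W y \<inter> B. C y z * m z * (f y - g z)\<^sup>2) \<le> (\<Sum>z\<in>B. C y z * m z * (f y - f z)\<^sup>2)"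
      proof -
        have "(\<Sum>z\<in>W y \<inter> B. C y z * m z * (f y - g z)\<^sup>2) = (\<Sum>z\<in>W y \<inter> B. C y z * m z * (f y - f z)\<^sup>2)"
          by (intro sum.cong) (auto simp: g_def)
        also have "\<dots> \<le> (\<Sum>z\<in>B. C y z * m z * (f y - f z)\<^sup>2)"
          using B C_nonneg[OF yV] m_pos by (intro sum_mono2) (auto simp: less_imp_le subset_iff)
        finally show ?thesis .
      qed
      also have "(\<Sum>z\<in>W y - B. C y z * m z * (f y - g z)\<^sup>2) = (\<Sum>z\<in>W y - B. C y z * m z) * (f y)\<^sup>2"
        unfolding sum_distrib_right by (intro sum.cong) (auto simp: g_def)
      also have "\<dots> \<le> kill_rate B y * (f y)\<^sup>2"
        using W(1,2)[OF y] by (intro mult_right_mono kill_rate_ge[OF B yV]) auto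
      finally have "m y * G y \<le> m y * ((\<Sum>z\<in>B. C y z * m z * (f y - f z)\<^sup>2) + kill_rate B y * (f y)\<^sup>2)"
        using m_pos[OF yV] by simp
      then show ?thesis by (simp add: distrib_left sum_distrib_left power2_eq_square mult_ac)
    qed
    from sum_mono[OF this] have "(\<Sum>y\<in>B. m y * G y) \<le> (\<Sum>y\<in>B. \<Sum>z\<in>B. C y z * m y * m z * (f y - f z) * (f y - f z))
       + (\<Sum>y\<in>B. m y * kill_rate B y * f y * f y)" by (simp add: sum.distrib)
    moreover have "0 \<le> (\<Sum>y\<in>B. m y * kill_rate B y * f y * f y)"
      using m_pos B killed.k_nonneg f by (intro sum_nonneg mult_nonneg_nonneg) (auto simp: less_imp_le)
    ultimately show ?thesis by (simp add: killed.energy_def)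
  qed
  have sumb: "(\<Sum>y\<in>B. m y * b y) \<le> c\<^sub>G * s powr d * M1"
  proof -
    have "(\<Sum>y\<in>B. m y * b y) \<le> (\<Sum>y\<in>B. \<Sum>z\<in>B. m z * f z * (if y \<in> gball V E z s then m y else 0))"
    proof (intro sum_mono)
      fix y assume y: "y \<in> B"
      have yV: "y \<in> V" using y B by auto
      have "m y * b y = (\<Sum>z\<in>W y \<inter> B. m z * f z * m y)"
        unfolding b_def g_def using W(2)[OF y]
        by (simp add: sum.inter_restrict sum_distrib_left if_distrib mult_ac cong: if_cong)
      also have "\<dots> = (\<Sum>z\<in>W y \<inter> B. m z * f z * (if y \<in> gball V E z s then m y else 0))"
        using W(4)[OF y] yV by (intro sum.cong) (auto simp: gball_def gdist_commute)
      also have "\<dots> \<le> (\<Sum>z\<in>B. m z * f z * (if y \<in> gball V E z s then m y else 0))"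
        using B f m_pos by (intro sum_mono2) (auto simp: less_imp_le subset_iff)
      finally show "m y * b y \<le> (\<Sum>z\<in>B. m z * f z * (if y \<in> gball V E z s then m y else 0))" .
    qed
    also have "\<dots> = (\<Sum>z\<in>B. m z * f z * (\<Sum>y\<in>B. if y \<in> gball V E z s then m y else 0))"
      by (subst sum.swap) (simp add: sum_distrib_left)
    also have "\<dots> \<le> (\<Sum>z\<in>B. m z * f z * (c\<^sub>G * s powr d))"
    proof (intro sum_mono mult_left_mono)
      fix z assume z: "z \<in> B"
      then have zV: "z \<in> V" using B by auto
      have "(\<Sum>y\<in>B. if y \<in> gball V E z s then m y else 0) = (\<Sum>y\<in>B \<inter> gball V E z s. m y)"
        using B by (simp add: sum.inter_restrict)
      also have "\<dots> \<le> (\<Sum>y\<in>gball V E z s. m y)"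
        using finite_gball[OF zV] m_pos gball_subset by (intro sum_mono2) (auto simp: less_imp_le subset_iff)
      also have "\<dots> \<le> c\<^sub>G * s powr d"
        using volume[OF zV s] measure_finite[OF finite_gball[OF zV] gball_subset] by simp
      finally show "(\<Sum>y\<in>B. if y \<in> gball V E z s then m y else 0) \<le> c\<^sub>G * s powr d" .
      show "0 \<le> m z * f z" using f[OF z] m_pos[OF zV] by simp
    qed
    also have "\<dots> = c\<^sub>G * s powr d * M1"
      unfolding M1_def sum_distrib_left by (intro sum.cong refl) (simp add: mult_ac)
    finally show ?thesis .
  qed
  define k1 where "k1 = 2 * (c\<^sub>M\<^sup>2 * C\<^sub>w * s powr d * s powr (d + \<alpha>))"
  have k1: "0 \<le> k1" using C0 by (simp add: k1_def)
  have M1: "0 \<le> M1" unfolding M1_def using f m_pos B by (intro sum_nonneg) (auto simp: less_imp_le subset_iff)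
  have "(q * s powr d)\<^sup>2 * (\<Sum>y\<in>B. m y * (f y)\<^sup>2) = (\<Sum>y\<in>B. m y * ((q * s powr d)\<^sup>2 * (f y)\<^sup>2))"
    by (simp add: sum_distrib_left mult_ac)
  also have "\<dots> \<le> (\<Sum>y\<in>B. m y * (k1 * G y + 2 * M1 * b y))"
    using pointwise m_pos B c_M by (intro sum_mono mult_left_mono) (auto simp: k1_def less_imp_le subset_iff)
  also have "\<dots> = k1 * (\<Sum>y\<in>B. m y * G y) + 2 * M1 * (\<Sum>y\<in>B. m y * b y)"
    by (simp add: distrib_left sum.distrib sum_distrib_left mult_ac)
  also have "\<dots> \<le> k1 * (2 * killed.energy f f) + 2 * M1 * (c\<^sub>G * s powr d * M1)"
    using sumG sumb k1 M1 by (intro add_mono mult_left_mono) auto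
  also have "\<dots> = (s powr d)\<^sup>2 * (4 * (c\<^sub>M\<^sup>2 * C\<^sub>w) * (s powr \<alpha> * killed.energy f f) + 2 * c\<^sub>G * (s powr (- d) * M1\<^sup>2))"
    using s0 by (simp add: k1_def powr_add powr_minus power2_eq_square field_simps)
  also have "\<dots> \<le> (s powr d)\<^sup>2 * ((4 * c\<^sub>M ^ 3 * C\<^sub>w + 2 * c\<^sub>G) * (s powr \<alpha> * killed.energy f f) + (4 * c\<^sub>M ^ 3 * C\<^sub>w + 2 * c\<^sub>G) * (s powr (- d) * M1\<^sup>2))"
  proof (intro mult_left_mono add_mono mult_right_mono)
    have "c\<^sub>M\<^sup>2 \<le> c\<^sub>M ^ 3" using c_M by (intro power_increasing) auto
    then have "c\<^sub>M\<^sup>2 * C\<^sub>w \<le> c\<^sub>M ^ 3 * C\<^sub>w" using C0 by (rule mult_right_mono)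
    then show "4 * (c\<^sub>M\<^sup>2 * C\<^sub>w) \<le> 4 * c\<^sub>M ^ 3 * C\<^sub>w + 2 * c\<^sub>G" using c_G by simp
    show "2 * c\<^sub>G \<le> 4 * c\<^sub>M ^ 3 * C\<^sub>w + 2 * c\<^sub>G" using C0 c_M by simp
  qed (use killed.energy_nonneg in auto)
  finally have "(s powr d)\<^sup>2 * (q\<^sup>2 * (\<Sum>y\<in>B. m y * (f y)\<^sup>2)) \<le> (s powr d)\<^sup>2 *
     ((4 * c\<^sub>M ^ 3 * C\<^sub>w + 2 * c\<^sub>G) * (s powr \<alpha> * killed.energy f f + s powr (- d) * M1\<^sup>2))"
    by (simp add: power_mult_distrib distrib_left mult_ac)
  then have "q\<^sup>2 * (\<Sum>y\<in>B. m y * (f y)\<^sup>2) \<le>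
     (4 * c\<^sub>M ^ 3 * C\<^sub>w + 2 * c\<^sub>G) * (s powr \<alpha> * killed.energy f f + s powr (- d) * M1\<^sup>2)"
    using s0 by (subst (asm) mult_le_cancel_left_pos) auto
  then have "(\<Sum>y\<in>B. m y * (f y)\<^sup>2) \<le>
     (4 * c\<^sub>M ^ 3 * C\<^sub>w + 2 * c\<^sub>G) * (s powr \<alpha> * killed.energy f f + s powr (- d) * M1\<^sup>2) / q\<^sup>2"
    using q by (subst pos_le_divide_eq) (auto simp only: mult.commute zero_less_power)
  then show ?thesis unfolding q_def[symmetric] M1_def[symmetric] by simp
qed

end

section \<open>Exit probabilities\<close>

context weighted_graph begin

text \<open>Here the differential inequalities meet the graph. The displacement \<open>N\<close> starts at \<open>0\<close> because the
  chain starts at the centre of the ball. Jumps longer than \<open>2 * r\<close> leave the ball, so that the cut at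
  this length makes all long jumps part of the killing.\<close>

lemma exit_probability_bound:
  fixes P :: "'v \<Rightarrow> 'o measure"
  assumes X: "conductance_process V E \<mu> w d \<alpha> P X" and x: "x \<in> V"
    and r: "1 \<le> r" "ereal r < r\<^sub>G" and C0: "0 < C\<^sub>w"
    and near: "\<And>y. y \<in> gball V E x r \<Longrightarrow>
       (\<Sum>z\<in>gball V E y (2 * r). w y z / real (gdist E y z) powr (d + \<alpha> - 2)) \<le> C\<^sub>w * (2 * r) powr (2 - \<alpha>)"
    and far: "\<And>y. y \<in> gball V E x r \<Longrightarrow>
       (\<Sum>\<^sub>\<infinity>z\<in>{z \<in> V. real (gdist E y z) > 2 * r}. w y z / real (gdist E y z) powr (d + \<alpha>)) \<le> C\<^sub>w * (2 * r) powr (- \<alpha>)"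
    and A: "0 < A" and ab: "0 < a" "a \<le> b" "r \<le> b"
    and nash: "\<And>\<sigma> f. a \<le> \<sigma> \<Longrightarrow> \<sigma> \<le> b \<Longrightarrow> (\<And>y. y \<in> gball V E x r \<Longrightarrow> 0 \<le> f y) \<Longrightarrow>
       (\<Sum>y\<in>gball V E x r. m y * (f y)\<^sup>2) \<le> A * (\<sigma> powr \<alpha> * killed_chain.energy (gball V E x r) m C (kill_rate (gball V E x r)) f f
          + \<sigma> powr (- d) * (\<Sum>y\<in>gball V E x r. m y * f y)\<^sup>2)"
    and burn_in: "c\<^sub>M * exp (- s\<^sub>0 / (A * a powr \<alpha>)) \<le> 2 * A * a powr (- d)" "0 < s\<^sub>0" "2 * s\<^sub>0 \<le> s\<^sub>1"
    and t: "s\<^sub>1 \<le> t" "t \<le> r powr \<alpha>"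
    and k: "k = c\<^sub>M * C\<^sub>w * (1 + c\<^sub>G)"
  shows "\<exists>D\<in>sets (P x). D \<subseteq> {\<omega> \<in> space (P x). ennreal t < exit_time X (gball V E x r) \<omega>} \<and>
    1 - measure (P x) D \<le> sqrt (s\<^sub>1 / r powr \<alpha>) * (ln (1 + c\<^sub>M * r powr d) + 2 * k) +
    sqrt (t / r powr \<alpha>) * (ln (1 + nash_constant A \<alpha> d) + 1 + d / \<alpha> * ln (r powr \<alpha> / t) + 2 * (d / \<alpha>) + 2 * k)
     + k * (t / r powr \<alpha>)"
proof -
  define B where "B = gball V E x r"
  have r0: "0 < r" using r by simp
  have B: "B \<subseteq> V" "finite B" "x \<in> B"
    using gball_subset finite_gball[OF x] x r by (auto simp: B_def gball_def)
  have BV: "y \<in> V" if "y \<in> B" for y using that B by auto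
  interpret killed: killed_chain B m C "kill_rate B" by (rule killed_chain_interp[OF B(1,2)])
  define K where "K = nash_constant A \<alpha> d"
  have K0: "0 \<le> K" using A by (simp add: K_def nash_constant_def)
  have k0: "0 < k" using c_M C0 c_G by (simp add: k)
  obtain p where p: "killed.flow p" "\<And>y. p 0 y = of_bool (y = x) / m x" "\<And>t y. t \<ge> 0 \<Longrightarrow> y \<in> B \<Longrightarrow> 0 \<le> p t y"
    by (rule killed.flow_exists[of "\<lambda>y. of_bool (y = x) / m x"]) auto
  have at_x: "(\<Sum>y\<in>B. F y * of_bool (y = x)) = F x" for F :: "'v \<Rightarrow> real"
    using B by (simp add: of_bool_def if_distrib cong: if_cong)
  have mx: "0 < m x" by (rule m_pos[OF x])
  have mass0: "(\<Sum>y\<in>B. m y * p 0 y) = 1"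
    using at_x[of "\<lambda>y. m y / m x"] mx by (simp add: p)
  have mass: "(\<Sum>y\<in>B. m y * p t y) \<le> 1" if "0 \<le> t" for t
    by (rule killed.mass_le_1[OF p(1,3) eq_refl[OF mass0] that])
  have mass_nonneg: "0 \<le> (\<Sum>y\<in>B. m y * p t y)" if "0 \<le> t" for t
    using p(3)[OF that] m_pos BV by (intro sum_nonneg) (auto simp: less_imp_le)
  \<comment> \<open>With this shift \<open>u\<close> times the volume of \<open>B\<close> is at most \<open>c\<^sub>G\<close>.\<close>
  define u where "u = r powr (- d)"
  have u: "0 < u" using r0 by (simp add: u_def)
  define \<Phi> where "\<Phi> t = (\<Sum>y\<in>B. m y * entropy_density u (p t y))" for t
  define \<Phi>' where "\<Phi>' t = killed.energy (p t) (\<lambda>y. ln (1 + p t y / u))" for t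
  define U where "U t = (\<Sum>y\<in>B. m y * (p t y)\<^sup>2)" for t
  define D where "D y = real (gdist E x y)" for y
  define N where "N t = (\<Sum>y\<in>B. m y * p t y * D y) / r + (1 - (\<Sum>y\<in>B. m y * p t y * 1))" for t
  define N' where "N' t = (- killed.energy (p t) D) / r + (0 - - killed.energy (p t) (\<lambda>_. 1))" for t
  have N: "(N has_real_derivative N' t) (at t)" for t
    unfolding N_def N'_def by (intro DERIV_add DERIV_cdivide DERIV_diff DERIV_const killed.mass_deriv[OF p(1)])
  have \<Phi>: "(\<Phi> has_real_derivative - \<Phi>' t) (at t)" if "0 \<le> t" for t
    unfolding \<Phi>_def \<Phi>'_def by (rule killed.entropy_deriv[OF p(1) u that p(3)[OF that]])
  define T where "T = r powr \<alpha>"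
  have T: "0 < T" using r0 by (simp add: T_def)

  \<comment> \<open>\<open>Nb y\<close> are the targets outside \<open>B\<close> of short jumps from \<open>y\<close>; \<open>kf y\<close> is the rate of long jumps.\<close>
  define Nb where "Nb y = gball V E y (2 * r) - B" for y
  define kf where "kf y = kill_rate B y - (\<Sum>z\<in>Nb y. C y z * m z)" for y
  have B_near: "B \<subseteq> gball V E y (2 * r)" if "y \<in> B" for y
    unfolding B_def using that BV[OF that]
    by (intro gball_shift x) (auto simp: B_def gball_def gdist_commute)
  have kf_nonneg: "0 \<le> kf y" if "y \<in> B" for y
    using kill_rate_ge[OF B(2,1) BV[OF that], of "Nb y"] finite_gball[OF BV[OF that]] gball_subset
    by (auto simp: kf_def Nb_def)
  have kf_le: "r * kf y \<le> k * r / T" if y: "y \<in> B" for y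
  proof -
    have yV: "y \<in> V" by (rule BV[OF y])
    define Z where "Z = {z \<in> V. real (gdist E y z) > 2 * r}"
    have G: "finite (gball V E y (2 * r))" "gball V E y (2 * r) \<subseteq> V"
      using finite_gball[OF yV] gball_subset by auto
    have VZ: "V = gball V E y (2 * r) \<union> Z" "gball V E y (2 * r) \<inter> Z = {}"
      by (auto simp: gball_def Z_def)
    have summ: "(\<lambda>z. C y z * m z) summable_on Z"
      by (rule summable_on_subset_banach[OF C_summable[OF yV]]) (auto simp: Z_def)
    have "rate y = (\<Sum>\<^sub>\<infinity>z\<in>gball V E y (2 * r) \<union> Z. C y z * m z)"
      unfolding jump_rate_def using VZ(1) by simp
    also have "\<dots> = (\<Sum>z\<in>gball V E y (2 * r). C y z * m z) + (\<Sum>\<^sub>\<infinity>z\<in>Z. C y z * m z)"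
      using G(1) VZ(2) summ by (subst infsum_Un_disjoint) auto
    also have "(\<Sum>z\<in>gball V E y (2 * r). C y z * m z) = (\<Sum>z\<in>B. C y z * m z) + (\<Sum>z\<in>Nb y. C y z * m z)"
      unfolding Nb_def using G(1) B_near[OF y] by (simp add: sum.subset_diff add.commute)
    finally have "kf y = (\<Sum>\<^sub>\<infinity>z\<in>Z. C y z * m z)" by (simp add: kf_def kill_rate_def)
    also have "\<dots> \<le> (\<Sum>\<^sub>\<infinity>z\<in>Z. C y z * c\<^sub>M)"
    proof (rule infsum_mono[OF summ])
      have "(\<lambda>z. C y z * m z * c\<^sub>M * c\<^sub>M) summable_on Z"
        by (intro summable_on_cmult_left summ)
      then show "(\<lambda>z. C y z * c\<^sub>M) summable_on Z"
      proof (rule summable_on_comparison_test)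
        fix z assume z: "z \<in> Z"
        then have zV: "z \<in> V" by (auto simp: Z_def)
        have "C y z * c\<^sub>M * 1 \<le> C y z * c\<^sub>M * (c\<^sub>M * m z)"
          using m_bounds(2)[OF zV] C_nonneg[OF yV zV] c_M by (intro mult_left_mono) auto
        then show "C y z * c\<^sub>M \<le> C y z * m z * c\<^sub>M * c\<^sub>M" by (simp add: mult_ac)
        show "0 \<le> C y z * c\<^sub>M" using C_nonneg[OF yV zV] c_M by simp
      qed
      show "C y z * m z \<le> C y z * c\<^sub>M" if "z \<in> Z" for z
        using that C_nonneg[OF yV] m_bounds(1) by (intro mult_left_mono) (auto simp: Z_def)
    qed
    also have "\<dots> = (\<Sum>\<^sub>\<infinity>z\<in>Z. C y z) * c\<^sub>M" by (rule infsum_cmult_left')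
    also have "(\<Sum>\<^sub>\<infinity>z\<in>Z. C y z) \<le> C\<^sub>w * (2 * r) powr (- \<alpha>)"
      using far[of y] y by (simp add: conductance_def Z_def B_def)
    also have "(2 * r) powr (- \<alpha>) \<le> r powr (- \<alpha>)"
      using r0 alpha by (intro powr_mono2') auto
    finally have "kf y \<le> C\<^sub>w * r powr (- \<alpha>) * c\<^sub>M" using C0 c_M by simp
    also have "\<dots> = c\<^sub>M * C\<^sub>w * 1 / T" by (simp add: T_def powr_minus divide_inverse mult_ac)
    also have "\<dots> \<le> k / T"
      unfolding k using T c_M C0 c_G by (intro divide_right_mono mult_left_mono) auto
    finally show ?thesis using mult_left_mono[of "kf y" "k / T" r] r0 by (simp add: mult.commute)
  qed
  have moment: "(\<Sum>z\<in>B. C y z * m z * (real (gdist E y z))\<^sup>2) + (\<Sum>z\<in>Nb y. C y z * m z * (real (gdist E y z))\<^sup>2)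
      \<le> c\<^sub>M * C\<^sub>w * (2 * r) powr (2 - \<alpha>)" if y: "y \<in> B" for y
  proof -
    have yV: "y \<in> V" by (rule BV[OF y])
    have "(\<Sum>z\<in>B. C y z * m z * (real (gdist E y z))\<^sup>2) + (\<Sum>z\<in>Nb y. C y z * m z * (real (gdist E y z))\<^sup>2)
      = (\<Sum>z\<in>gball V E y (2 * r). C y z * m z * (real (gdist E y z))\<^sup>2)"
      unfolding Nb_def using finite_gball[OF yV] B_near[OF y] by (simp add: sum.subset_diff add.commute)
    also have "\<dots> \<le> (\<Sum>z\<in>gball V E y (2 * r). c\<^sub>M * (w y z / real (gdist E y z) powr (d + \<alpha> - 2)))"
    proof (intro sum_mono)
      fix z assume "z \<in> gball V E y (2 * r)"
      then have z: "z \<in> V" by (simp add: gball_def)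
      have "C y z * (real (gdist E y z))\<^sup>2 * m z \<le> C y z * (real (gdist E y z))\<^sup>2 * c\<^sub>M"
        using m_bounds(1)[OF z] C_nonneg[OF yV z] by (intro mult_left_mono) auto
      then show "C y z * m z * (real (gdist E y z))\<^sup>2 \<le> c\<^sub>M * (w y z / real (gdist E y z) powr (d + \<alpha> - 2))"
        unfolding C_times_square[OF yV z] using C_times_square[OF yV z] by (simp add: mult_ac)
    qed
    also have "\<dots> \<le> c\<^sub>M * (C\<^sub>w * (2 * r) powr (2 - \<alpha>))"
      unfolding sum_distrib_left[symmetric] using near[of y] y c_M by (intro mult_left_mono) (auto simp: B_def)
    finally show ?thesis by (simp add: mult_ac)
  qed
  have flux: "N' t \<le> L * \<Phi>' t + k / (L * T) + k / T" if t: "0 \<le> t" and L: "0 < L" for t L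
  proof -
    have "- killed.energy (p t) D + r * (\<Sum>y\<in>B. m y * kill_rate B y * p t y)
      \<le> (r * L) * \<Phi>' t + c\<^sub>M * C\<^sub>w * (2 * r) powr (2 - \<alpha>) * (1 + u * (\<Sum>y\<in>B. m y)) / (4 * (r * L)) + k * r / T"
      unfolding \<Phi>'_def
    proof (rule killed.distance_flux[where N = Nb and kf = kf and \<rho> = "\<lambda>y z. real (gdist E y z)"])
      show "B \<noteq> {}" "0 < r" "0 < u" "0 < r * L" using B r0 u L by auto
      show "0 \<le> p t y" if "y \<in> B" for y using p(3) t that by blast
      show "(\<Sum>y\<in>B. m y * p t y) \<le> 1" by (rule mass[OF t])
      show "kill_rate B y = (\<Sum>z\<in>Nb y. C y z * m z) + kf y" for y by (simp add: kf_def)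
      show "0 \<le> C y z * m z" if "y \<in> B" "z \<in> Nb y" for y z
        using that BV C_nonneg by (auto simp: Nb_def gball_def)
      show "D y \<le> r" if "y \<in> B" for y using that by (simp add: D_def B_def gball_def)
      show "0 \<le> D y" for y by (simp add: D_def)
      show "real (gdist E y z) = real (gdist E z y)" for y z by (simp add: gdist_commute)
      show "\<bar>D y - D z\<bar> \<le> real (gdist E y z)" if "y \<in> B" "z \<in> B" for y z
        using gdist_triangle[OF x BV[OF that(1)] BV[OF that(2)]] gdist_triangle[OF x BV[OF that(2)] BV[OF that(1)]]
        by (simp add: D_def gdist_commute[of z y])
      show "r - D y \<le> real (gdist E y z)" if "y \<in> B" "z \<in> Nb y" for y z
      proof -
        have z: "z \<in> V" "r < real (gdist E x z)" using that(2) by (auto simp: Nb_def B_def gball_def)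
        then show ?thesis using gdist_triangle[OF x BV[OF that(1)] z(1)] by (simp add: D_def)
      qed
    qed (use kf_nonneg kf_le moment in auto)
    also have "c\<^sub>M * C\<^sub>w * (2 * r) powr (2 - \<alpha>) * (1 + u * (\<Sum>y\<in>B. m y)) / (4 * (r * L)) \<le> r * (k / (L * T))"
    proof -
      have "(\<Sum>y\<in>B. m y) \<le> c\<^sub>G * r powr d"
        using volume[OF x r] measure_finite[OF B(2,1)] by (simp add: B_def)
      then have "u * (\<Sum>y\<in>B. m y) \<le> u * (c\<^sub>G * r powr d)" using u by simp
      also have "\<dots> = c\<^sub>G" using r0 by (simp add: u_def powr_minus)
      finally have 1: "c\<^sub>M * C\<^sub>w * (1 + u * (\<Sum>y\<in>B. m y)) \<le> k" unfolding k using c_M C0 by simp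
      have "(2 * r) powr (2 - \<alpha>) = 2 powr (2 - \<alpha>) * r powr (2 - \<alpha>)" by (rule powr_mult)
      also have "r powr (2 - \<alpha>) = r * r / T" using r0 by (simp add: T_def powr_diff power2_eq_square)
      also have "2 powr (2 - \<alpha>) * (r * r / T) \<le> 4 * (r * r / T)"
      proof (rule mult_right_mono)
        show "2 powr (2 - \<alpha>) \<le> (4 :: real)" using powr_mono[of "2 - \<alpha>" 2 "2 :: real"] alpha by simp
      qed (use r0 T in simp)
      finally have 2: "(2 * r) powr (2 - \<alpha>) \<le> 4 * (r * r / T)" .
      have "c\<^sub>M * C\<^sub>w * (1 + u * (\<Sum>y\<in>B. m y)) * (2 * r) powr (2 - \<alpha>) \<le> k * (4 * (r * r / T))"
        using 1 2 k0 by (intro mult_mono) auto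
      then have "c\<^sub>M * C\<^sub>w * (2 * r) powr (2 - \<alpha>) * (1 + u * (\<Sum>y\<in>B. m y)) / (4 * (r * L)) \<le> k * (4 * (r * r / T)) / (4 * (r * L))"
        using r0 L by (intro divide_right_mono) (auto simp: mult_ac)
      also have "\<dots> = r * (k / (L * T))" using r0 L T by (simp add: field_simps)
      finally show ?thesis .
    qed
    finally have "- killed.energy (p t) D + r * (\<Sum>y\<in>B. m y * kill_rate B y * p t y) \<le> r * (L * \<Phi>' t + k / (L * T) + k / T)"
      by (simp add: algebra_simps)
    moreover have "N' t = (- killed.energy (p t) D + r * (\<Sum>y\<in>B. m y * kill_rate B y * p t y)) / r"
      using r0 by (simp add: N'_def killed.energy_const add_divide_distrib diff_divide_distrib)
    ultimately show ?thesis using r0 by (simp add: pos_divide_le_eq mult.commute)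
  qed
  have N0: "N 0 = 0"
    using at_x[of "\<lambda>y. m y * D y / m x"] mass0 by (simp add: N_def p D_def mult_ac)
  have entropy0: "\<Phi> 0 \<le> ln (1 + c\<^sub>M * r powr d)"
  proof -
    have "\<Phi> 0 = (\<Sum>y\<in>B. m y * entropy_density u (1 / m x) * of_bool (y = x))"
      unfolding \<Phi>_def by (intro sum.cong refl) (auto simp: p entropy_density_def)
    also have "\<dots> = m x * entropy_density u (1 / m x)" by (rule at_x)
    also have "\<dots> \<le> m x * (1 / m x * ln (1 + 1 / m x / u))"
      using mx u by (intro mult_left_mono entropy_density_le) auto
    also have "\<dots> = ln (1 + 1 / m x * r powr d)" using mx by (simp add: u_def powr_minus divide_inverse)
    also have "\<dots> \<le> ln (1 + c\<^sub>M * r powr d)"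
    proof -
      have "1 / m x * r powr d \<le> c\<^sub>M * r powr d" using m_bounds(3)[OF x] by (intro mult_right_mono) auto
      moreover have "0 \<le> 1 / m x * r powr d" using mx by simp
      ultimately show ?thesis by (intro ln_mono) linarith+
    qed
    finally show ?thesis .
  qed
  have U_decay: "U s \<le> K * s powr (- d / \<alpha>)" if s: "s\<^sub>1 \<le> s" "s \<le> T" for s
    unfolding K_def
  proof (rule nash_decay[where e = "\<lambda>t. killed.energy (p t) (p t)" and a = a and b = b and s\<^sub>0 = s\<^sub>0])
    show "0 < A" "0 < \<alpha>" "0 < d" "0 < a" "a \<le> b" "0 < s\<^sub>0" using A alpha d ab burn_in by auto
    show "(U has_real_derivative - 2 * killed.energy (p t) (p t)) (at t)" for t
      unfolding U_def by (rule killed.l2_deriv[OF p(1)])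
    show "0 \<le> killed.energy (p t) (p t)" for t by (rule killed.energy_nonneg)
    show "U t \<le> A * (\<sigma> powr \<alpha> * killed.energy (p t) (p t) + \<sigma> powr (- d))" if t: "0 \<le> t" "a \<le> \<sigma>" "\<sigma> \<le> b" for t \<sigma>
    proof -
      have "U t \<le> A * (\<sigma> powr \<alpha> * killed.energy (p t) (p t) + \<sigma> powr (- d) * (\<Sum>y\<in>B. m y * p t y)\<^sup>2)"
        using nash[OF t(2,3), of "p t"] p(3)[OF t(1)] by (simp add: U_def B_def)
      also have "\<dots> \<le> A * (\<sigma> powr \<alpha> * killed.energy (p t) (p t) + \<sigma> powr (- d) * 1)"
        using mass[OF t(1)] mass_nonneg[OF t(1)] A by (intro mult_left_mono add_left_mono power_le_one) auto
      finally show ?thesis by simp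
    qed
    have "U 0 = (\<Sum>y\<in>B. m y * (1 / m x)\<^sup>2 * of_bool (y = x))"
      unfolding U_def by (intro sum.cong refl) (auto simp: p)
    also have "\<dots> = 1 / m x" unfolding at_x using mx by (simp add: power2_eq_square)
    finally have "U 0 \<le> c\<^sub>M" using m_bounds(3)[OF x] by simp
    then have "U 0 * exp (- s\<^sub>0 / (A * a powr \<alpha>)) \<le> c\<^sub>M * exp (- s\<^sub>0 / (A * a powr \<alpha>))" by (intro mult_right_mono) auto
    then show "U 0 * exp (- s\<^sub>0 / (A * a powr \<alpha>)) \<le> 2 * A * a powr (- d)" using burn_in(1) by linarith
    show "2 * s\<^sub>0 \<le> s" using burn_in s by simp
    have "r powr \<alpha> \<le> b powr \<alpha>" using ab r0 alpha by (intro powr_mono2) auto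
    then show "s \<le> b powr \<alpha>" using s by (simp add: T_def)
  qed
  have s1: "0 < s\<^sub>1" using burn_in by simp
  have \<Phi>_log: "\<Phi> s \<le> (ln (1 + K) + 1) + d / \<alpha> * ln (T / s)" if s: "s\<^sub>1 \<le> s" "s \<le> T" for s
  proof -
    have s0: "0 < s" "0 \<le> s" using s s1 by auto
    have Ts: "1 \<le> T / s" using s s0 by simp
    have Ts1: "1 \<le> (T / s) powr (d / \<alpha>)" using Ts d alpha by (intro ge_one_powr_ge_zero) auto
    have "U s / u \<le> K * s powr (- d / \<alpha>) / u" using U_decay[OF s] u by (intro divide_right_mono) auto
    also have "s powr (- d / \<alpha>) = 1 / s powr (d / \<alpha>)" by (simp add: powr_minus_divide)
    also have "K * (1 / s powr (d / \<alpha>)) / u = K * (T / s) powr (d / \<alpha>)"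
    proof -
      have "T powr (d / \<alpha>) = r powr d" using alpha by (simp add: T_def powr_powr)
      then have e: "(T / s) powr (d / \<alpha>) = r powr d / s powr (d / \<alpha>)" by (simp only: powr_divide)
      have "1 / u = r powr d" by (simp add: u_def powr_minus_divide)
      then show ?thesis unfolding e by (simp add: divide_inverse mult_ac)
    qed
    finally have "1 + U s / u \<le> 1 + K * (T / s) powr (d / \<alpha>)" by simp
    also have "\<dots> \<le> (1 + K) * (T / s) powr (d / \<alpha>)" using Ts1 by (simp add: distrib_right)
    finally have le: "1 + U s / u \<le> (1 + K) * (T / s) powr (d / \<alpha>)" .
    have Us: "0 \<le> U s" unfolding U_def using m_pos BV by (intro sum_nonneg) (auto simp: less_imp_le)
    have "\<Phi> s \<le> ln (1 + U s / u) + 1"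
      unfolding \<Phi>_def U_def by (rule killed.entropy_le_l2[OF u p(3)[OF s0(2)] mass[OF s0(2)]])
    also have "ln (1 + U s / u) \<le> ln ((1 + K) * (T / s) powr (d / \<alpha>))"
    proof (rule ln_mono)
      show "0 < 1 + U s / u" using Us u by (simp add: add_pos_nonneg)
    qed (use le in auto)
    also have "\<dots> = ln (1 + K) + d / \<alpha> * ln (T / s)"
      using K0 T s0 by (subst ln_mult) (auto simp: ln_powr)
    finally show ?thesis by simp
  qed
  have "N t \<le> sqrt (s\<^sub>1 / T) * (ln (1 + c\<^sub>M * r powr d) + 2 * k)
     + sqrt (t / T) * ((ln (1 + K) + 1) + d / \<alpha> * ln (T / t) + 2 * (d / \<alpha>) + 2 * k) + k * (t / T)"
  proof (rule entropy_flux_integration[where \<Phi> = \<Phi> and \<Phi>' = \<Phi>' and N' = N'])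
    show "0 \<le> \<Phi> t" if "0 \<le> t" for t
      unfolding \<Phi>_def using p(3)[OF that] u m_pos BV
      by (intro sum_nonneg mult_nonneg_nonneg entropy_density_nonneg) (auto simp: less_imp_le)
    show "t \<le> T" using t by (simp add: T_def)
    show "0 \<le> d / \<alpha>" using d alpha by simp
  qed (use N \<Phi> flux N0 entropy0 \<Phi>_log k0 s1 t in auto)
  moreover have "1 - (\<Sum>y\<in>B. m y * p t y) \<le> N t"
  proof -
    have "0 \<le> (\<Sum>y\<in>B. m y * p t y * D y)" using p(3)[of t] t s1 m_pos BV
      by (intro sum_nonneg mult_nonneg_nonneg) (auto simp: less_imp_le D_def)
    then show ?thesis using r0 by (simp add: N_def)
  qed
  moreover obtain D' where "D' \<in> sets (P x)" "D' \<subseteq> {\<omega> \<in> space (P x). ennreal t < exit_time X B \<omega>}"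
    "(\<Sum>y\<in>B. m y * p t y) \<le> measure (P x) D'"
    using exit_survival[OF X B p(1,2), of t] t s1 by auto
  ultimately show ?thesis unfolding B_def[symmetric] T_def[symmetric] K_def[symmetric]
    by (intro bexI[of _ D'] conjI) auto
qed

end

section \<open>The rate of leaving a ball\<close>

context weighted_graph begin

lemma relpow_in_V: "x \<in> V \<Longrightarrow> (x, y) \<in> E ^^ n \<Longrightarrow> y \<in> V"
  using edges(1) by (cases n) auto

text \<open>Cut a shortest path after \<open>i\<close> steps.\<close>

lemma geodesic_vertex:
  assumes "x \<in> V" "y \<in> V" "i \<le> gdist E x y" shows "\<exists>z\<in>V. gdist E x z = i"
proof -
  have "(x, y) \<in> E ^^ (i + (gdist E x y - i))" using gdist_path[OF assms(1,2)] assms(3) by simp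
  then obtain z where z: "(x, z) \<in> E ^^ i" "(z, y) \<in> E ^^ (gdist E x y - i)"
    by (auto simp: relpow_add)
  have zV: "z \<in> V" by (rule relpow_in_V[OF assms(1) z(1)])
  have "gdist E x y \<le> gdist E x z + (gdist E x y - i)"
    using gdist_triangle[OF assms(1) zV assms(2)] gdist_le[OF z(2)] by simp
  then have "gdist E x z = i" using gdist_le[OF z(1)] assms(3) by simp
  then show ?thesis using zV by blast
qed

text \<open>A geodesic of length \<open>n\<close> already has volume of order \<open>n\<close>. For \<open>d < 1\<close> this exceeds the admissible
  volume once \<open>n\<close> is large, so the graph cannot reach that far, and the lower volume bound then limits
  \<open>r\<^sub>G\<close>. Large radii therefore force \<open>d \<ge> 1\<close>.\<close>

lemma sublinear_growth_range:
  assumes x: "x \<in> V" and n: "c\<^sub>M * c\<^sub>G * real n powr d < real n"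
  shows "r\<^sub>G \<le> ereal (2 * real n * c\<^sub>G powr (2 / d))"
proof (rule ccontr)
  define \<rho> where "\<rho> = 2 * real n * c\<^sub>G powr (2 / d)"
  assume "\<not> r\<^sub>G \<le> ereal (2 * real n * c\<^sub>G powr (2 / d))"
  then have \<rho>: "ereal \<rho> < r\<^sub>G" by (simp add: \<rho>_def)
  have n0: "1 \<le> real n" using n c_M c_G by (cases n) auto
  have cg: "1 \<le> c\<^sub>G powr (2 / d)" using c_G d by (intro ge_one_powr_ge_zero) auto
  have n\<rho>: "real n \<le> \<rho>" "1 \<le> \<rho>"
  proof -
    have "real n * 1 \<le> 2 * real n * c\<^sub>G powr (2 / d)" using n0 cg by (intro mult_mono) auto
    then show "real n \<le> \<rho>" by (simp add: \<rho>_def)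
    then show "1 \<le> \<rho>" using n0 by simp
  qed
  have n_rG: "ereal (real n) < r\<^sub>G" using n\<rho>(1) \<rho> by (meson ereal_less_eq(3) le_less_trans)
  have "\<rho> powr d = 2 powr d * real n powr d * c\<^sub>G\<^sup>2"
  proof -
    have "(c\<^sub>G powr (2 / d)) powr d = c\<^sub>G\<^sup>2" using d c_G by (simp add: powr_powr)
    then show ?thesis by (simp only: \<rho>_def powr_mult)
  qed
  moreover have "1 < (2::real) powr d" using d by simp
  then have "1 * (real n powr d * c\<^sub>G\<^sup>2) < 2 powr d * (real n powr d * c\<^sub>G\<^sup>2)"
    using n0 c_G by (intro mult_strict_right_mono) auto
  ultimately have "c\<^sub>G * real n powr d < 1 / c\<^sub>G * \<rho> powr d"
    using c_G by (simp add: field_simps power2_eq_square)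
  then have lt: "measure \<mu> (gball V E x (real n)) < measure \<mu> (gball V E x \<rho>)"
    using volume[OF x n0 n_rG] volume[OF x n\<rho>(2) \<rho>] by linarith
  have "\<exists>y\<in>V. n < gdist E x y"
  proof (rule ccontr)
    assume "\<not> (\<exists>y\<in>V. n < gdist E x y)"
    then have "gball V E x (real n) = gball V E x \<rho>" using n\<rho>(1) by (force simp: gball_def not_less)
    then show False using lt by simp
  qed
  then obtain y where y: "y \<in> V" "n < gdist E x y" by blast
  have "\<forall>i\<in>{..n}. \<exists>z\<in>V. gdist E x z = i"
    using geodesic_vertex[OF x y(1)] y(2) by auto
  then obtain z where z: "\<And>i. i \<in> {..n} \<Longrightarrow> z i \<in> V \<and> gdist E x (z i) = i" by metis
  have inj: "inj_on z {..n}" using z by (metis inj_onI)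
  have sub: "z ` {..n} \<subseteq> gball V E x (real n)" using z by (auto simp: gball_def)
  have "real (n + 1) / c\<^sub>M = (\<Sum>v\<in>z ` {..n}. 1 / c\<^sub>M)" using inj by (simp add: card_image)
  also have "\<dots> \<le> (\<Sum>v\<in>z ` {..n}. m v)" using z atoms by (intro sum_mono) auto
  also have "\<dots> \<le> (\<Sum>v\<in>gball V E x (real n). m v)"
    using sub finite_gball[OF x] by (intro sum_mono2) auto
  also have "\<dots> \<le> c\<^sub>G * real n powr d"
    using volume[OF x n0 n_rG] measure_finite[OF finite_gball[OF x] gball_subset] by simp
  finally have "real (n + 1) \<le> c\<^sub>M * c\<^sub>G * real n powr d" using c_M by (simp add: field_simps)
  then show False using n by simp
qed

text \<open>The ball of radius \<open>s\<close> has at least \<open>16\<close> times the upper volume bound of a ball of radius \<open>r\<close>, so that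
  even its share \<open>c\<^sub>0 > 1 / 2\<close> of vertices with positive weight to \<open>y\<close> lies mostly outside the
  smaller ball. Cauchy--Schwarz between \<open>w\<close> and \<open>1 / w\<close> bounds the total weight of these vertices from
  below.\<close>

lemma kill_rate_lower_bound:
  assumes x: "x \<in> V" and y: "y \<in> gball V E x r" and r: "1 \<le> r" and d1: "1 \<le> d"
    and s: "s = 2 * c_star c\<^sub>G d * r" "ereal s < r\<^sub>G" and c0: "1 / 2 < c\<^sub>0" and Cw: "0 < C\<^sub>w"
    and thick: "c\<^sub>0 * measure \<mu> (gball V E y s) \<le> measure \<mu> (wball V E w y y s)"
    and inv: "(\<Sum>z\<in>wball V E w y y s. inverse (w y z)) \<le> C\<^sub>w * (2 * r) powr d"
  shows "(2 * c_star c\<^sub>G d) powr (- (d + \<alpha>)) / (c\<^sub>M ^ 3 * C\<^sub>w * 2 powr d) * r powr (- \<alpha>) \<le> kill_rate (gball V E x r) y"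
proof -
  define B where "B = gball V E x r"
  define W where "W = wball V E w y y s"
  define F where "F = W - B"
  have yV: "y \<in> V" using y by (simp add: gball_def)
  have cs: "8 \<le> c_star c\<^sub>G d"
    using c_G d ge_one_powr_ge_zero[of c\<^sub>G "2 / d"] by (simp add: c_star_def)
  have rs: "r \<le> s" "0 < s" "1 \<le> s"
  proof -
    have "1 * r \<le> 2 * c_star c\<^sub>G d * r" using r cs by (intro mult_right_mono) auto
    then show "r \<le> s" by (simp add: s)
    then show "0 < s" "1 \<le> s" using r by auto
  qed
  have r_rG: "ereal r < r\<^sub>G" using rs(1) s(2) by (meson ereal_less_eq(3) le_less_trans)
  have W: "W \<subseteq> V" "finite W" "\<And>z. z \<in> W \<Longrightarrow> 0 < w y z" "\<And>z. z \<in> W \<Longrightarrow> real (gdist E y z) \<le> s"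
    unfolding W_def by (rule wball_neighbours[OF yV]; assumption?)+
  have F: "F \<subseteq> V" "finite F" "F \<inter> B = {}" using W by (auto simp: F_def)
  have B: "finite B" "B \<subseteq> V" using finite_gball[OF x] gball_subset by (auto simp: B_def)
  have "r powr d \<le> (\<Sum>z\<in>F. m z)"
  proof -
    have sd: "s powr d = 16 powr d * c\<^sub>G\<^sup>2 * r powr d"
    proof -
      have "s = 16 * (c\<^sub>G powr (2 / d) * r)" by (simp add: s c_star_def)
      also have "\<dots> powr d = 16 powr d * ((c\<^sub>G powr (2 / d)) powr d * r powr d)"
        by (simp only: powr_mult)
      also have "(c\<^sub>G powr (2 / d)) powr d = c\<^sub>G\<^sup>2" using d c_G by (simp add: powr_powr)
      finally show ?thesis by simp
    qed
    have "(16 :: real) powr 1 \<le> 16 powr d" using d1 by (intro powr_mono) auto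
    then have "8 \<le> c\<^sub>0 * 16 powr d" using c0 mult_mono[of "1/2" c\<^sub>0 16 "16 powr d"] by simp
    then have "8 * (c\<^sub>G * r powr d) \<le> c\<^sub>0 * 16 powr d * (c\<^sub>G * r powr d)" using c_G by (intro mult_right_mono) auto
    also have "\<dots> = c\<^sub>0 * (1 / c\<^sub>G * s powr d)" using c_G by (simp add: sd power2_eq_square)
    also have "\<dots> \<le> c\<^sub>0 * measure \<mu> (gball V E y s)"
      using volume[OF yV rs(3) s(2)] c0 by (intro mult_left_mono) auto
    also have "\<dots> \<le> measure \<mu> W" unfolding W_def by (rule thick)
    also have "\<dots> = (\<Sum>z\<in>W. m z)" by (rule measure_finite[OF W(2,1)])
    also have "\<dots> = (\<Sum>z\<in>F. m z) + (\<Sum>z\<in>W \<inter> B. m z)"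
      unfolding F_def using W(2) by (simp add: sum.Int_Diff[of W m B] add.commute)
    also have "(\<Sum>z\<in>W \<inter> B. m z) \<le> (\<Sum>z\<in>B. m z)" using B by (intro sum_mono2) auto
    also have "\<dots> \<le> c\<^sub>G * r powr d" using volume[OF x r r_rG] measure_finite[OF B] by (simp add: B_def)
    finally have "7 * (c\<^sub>G * r powr d) \<le> (\<Sum>z\<in>F. m z)" by simp
    moreover have "1 * r powr d \<le> c\<^sub>G * r powr d" using c_G by (intro mult_right_mono) auto
    moreover have "0 \<le> r powr d" by simp
    ultimately show ?thesis by linarith
  qed
  also have "\<dots> \<le> (\<Sum>z\<in>F. c\<^sub>M)" using F m_bounds(1) by (intro sum_mono) auto
  also have "\<dots> = c\<^sub>M * (\<Sum>z\<in>F. sqrt (w y z) * sqrt (inverse (w y z)))"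
  proof -
    have "(\<Sum>z\<in>F. sqrt (w y z) * sqrt (inverse (w y z))) = (\<Sum>z\<in>F. 1)"
    proof (intro sum.cong refl)
      fix z assume "z \<in> F"
      then have "0 < w y z" using W(3) by (simp add: F_def)
      then show "sqrt (w y z) * sqrt (inverse (w y z)) = 1" by (simp add: real_sqrt_mult[symmetric])
    qed
    then show ?thesis by simp
  qed
  finally have "(r powr d)\<^sup>2 \<le> (c\<^sub>M * (\<Sum>z\<in>F. sqrt (w y z) * sqrt (inverse (w y z))))\<^sup>2"
    by (intro power_mono) auto
  also have "\<dots> \<le> c\<^sub>M\<^sup>2 * ((\<Sum>z\<in>F. (sqrt (w y z))\<^sup>2) * (\<Sum>z\<in>F. (sqrt (inverse (w y z)))\<^sup>2))"
    unfolding power_mult_distrib by (intro mult_left_mono Cauchy_Schwarz_ineq_sum) auto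
  also have "(\<Sum>z\<in>F. (sqrt (w y z))\<^sup>2) = (\<Sum>z\<in>F. w y z)"
    using W(3) by (intro sum.cong) (auto simp: F_def less_imp_le)
  also have "(\<Sum>z\<in>F. (sqrt (inverse (w y z)))\<^sup>2) = (\<Sum>z\<in>F. inverse (w y z))"
    using W(3) by (intro sum.cong) (auto simp: F_def less_imp_le)
  also have "c\<^sub>M\<^sup>2 * ((\<Sum>z\<in>F. w y z) * (\<Sum>z\<in>F. inverse (w y z))) \<le> c\<^sub>M\<^sup>2 * ((\<Sum>z\<in>F. w y z) * (C\<^sub>w * (2 * r) powr d))"
  proof (intro mult_left_mono)
    have "(\<Sum>z\<in>F. inverse (w y z)) \<le> (\<Sum>z\<in>W. inverse (w y z))"
      using W by (intro sum_mono2) (auto simp: F_def less_imp_le)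
    then show "(\<Sum>z\<in>F. inverse (w y z)) \<le> C\<^sub>w * (2 * r) powr d" using inv by (simp add: W_def)
  qed (use F w_nonneg[OF yV] in \<open>auto intro!: sum_nonneg\<close>)
  also have "(2 * r) powr d = 2 powr d * r powr d" by (rule powr_mult)
  finally have "r powr d * r powr d \<le> (c\<^sub>M\<^sup>2 * (C\<^sub>w * 2 powr d) * (\<Sum>z\<in>F. w y z)) * r powr d"
    by (simp add: power2_eq_square mult_ac)
  then have rd: "r powr d \<le> c\<^sub>M\<^sup>2 * (C\<^sub>w * 2 powr d) * (\<Sum>z\<in>F. w y z)" using r by simp
  have "(\<Sum>z\<in>F. w y z) \<le> (\<Sum>z\<in>F. c\<^sub>M * s powr (d + \<alpha>) * (C y z * m z))"
  proof (intro sum_mono)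
    fix z assume z: "z \<in> F"
    then have zV: "z \<in> V" and zW: "z \<in> W" using F by (auto simp: F_def)
    have "w y z \<le> C y z * s powr (d + \<alpha>)" by (rule w_le_C[OF yV zV W(4)[OF zW]])
    also have "\<dots> * 1 \<le> C y z * s powr (d + \<alpha>) * (c\<^sub>M * m z)"
      using m_bounds(2)[OF zV] C_nonneg[OF yV zV] by (intro mult_left_mono) auto
    finally show "w y z \<le> c\<^sub>M * s powr (d + \<alpha>) * (C y z * m z)" by (simp add: mult_ac)
  qed
  also have "\<dots> \<le> c\<^sub>M * s powr (d + \<alpha>) * kill_rate B y"
    unfolding sum_distrib_left[symmetric] using kill_rate_ge[OF B yV F(2,1,3)] c_M by (intro mult_left_mono) auto
  finally have "r powr d \<le> c\<^sub>M\<^sup>2 * (C\<^sub>w * 2 powr d) * (c\<^sub>M * s powr (d + \<alpha>) * kill_rate B y)"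
    using rd c_M Cw by (elim order_trans) (intro mult_left_mono, auto)
  also have "\<dots> = c\<^sub>M ^ 3 * C\<^sub>w * 2 powr d * s powr (d + \<alpha>) * kill_rate B y"
    by (simp add: power2_eq_square power3_eq_cube mult_ac)
  finally have "r powr d / (c\<^sub>M ^ 3 * C\<^sub>w * 2 powr d * s powr (d + \<alpha>)) \<le> kill_rate B y"
    using c_M Cw rs by (subst pos_divide_le_eq) (auto simp: mult_ac)
  moreover have "s powr (d + \<alpha>) = (2 * c_star c\<^sub>G d) powr (d + \<alpha>) * (r powr d * r powr \<alpha>)"
    unfolding s(1) powr_mult[of _ r] by (simp add: powr_add)
  moreover have "r powr d / (c\<^sub>M ^ 3 * C\<^sub>w * 2 powr d * ((2 * c_star c\<^sub>G d) powr (d + \<alpha>) * (r powr d * r powr \<alpha>)))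
     = (2 * c_star c\<^sub>G d) powr (- (d + \<alpha>)) / (c\<^sub>M ^ 3 * C\<^sub>w * 2 powr d) * r powr (- \<alpha>)"
    using r by (simp only: powr_minus) (simp add: divide_inverse mult_ac)
  ultimately show ?thesis by (simp add: B_def)
qed

end

section \<open>Choice of scales and constants\<close>

lemma burn_in_eventually:
  fixes A c \<eta> q :: real
  assumes "0 < A" "0 < \<eta>"
  shows "\<exists>R\<^sub>b. \<forall>R\<ge>R\<^sub>b. c * exp (- (R powr \<eta> / (2 * A))) * R powr q \<le> 2 * A"
proof -
  have "((\<lambda>R. c * exp (- (R powr \<eta> / (2 * A))) * R powr q) \<longlongrightarrow> 0) at_top"
    using assms by real_asymp
  then have "\<forall>\<^sub>F R in at_top. c * exp (- (R powr \<eta> / (2 * A))) * R powr q < 2 * A"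
    using assms by (intro order_tendstoD(2)) auto
  then show ?thesis by (auto simp: eventually_at_top_linorder intro: less_imp_le)
qed

text \<open>The first term carries \<open>ln r\<close>, but also a factor of at most \<open>r powr (- \<epsilon>)\<close> relative to
  \<open>sqrt (t / r powr \<alpha>)\<close>, since the burn-in ends a power of \<open>r\<close> before time \<open>t\<close>.\<close>

lemma exit_bound_simplified:
  fixes d \<alpha> k K c\<^sub>M \<theta>' \<theta>\<^sub>2 r t :: real
  defines "\<epsilon> \<equiv> (\<theta>' - \<theta>\<^sub>2) * \<alpha> / 2"
  assumes pos: "0 < d" "0 < \<alpha>" "0 \<le> k" "0 \<le> K" "1 \<le> c\<^sub>M" and \<theta>: "\<theta>\<^sub>2 < \<theta>'" and r: "1 \<le> r"
    and t: "r powr (\<theta>' * \<alpha>) \<le> t" "t \<le> r powr \<alpha>"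
  shows "sqrt (r powr (\<theta>\<^sub>2 * \<alpha>) / r powr \<alpha>) * (ln (1 + c\<^sub>M * r powr d) + 2 * k) +
    sqrt (t / r powr \<alpha>) * (ln (1 + K) + 1 + d / \<alpha> * ln (r powr \<alpha> / t) + 2 * (d / \<alpha>) + 2 * k)
     + k * (t / r powr \<alpha>)
    \<le> (ln (2 * c\<^sub>M) + d / \<epsilon> + ln (1 + K) + 1 + 3 * (d / \<alpha>) + 5 * k)
      * (t / r powr \<alpha>) powr (1 / 2) * max 1 (ln (r powr \<alpha> / t))"
proof -
  define T where "T = r powr \<alpha>"
  define m where "m = max 1 (ln (T / t))"
  have m: "1 \<le> m" "ln (T / t) \<le> m" by (auto simp: m_def)
  have \<epsilon>: "0 < \<epsilon>" using \<theta> pos by (simp add: \<epsilon>_def)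
  have r0: "0 < r" "0 < T" using r by (auto simp: T_def)
  have t0: "0 < t" using t(1) r0 by (auto intro: less_le_trans[of _ "r powr (\<theta>' * \<alpha>)"])
  define \<sigma> where "\<sigma> = t / T"
  have \<sigma>: "0 < \<sigma>" "\<sigma> \<le> 1" using t0 r0 t by (auto simp: \<sigma>_def T_def)
  have sq: "0 \<le> sqrt \<sigma>" "\<sigma> \<le> sqrt \<sigma>"
  proof -
    show "0 \<le> sqrt \<sigma>" using \<sigma> by simp
    have "sqrt \<sigma> * sqrt \<sigma> \<le> 1 * sqrt \<sigma>" using \<sigma> by (intro mult_right_mono) auto
    then show "\<sigma> \<le> sqrt \<sigma>" using \<sigma> by simp
  qed
  define Q where "Q = ln (2 * c\<^sub>M) + d / \<epsilon> + 2 * k"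
  have l2: "0 \<le> ln (2 * c\<^sub>M)" using pos by simp
  have Q: "0 \<le> Q" using l2 \<epsilon> pos by (simp add: Q_def)
  have first: "sqrt (r powr (\<theta>\<^sub>2 * \<alpha>) / T) * (ln (1 + c\<^sub>M * r powr d) + 2 * k) \<le> sqrt \<sigma> * Q"
  proof -
    have "\<theta>\<^sub>2 * \<alpha> = \<theta>' * \<alpha> + - 2 * \<epsilon>" by (simp add: \<epsilon>_def field_simps)
    then have "r powr (\<theta>\<^sub>2 * \<alpha>) = r powr (\<theta>' * \<alpha>) * r powr (- 2 * \<epsilon>)"
      by (simp only: powr_add)
    also have "\<dots> \<le> t * r powr (- 2 * \<epsilon>)" using t(1) by (intro mult_right_mono) auto
    finally have "r powr (\<theta>\<^sub>2 * \<alpha>) / T \<le> \<sigma> * r powr (- 2 * \<epsilon>)"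
      using r0 by (simp add: \<sigma>_def divide_right_mono)
    then have "sqrt (r powr (\<theta>\<^sub>2 * \<alpha>) / T) \<le> sqrt (\<sigma> * r powr (- 2 * \<epsilon>))" by simp
    also have "\<dots> = sqrt \<sigma> * r powr (- \<epsilon>)"
    proof -
      have "r powr (- 2 * \<epsilon>) = (r powr (- \<epsilon>))\<^sup>2"
        by (simp add: power2_eq_square powr_add[symmetric])
      then show ?thesis by (simp add: real_sqrt_mult)
    qed
    finally have 1: "sqrt (r powr (\<theta>\<^sub>2 * \<alpha>) / T) \<le> sqrt \<sigma> * r powr (- \<epsilon>)" .
    have rd: "1 \<le> r powr d" using r pos by (intro ge_one_powr_ge_zero) auto
    have "1 * 1 \<le> c\<^sub>M * r powr d" using rd pos by (intro mult_mono) auto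
    then have "ln (1 + c\<^sub>M * r powr d) \<le> ln (2 * c\<^sub>M * r powr d)"
      by (intro ln_mono) linarith+
    also have "\<dots> = ln (2 * c\<^sub>M) + d * ln r"
      using pos r0 by (subst ln_mult) (auto simp: ln_powr)
    also have "\<dots> \<le> ln (2 * c\<^sub>M) + d * (r powr \<epsilon> / \<epsilon>)"
      using ln_powr_bound[OF r \<epsilon>] pos by (intro add_left_mono mult_left_mono) auto
    also have "ln (2 * c\<^sub>M) \<le> ln (2 * c\<^sub>M) * r powr \<epsilon>"
      using mult_left_mono[OF ge_one_powr_ge_zero[OF r less_imp_le[OF \<epsilon>]] l2] by simp
    also have "ln (2 * c\<^sub>M) * r powr \<epsilon> + d * (r powr \<epsilon> / \<epsilon>) = (ln (2 * c\<^sub>M) + d / \<epsilon>) * r powr \<epsilon>"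
      by (simp add: distrib_right)
    finally have "ln (1 + c\<^sub>M * r powr d) + 2 * k \<le> (ln (2 * c\<^sub>M) + d / \<epsilon>) * r powr \<epsilon> + 2 * k * r powr \<epsilon>"
      using mult_left_mono[OF ge_one_powr_ge_zero[OF r less_imp_le[OF \<epsilon>]], of "2 * k"] pos by simp
    then have 2: "ln (1 + c\<^sub>M * r powr d) + 2 * k \<le> Q * r powr \<epsilon>" by (simp add: Q_def algebra_simps)
    have "0 \<le> ln (1 + c\<^sub>M * r powr d) + 2 * k" using pos by (intro add_nonneg_nonneg ln_ge_zero) auto
    then have "sqrt (r powr (\<theta>\<^sub>2 * \<alpha>) / T) * (ln (1 + c\<^sub>M * r powr d) + 2 * k) \<le> (sqrt \<sigma> * r powr (- \<epsilon>)) * (Q * r powr \<epsilon>)"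
      using 1 2 sq by (intro mult_mono) auto
    also have "\<dots> = sqrt \<sigma> * Q" using r0 by (simp add: powr_minus)
    finally show ?thesis .
  qed
  define A1 where "A1 = ln (1 + K) + 1 + 2 * (d / \<alpha>) + 2 * k"
  have A1: "0 \<le> A1" using pos by (auto simp: A1_def intro!: add_nonneg_nonneg)
  have "sqrt (r powr (\<theta>\<^sub>2 * \<alpha>) / T) * (ln (1 + c\<^sub>M * r powr d) + 2 * k) \<le> sqrt \<sigma> * (Q * m)"
    using first mult_left_mono[OF mult_left_mono[OF m(1) Q] sq(1)] by simp
  moreover have "sqrt \<sigma> * (A1 + d / \<alpha> * ln (T / t)) \<le> sqrt \<sigma> * ((A1 + d / \<alpha>) * m)"
  proof (intro mult_left_mono sq)
    have "d / \<alpha> * ln (T / t) \<le> d / \<alpha> * m" using m pos by (intro mult_left_mono) auto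
    moreover have "A1 * 1 \<le> A1 * m" using m A1 by (intro mult_left_mono) auto
    ultimately show "A1 + d / \<alpha> * ln (T / t) \<le> (A1 + d / \<alpha>) * m" by (simp add: distrib_right)
  qed
  moreover have "k * \<sigma> \<le> sqrt \<sigma> * (k * m)"
  proof -
    have "k * \<sigma> \<le> k * sqrt \<sigma>" using sq pos by (intro mult_left_mono) auto
    also have "\<dots> \<le> k * sqrt \<sigma> * m" using m pos sq mult_left_mono[of 1 m "k * sqrt \<sigma>"] by simp
    finally show ?thesis by (simp add: mult_ac)
  qed
  ultimately have fin: "sqrt (r powr (\<theta>\<^sub>2 * \<alpha>) / T) * (ln (1 + c\<^sub>M * r powr d) + 2 * k) +
     sqrt \<sigma> * (A1 + d / \<alpha> * ln (T / t)) + k * \<sigma> \<le> sqrt \<sigma> * ((Q + (A1 + d / \<alpha>) + k) * m)"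
    by (simp add: algebra_simps)
  have e1: "ln (2 * c\<^sub>M) + d / \<epsilon> + ln (1 + K) + 1 + 3 * (d / \<alpha>) + 5 * k = Q + (A1 + d / \<alpha>) + k"
    by (simp add: Q_def A1_def)
  have e2: "\<sigma> powr (1 / 2) = sqrt \<sigma>" using \<sigma> by (simp add: powr_half_sqrt)
  have e3: "ln (1 + K) + 1 + d / \<alpha> * ln (T / t) + 2 * (d / \<alpha>) + 2 * k = A1 + d / \<alpha> * ln (T / t)"
    by (simp add: A1_def)
  show ?thesis unfolding T_def[symmetric] \<sigma>_def[symmetric] m_def[symmetric] e1 e2 e3
    using fin by (simp add: mult_ac)
qed

lemma small_time_constant:
  assumes "1 \<le> (c::real)"
  shows "c * (1 / (16 * c) ^ 4) powr (1 / 2) * max 1 (ln ((16 * c) ^ 4)) \<le> 1 / 4"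
proof -
  define y where "y = 16 * c"
  have y: "16 \<le> y" using assms by (simp add: y_def)
  have "(1 / y ^ 4) powr (1 / 2) = sqrt ((1 / y\<^sup>2)\<^sup>2)"
    using y by (simp add: powr_half_sqrt power_divide)
  also have "\<dots> = 1 / y\<^sup>2" using y by simp
  finally have e: "(1 / y ^ 4) powr (1 / 2) = 1 / y\<^sup>2" .
  have "ln (y ^ 4) = 4 * ln y" using y by (simp add: ln_realpow)
  also have "\<dots> \<le> 4 * y" using ln_le_minus_one[of y] y by simp
  finally have "max 1 (ln (y ^ 4)) \<le> 4 * y" using y by simp
  then have "c * (1 / y\<^sup>2) * max 1 (ln (y ^ 4)) \<le> c * (1 / y\<^sup>2) * (4 * y)"
    using assms by (intro mult_left_mono) auto
  also have "\<dots> = 1 / 4" using y by (simp add: y_def power2_eq_square)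
  finally show ?thesis using e by (simp add: y_def)
qed


context weighted_graph begin

lemma c_star_ge_8: "8 \<le> c_star c\<^sub>G d"
  using c_G d ge_one_powr_ge_zero[of c\<^sub>G "2 / d"] by (simp add: c_star_def)

text \<open>The bound on the volume of the vertices with positive weight is needed at radius \<open>2 * c_star c\<^sub>G d * r\<close>, and is taken from
  the hypotheses for the larger ball of radius \<open>c_star c\<^sub>G d * R\<close>; the inverse weights are controlled
  up to that radius by the hypothesis at scale \<open>R\<close> itself.\<close>

lemma mean_exit_time_at_scale:
  fixes P :: "'v \<Rightarrow> 'o measure"
  assumes X: "conductance_process V E \<mu> w d \<alpha> P X" and v: "v \<in> V" and x: "x \<in> gball V E v (2 * R)"
    and R: "1 \<le> R" "ereal (2 * c_star c\<^sub>G d * R) < r\<^sub>G" and \<theta>: "0 < \<theta>" "\<theta> < 1"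
    and r: "R powr \<theta> \<le> r" "r \<le> R" and d1: "1 \<le> d" and c0: "1 / 2 < c\<^sub>0" and Cw: "0 < C\<^sub>w"
    and thick: "\<And>\<rho> y. (c_star c\<^sub>G d * R) powr \<theta> / 2 \<le> \<rho> \<Longrightarrow> \<rho> \<le> 2 * (c_star c\<^sub>G d * R) \<Longrightarrow>
       y \<in> gball V E v (6 * (c_star c\<^sub>G d * R)) \<Longrightarrow>
       c\<^sub>0 * measure \<mu> (gball V E y \<rho>) \<le> measure \<mu> (wball V E w y y \<rho>)"
    and inv: "\<And>\<rho> y. R powr \<theta> / 2 \<le> \<rho> \<Longrightarrow> \<rho> \<le> 2 * R \<Longrightarrow> y \<in> gball V E v (6 * R) \<Longrightarrow>
       (\<Sum>z\<in>wball V E w y y (c_star c\<^sub>G d * \<rho>). inverse (w y z)) \<le> C\<^sub>w * \<rho> powr d"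
    and \<kappa>: "\<kappa> = (2 * c_star c\<^sub>G d) powr (- (d + \<alpha>)) / (c\<^sub>M ^ 3 * C\<^sub>w * 2 powr d)"
  shows "(\<integral>\<^sup>+\<omega>. exit_time X (gball V E x r) \<omega> \<partial>P x) \<le> ennreal (2 / \<kappa> * r powr \<alpha>)"
proof -
  note cs = c_star_ge_8
  have r1: "1 \<le> r" using ge_one_powr_ge_zero[OF R(1), of \<theta>] \<theta> r by simp
  have xV: "x \<in> V" using x by (simp add: gball_def)
  have \<kappa>0: "0 < \<kappa>" using cs c_M Cw by (simp add: \<kappa>)
  show ?thesis
  proof (rule mean_exit_time_le[OF X gball_subset finite_gball[OF xV]])
    show "x \<in> gball V E x r" using xV r1 by (simp add: gball_def)
    show "0 \<le> 2 / \<kappa> * r powr \<alpha>" using \<kappa>0 by simp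
    fix y assume y: "y \<in> gball V E x r"
    have y6: "y \<in> gball V E v (6 * R)"
      using gball_shift[OF xV v, of r "6 * R"] x r R y by (auto simp: gball_def)
    have RcR: "R \<le> c_star c\<^sub>G d * R" using mult_right_mono[of 1 "c_star c\<^sub>G d" R] cs R by simp
    have y6': "y \<in> gball V E v (6 * (c_star c\<^sub>G d * R))"
      using y6 gball_mono[of "6 * R" "6 * (c_star c\<^sub>G d * R)" v] RcR by auto
    have "\<kappa> * r powr (- \<alpha>) \<le> kill_rate (gball V E x r) y"
      unfolding \<kappa>
    proof (rule kill_rate_lower_bound[OF xV y r1 d1 refl _ c0 Cw])
      have "2 * c_star c\<^sub>G d * r \<le> 2 * c_star c\<^sub>G d * R" using r cs by (intro mult_left_mono) auto
      then show "ereal (2 * c_star c\<^sub>G d * r) < r\<^sub>G" using R(2) by (meson ereal_less_eq(3) le_less_trans)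
      show "c\<^sub>0 * measure \<mu> (gball V E y (2 * c_star c\<^sub>G d * r)) \<le> measure \<mu> (wball V E w y y (2 * c_star c\<^sub>G d * r))"
      proof (rule thick[OF _ _ y6'])
        show "2 * c_star c\<^sub>G d * r \<le> 2 * (c_star c\<^sub>G d * R)" using r cs by simp
        have "(c_star c\<^sub>G d * R) powr \<theta> = c_star c\<^sub>G d powr \<theta> * R powr \<theta>" by (rule powr_mult)
        also have "c_star c\<^sub>G d powr \<theta> * R powr \<theta> \<le> c_star c\<^sub>G d * R powr \<theta>"
        proof (rule mult_right_mono)
          have "c_star c\<^sub>G d powr \<theta> \<le> c_star c\<^sub>G d powr 1" using cs \<theta> by (intro powr_mono) auto
          then show "c_star c\<^sub>G d powr \<theta> \<le> c_star c\<^sub>G d" using cs by simp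
        qed simp
        also have "\<dots> \<le> c_star c\<^sub>G d * r" using r cs by (intro mult_left_mono) auto
        finally have "(c_star c\<^sub>G d * R) powr \<theta> \<le> c_star c\<^sub>G d * r" .
        then show "(c_star c\<^sub>G d * R) powr \<theta> / 2 \<le> 2 * c_star c\<^sub>G d * r"
        proof -
          have "0 \<le> c_star c\<^sub>G d * r" using cs r1 by simp
          then show ?thesis using \<open>(c_star c\<^sub>G d * R) powr \<theta> \<le> c_star c\<^sub>G d * r\<close> by linarith
        qed
      qed
      show "(\<Sum>z\<in>wball V E w y y (2 * c_star c\<^sub>G d * r). inverse (w y z)) \<le> C\<^sub>w * (2 * r) powr d"
      proof -
        have "R powr \<theta> / 2 \<le> 2 * r" using r r1 by simp
        from inv[OF this _ y6] show ?thesis using r by (simp add: mult_ac)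
      qed
    qed
    then have "2 / \<kappa> * r powr \<alpha> * (\<kappa> * r powr (- \<alpha>)) \<le> 2 / \<kappa> * r powr \<alpha> * kill_rate (gball V E x r) y"
      using \<kappa>0 by (intro mult_left_mono) auto
    moreover have "2 / \<kappa> * r powr \<alpha> * (\<kappa> * r powr (- \<alpha>)) = 2" using \<kappa>0 r1 by (simp add: powr_minus)
    ultimately show "2 \<le> 2 / \<kappa> * r powr \<alpha> * kill_rate (gball V E x r) y" by simp
  qed
qed

lemma exit_probability_at_scale:
  fixes P :: "'v \<Rightarrow> 'o measure"
  assumes X: "conductance_process V E \<mu> w d \<alpha> P X" and v: "v \<in> V" and x: "x \<in> gball V E v (2 * R)"
    and R: "1 \<le> R" "ereal (2 * R) < r\<^sub>G" and \<theta>: "0 < \<theta>" "\<theta> < 1"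
    and r: "R powr \<theta> \<le> r" "r \<le> R" and c0: "0 < c\<^sub>0" and Cw: "0 < C\<^sub>w"
    and near: "\<And>\<rho> y. R powr \<theta> / 2 \<le> \<rho> \<Longrightarrow> \<rho> \<le> 2 * R \<Longrightarrow> y \<in> gball V E v (6 * R) \<Longrightarrow>
       (\<Sum>z\<in>gball V E y \<rho>. w y z / real (gdist E y z) powr (d + \<alpha> - 2)) \<le> C\<^sub>w * \<rho> powr (2 - \<alpha>)"
    and thick: "\<And>\<rho> y. R powr \<theta> / 2 \<le> \<rho> \<Longrightarrow> \<rho> \<le> 2 * R \<Longrightarrow> y \<in> gball V E v (6 * R) \<Longrightarrow>
       c\<^sub>0 * measure \<mu> (gball V E y \<rho>) \<le> measure \<mu> (wball V E w y y \<rho>)"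
    and inv: "\<And>\<rho> y. R powr \<theta> / 2 \<le> \<rho> \<Longrightarrow> \<rho> \<le> 2 * R \<Longrightarrow> y \<in> gball V E v (6 * R) \<Longrightarrow>
       (\<Sum>z\<in>wball V E w y y (c_star c\<^sub>G d * \<rho>). inverse (w y z)) \<le> C\<^sub>w * \<rho> powr d"
    and far: "\<And>\<rho> y. R powr \<theta> / 2 \<le> \<rho> \<Longrightarrow> y \<in> gball V E v (6 * R) \<Longrightarrow>
       (\<Sum>\<^sub>\<infinity>z\<in>{z \<in> V. real (gdist E y z) > \<rho>}. w y z / real (gdist E y z) powr (d + \<alpha>)) \<le> C\<^sub>w * \<rho> powr (- \<alpha>)"
    and A: "A = (4 * c\<^sub>M ^ 3 * C\<^sub>w + 2 * c\<^sub>G) / (c\<^sub>0 / c\<^sub>G)\<^sup>2"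
    and burn_in: "c\<^sub>M * exp (- s\<^sub>0 / (A * (R powr \<theta>) powr \<alpha>)) \<le> 2 * A * (R powr \<theta>) powr (- d)" "0 < s\<^sub>0" "2 * s\<^sub>0 \<le> s\<^sub>1"
    and t: "s\<^sub>1 \<le> t" "t \<le> r powr \<alpha>"
    and k: "k = c\<^sub>M * C\<^sub>w * (1 + c\<^sub>G)"
  shows "\<exists>D\<in>sets (P x). D \<subseteq> {\<omega> \<in> space (P x). ennreal t < exit_time X (gball V E x r) \<omega>} \<and>
    1 - measure (P x) D \<le> sqrt (s\<^sub>1 / r powr \<alpha>) * (ln (1 + c\<^sub>M * r powr d) + 2 * k) +
    sqrt (t / r powr \<alpha>) * (ln (1 + nash_constant A \<alpha> d) + 1 + d / \<alpha> * ln (r powr \<alpha> / t) + 2 * (d / \<alpha>) + 2 * k)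
     + k * (t / r powr \<alpha>)"
proof -
  have R\<theta>: "1 \<le> R powr \<theta>" using R \<theta> by (intro ge_one_powr_ge_zero) auto
  then have r1: "1 \<le> r" using r by simp
  have xV: "x \<in> V" using x by (simp add: gball_def)
  have y6: "y \<in> gball V E v (6 * R)" if "y \<in> gball V E x r" for y
    using gball_shift[OF xV v, of r "6 * R"] x r R that by (auto simp: gball_def)
  have A0: "0 < A" unfolding A using c_M c_G Cw c0
    by (intro divide_pos_pos zero_less_power add_nonneg_pos mult_nonneg_nonneg) auto
  have "r \<le> 2 * R" using r R by simp
  then have r_rG: "ereal r < r\<^sub>G" using R(2) by (meson ereal_less_eq(3) le_less_trans)
  show ?thesis
  proof (rule exit_probability_bound[OF X xV r1 r_rG Cw _ _ A0 _ _ _ _ burn_in t k])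
    show "(\<Sum>z\<in>gball V E y (2 * r). w y z / real (gdist E y z) powr (d + \<alpha> - 2)) \<le> C\<^sub>w * (2 * r) powr (2 - \<alpha>)"
      if "y \<in> gball V E x r" for y
      using r r1 by (intro near y6 that) auto
    show "(\<Sum>\<^sub>\<infinity>z\<in>{z \<in> V. real (gdist E y z) > 2 * r}. w y z / real (gdist E y z) powr (d + \<alpha>)) \<le> C\<^sub>w * (2 * r) powr (- \<alpha>)"
      if "y \<in> gball V E x r" for y
      using r r1 by (intro far y6 that) auto
    show "0 < R powr \<theta>" "R powr \<theta> \<le> 2 * R" "r \<le> 2 * R" using R\<theta> r R by auto
    fix \<sigma> and f :: "'v \<Rightarrow> real"
    assume \<sigma>: "R powr \<theta> \<le> \<sigma>" "\<sigma> \<le> 2 * R" and f: "\<And>y. y \<in> gball V E x r \<Longrightarrow> 0 \<le> f y"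
    have \<sigma>R: "R powr \<theta> / 2 \<le> \<sigma>" "1 \<le> \<sigma>" using \<sigma> R\<theta> by auto
    have \<sigma>_rG: "ereal \<sigma> < r\<^sub>G" using \<sigma>(2) R(2) by (meson ereal_less_eq(3) le_less_trans)
    show "(\<Sum>y\<in>gball V E x r. m y * (f y)\<^sup>2) \<le> A * (\<sigma> powr \<alpha> * killed_chain.energy (gball V E x r) m C (kill_rate (gball V E x r)) f f
          + \<sigma> powr (- d) * (\<Sum>y\<in>gball V E x r. m y * f y)\<^sup>2)"
      unfolding A
    proof (rule nash_inequality[OF finite_gball[OF xV] gball_subset \<sigma>R(2) \<sigma>_rG c0 less_imp_le[OF Cw] _ _ f])
      fix y assume y: "y \<in> gball V E x r"
      have yV: "y \<in> V" using y by (simp add: gball_def)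
      show "c\<^sub>0 * measure \<mu> (gball V E y \<sigma>) \<le> measure \<mu> (wball V E w y y \<sigma>)"
        by (rule thick[OF \<sigma>R(1) \<sigma>(2) y6[OF y]])
      have "(\<Sum>z\<in>wball V E w y y \<sigma>. inverse (w y z)) \<le> (\<Sum>z\<in>wball V E w y y (c_star c\<^sub>G d * \<sigma>). inverse (w y z))"
      proof (rule sum_mono2)
        show "finite (wball V E w y y (c_star c\<^sub>G d * \<sigma>))"
          by (rule finite_subset[OF _ finite_gball[OF yV]]) (auto simp: wball_def)
        have "\<sigma> \<le> c_star c\<^sub>G d * \<sigma>" using mult_right_mono[of 1 "c_star c\<^sub>G d" \<sigma>] c_star_ge_8 \<sigma>R by simp
        then show "wball V E w y y \<sigma> \<subseteq> wball V E w y y (c_star c\<^sub>G d * \<sigma>)"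
          using gball_mono[of \<sigma> "c_star c\<^sub>G d * \<sigma>" y] by (auto simp: wball_def)
        show "0 \<le> inverse (w y z)" if "z \<in> wball V E w y y (c_star c\<^sub>G d * \<sigma>) - wball V E w y y \<sigma>" for z
          using that w_nonneg[OF yV] by (auto simp: wball_def gball_def)
      qed
      also have "\<dots> \<le> C\<^sub>w * \<sigma> powr d" by (rule inv[OF \<sigma>R(1) \<sigma>(2) y6[OF y]])
      finally show "(\<Sum>z\<in>wball V E w y y \<sigma>. inverse (w y z)) \<le> C\<^sub>w * \<sigma> powr d" .
    qed
  qed
qed

end

theorem theorem3p3:
  fixes d \<alpha> c\<^sub>G c\<^sub>M \<theta> R\<^sub>0 c\<^sub>0 C \<theta>' :: real
  assumes "d > 0" and "0 < \<alpha>" and "\<alpha> < 2" and "c\<^sub>G \<ge> 1" and "c\<^sub>M \<ge> 1"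
    and "0 < \<theta>" and "\<theta> < 1"
    and "R\<^sub>0 \<ge> 1" and "1/2 < c\<^sub>0" and "c\<^sub>0 < 1" and "C > 0"
    and "\<theta> < \<theta>'" and "\<theta>' < 1"
  shows "\<exists>R\<^sub>1 \<delta> C\<^sub>0 C\<^sub>1 C\<^sub>2. R\<^sub>1 \<ge> 1 \<and> \<theta> < \<delta> \<and> \<delta> < 1 \<and> C\<^sub>0 > 0 \<and> C\<^sub>1 > 0 \<and> C\<^sub>2 > 0 \<and>
    (\<forall>(V :: 'v set) E \<mu> w (r\<^sub>G :: ereal) v\<^sub>0 (P :: 'v \<Rightarrow> 'o measure) X.
      weighted_graph V E \<mu> w d \<alpha> r\<^sub>G c\<^sub>G c\<^sub>M \<longrightarrow>
      v\<^sub>0 \<in> V \<longrightarrow>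
      conductance_process V E \<mu> w d \<alpha> P X \<longrightarrow>
      (\<forall>R r. R\<^sub>0 < R \<and> ereal R < r\<^sub>G \<and> R powr \<theta> / 2 \<le> r \<and> r \<le> 2 * R \<longrightarrow>
        (\<forall>x \<in> gball V E v\<^sub>0 (6 * R).
          (\<Sum>y\<in>gball V E x r. w x y / real (gdist E x y) powr (d + \<alpha> - 2)) \<le> C * r powr (2 - \<alpha>)) \<and>
        (\<forall>x \<in> gball V E v\<^sub>0 (6 * R). \<forall>z \<in> gball V E v\<^sub>0 (6 * R).
          measure \<mu> (wball V E w z x r) \<ge> c\<^sub>0 * measure \<mu> (gball V E x r)) \<and>
        (\<forall>x \<in> gball V E v\<^sub>0 (6 * R).
          (\<Sum>y\<in>wball V E w x x (c_star c\<^sub>G d * r). inverse (w x y)) \<le> C * r powr d)) \<longrightarrow>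
      (\<forall>R r. R\<^sub>0 < R \<and> ereal R < r\<^sub>G \<and> R powr \<theta> / 2 \<le> r \<longrightarrow>
        (\<forall>x \<in> gball V E v\<^sub>0 (6 * R).
          (\<Sum>\<^sub>\<infinity>y\<in>{y \<in> V. real (gdist E x y) > r}. w x y / real (gdist E x y) powr (d + \<alpha>))
            \<le> C * r powr (- \<alpha>))) \<longrightarrow>
      (\<forall>R r. R\<^sub>1 < R \<and> ereal R < r\<^sub>G / ereal (2 * c_star c\<^sub>G d) \<and> R powr \<delta> \<le> r \<and> r \<le> R \<longrightarrow>
        (\<forall>x \<in> gball V E v\<^sub>0 (2 * R).
          measure (P x) {\<omega> \<in> space (P x).
              exit_time X (gball V E x r) \<omega> \<le> ennreal (C\<^sub>0 * r powr \<alpha>)} \<le> 1/4) \<and>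
        (\<forall>x \<in> gball V E v\<^sub>0 (2 * R). \<forall>t \<ge> r powr (\<theta>' * \<alpha>).
          measure (P x) {\<omega> \<in> space (P x). exit_time X (gball V E x r) \<omega> \<le> ennreal t}
            \<le> C\<^sub>1 * (t / r powr \<alpha>) powr (1/2) * max 1 (ln (r powr \<alpha> / t))) \<and>
        (\<forall>x \<in> gball V E v\<^sub>0 (2 * R).
          ennreal (C\<^sub>2 * r powr \<alpha>) \<le> (\<integral>\<^sup>+\<omega>. exit_time X (gball V E x r) \<omega> \<partial>P x) \<and>
          (\<integral>\<^sup>+\<omega>. exit_time X (gball V E x r) \<omega> \<partial>P x) \<le> ennreal (C\<^sub>1 * r powr \<alpha>))))"
proof -
  define cst where "cst = c_star c\<^sub>G d"
  have cs: "8 \<le> cst"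
    using assms ge_one_powr_ge_zero[of c\<^sub>G "2 / d"] by (simp add: cst_def c_star_def)
  \<comment> \<open>The burn-in takes time \<open>r powr (\<theta>\<^sub>2 * \<alpha>) / 2\<close>, which must be shorter than \<open>r powr (\<theta>' * \<alpha>)\<close> by a power of \<open>r\<close> and
    longer than \<open>R powr (\<theta> * \<alpha>)\<close> by a power of \<open>R\<close>. The latter requires \<open>\<delta> * \<theta>\<^sub>2 > \<theta>\<close>.\<close>
  define \<theta>\<^sub>2 where "\<theta>\<^sub>2 = (\<theta> + \<theta>') / 2"
  have \<theta>\<^sub>2: "\<theta> < \<theta>\<^sub>2" "\<theta>\<^sub>2 < \<theta>'" "\<theta>\<^sub>2 < 1" "0 < \<theta>\<^sub>2" using assms by (auto simp: \<theta>\<^sub>2_def)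
  define q where "q = \<theta> / \<theta>\<^sub>2"
  have q: "q < 1" "\<theta> \<le> q" using \<theta>\<^sub>2 assms by (auto simp: q_def field_simps)
  define \<delta> where "\<delta> = (1 + q) / 2"
  have \<delta>: "q < \<delta>" "\<delta> < 1" "\<theta> < \<delta>" using q by (auto simp: \<delta>_def)
  have \<delta>\<theta>: "\<theta> < \<delta> * \<theta>\<^sub>2" using \<delta>(1) \<theta>\<^sub>2 by (simp add: q_def pos_divide_less_eq)
  define A where "A = (4 * c\<^sub>M ^ 3 * C + 2 * c\<^sub>G) / (c\<^sub>0 / c\<^sub>G)\<^sup>2"
  have A0: "0 < A" unfolding A_def using assms
    by (intro divide_pos_pos zero_less_power add_nonneg_pos mult_nonneg_nonneg) auto
  define K where "K = nash_constant A \<alpha> d"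
  have K0: "0 \<le> K" using A0 by (simp add: K_def nash_constant_def)
  define k where "k = c\<^sub>M * C * (1 + c\<^sub>G)"
  have k0: "0 \<le> k" using assms by (simp add: k_def)
  define \<kappa> where "\<kappa> = (2 * c_star c\<^sub>G d) powr (- (d + \<alpha>)) / (c\<^sub>M ^ 3 * C * 2 powr d)"
  have \<kappa>0: "0 < \<kappa>" using cs assms by (simp add: \<kappa>_def cst_def)
  define \<epsilon> where "\<epsilon> = (\<theta>' - \<theta>\<^sub>2) * \<alpha> / 2"
  have \<epsilon>0: "0 < \<epsilon>" using \<theta>\<^sub>2 assms by (simp add: \<epsilon>_def)
  define Ca where "Ca = ln (2 * c\<^sub>M) + d / \<epsilon> + ln (1 + K) + 1 + 3 * (d / \<alpha>) + 5 * k"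
  have Ca: "1 \<le> Ca" using assms \<epsilon>0 K0 k0 by (auto simp: Ca_def intro!: add_increasing add_increasing2)
  define C\<^sub>1 where "C\<^sub>1 = Ca + 2 / \<kappa>"
  have C1: "1 \<le> C\<^sub>1" "Ca \<le> C\<^sub>1" "2 / \<kappa> \<le> C\<^sub>1" using Ca \<kappa>0 by (auto simp: C\<^sub>1_def add_increasing2)
  \<comment> \<open>At \<open>t = C\<^sub>0 * r powr \<alpha>\<close> the square root is \<open>1 / (16 * C\<^sub>1)\<^sup>2\<close>, which beats the logarithm; see
    \<open>small_time_constant\<close>.\<close>
  define C\<^sub>0 where "C\<^sub>0 = 1 / (16 * C\<^sub>1) ^ 4"
  have "1 \<le> (16 * C\<^sub>1) ^ 4" using C1 by (intro one_le_power) auto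
  then have C0: "0 < C\<^sub>0" "C\<^sub>0 \<le> 1" using C1 unfolding C\<^sub>0_def by (auto simp only: divide_le_eq_1 zero_less_divide_1_iff)
  define \<eta> where "\<eta> = (\<delta> * \<theta>\<^sub>2 - \<theta>) * \<alpha>"
  have \<eta>0: "0 < \<eta>" using \<delta>\<theta> assms by (simp add: \<eta>_def)
  obtain R\<^sub>b where R\<^sub>b: "\<And>R. R\<^sub>b \<le> R \<Longrightarrow> c\<^sub>M * exp (- (R powr \<eta> / (2 * A))) * R powr (\<theta> * d) \<le> 2 * A"
    using burn_in_eventually[OF A0 \<eta>0, of c\<^sub>M "\<theta> * d"] by auto
  \<comment> \<open>Beyond \<open>R\<^sub>e\<close> the time \<open>C\<^sub>0 * r powr \<alpha>\<close> is at least \<open>r powr (\<theta>' * \<alpha>)\<close>.\<close>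
  define R\<^sub>e where "R\<^sub>e = ((16 * C\<^sub>1) ^ 4) powr (1 / (\<delta> * (1 - \<theta>') * \<alpha>))"
  have "\<exists>R\<^sub>d. d < 1 \<longrightarrow> (\<forall>(V :: 'v set) E \<mu> w r\<^sub>G v. weighted_graph V E \<mu> w d \<alpha> r\<^sub>G c\<^sub>G c\<^sub>M \<longrightarrow> v \<in> V \<longrightarrow> r\<^sub>G \<le> ereal R\<^sub>d)"
  proof (cases "d < 1")
    case True
    have "filterlim (\<lambda>n. real n powr (1 - d)) at_top sequentially" using True by real_asymp
    then have "\<forall>\<^sub>F n in sequentially. c\<^sub>M * c\<^sub>G < real n powr (1 - d)" by (simp add: filterlim_at_top_dense)
    then have "\<forall>\<^sub>F n in sequentially. c\<^sub>M * c\<^sub>G < real n powr (1 - d) \<and> 0 < n"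
      using eventually_gt_at_top[of 0] by eventually_elim simp
    then obtain n :: nat where n: "c\<^sub>M * c\<^sub>G < real n powr (1 - d)" "0 < n"
      using eventually_happens[of _ sequentially] by auto
    have "c\<^sub>M * c\<^sub>G * real n powr d < real n powr (1 - d) * real n powr d"
      using n by (intro mult_strict_right_mono) auto
    also have "\<dots> = real n" using n by (simp add: powr_add[symmetric])
    finally have n': "c\<^sub>M * c\<^sub>G * real n powr d < real n" .
    show ?thesis
      by (intro exI[of _ "2 * real n * c\<^sub>G powr (2 / d)"] impI allI)
        (rule weighted_graph.sublinear_growth_range[OF _ _ n'])
  qed simp
  then obtain R\<^sub>d where R\<^sub>d: "\<And>(V :: 'v set) E \<mu> w r\<^sub>G v. d < 1 \<Longrightarrow> weighted_graph V E \<mu> w d \<alpha> r\<^sub>G c\<^sub>G c\<^sub>M \<Longrightarrow> v \<in> V \<Longrightarrow> r\<^sub>G \<le> ereal R\<^sub>d"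
    by blast
  define R\<^sub>1 where "R\<^sub>1 = max 1 (max R\<^sub>0 (max R\<^sub>b (max R\<^sub>e R\<^sub>d)))"
  have R1: "1 \<le> R\<^sub>1" "R\<^sub>0 \<le> R\<^sub>1" "R\<^sub>b \<le> R\<^sub>1" "R\<^sub>e \<le> R\<^sub>1" "R\<^sub>d \<le> R\<^sub>1" by (auto simp: R\<^sub>1_def)
  define C\<^sub>2 where "C\<^sub>2 = C\<^sub>0 * (3 / 4)"
  show ?thesis
  proof (rule exI[of _ R\<^sub>1], rule exI[of _ \<delta>], rule exI[of _ C\<^sub>0], rule exI[of _ C\<^sub>1], rule exI[of _ C\<^sub>2],
      intro conjI allI impI)
    show "1 \<le> R\<^sub>1" "\<theta> < \<delta>" "\<delta> < 1" "0 < C\<^sub>0" "0 < C\<^sub>1" "0 < C\<^sub>2"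
      using R1 \<delta> C0 C1 by (auto simp: C\<^sub>2_def)
    fix V :: "'v set" and E \<mu> w and r\<^sub>G :: ereal and v\<^sub>0 and P :: "'v \<Rightarrow> 'o measure" and X and R r :: real
    assume WG: "weighted_graph V E \<mu> w d \<alpha> r\<^sub>G c\<^sub>G c\<^sub>M" and v: "v\<^sub>0 \<in> V"
      and X: "conductance_process V E \<mu> w d \<alpha> P X"
      and H1: "\<forall>R r. R\<^sub>0 < R \<and> ereal R < r\<^sub>G \<and> R powr \<theta> / 2 \<le> r \<and> r \<le> 2 * R \<longrightarrow>
        (\<forall>x \<in> gball V E v\<^sub>0 (6 * R).
          (\<Sum>y\<in>gball V E x r. w x y / real (gdist E x y) powr (d + \<alpha> - 2)) \<le> C * r powr (2 - \<alpha>)) \<and>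
        (\<forall>x \<in> gball V E v\<^sub>0 (6 * R). \<forall>z \<in> gball V E v\<^sub>0 (6 * R).
          measure \<mu> (wball V E w z x r) \<ge> c\<^sub>0 * measure \<mu> (gball V E x r)) \<and>
        (\<forall>x \<in> gball V E v\<^sub>0 (6 * R).
          (\<Sum>y\<in>wball V E w x x (c_star c\<^sub>G d * r). inverse (w x y)) \<le> C * r powr d)"
      and H2: "\<forall>R r. R\<^sub>0 < R \<and> ereal R < r\<^sub>G \<and> R powr \<theta> / 2 \<le> r \<longrightarrow>
        (\<forall>x \<in> gball V E v\<^sub>0 (6 * R).
          (\<Sum>\<^sub>\<infinity>y\<in>{y \<in> V. real (gdist E x y) > r}. w x y / real (gdist E x y) powr (d + \<alpha>))
            \<le> C * r powr (- \<alpha>))"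
      and Rr: "R\<^sub>1 < R \<and> ereal R < r\<^sub>G / ereal (2 * c_star c\<^sub>G d) \<and> R powr \<delta> \<le> r \<and> r \<le> R"
    interpret weighted_graph V E \<mu> w d \<alpha> r\<^sub>G c\<^sub>G c\<^sub>M by fact
    have R: "1 < R" "R\<^sub>0 < R" "R\<^sub>b \<le> R" "R\<^sub>e \<le> R" "R\<^sub>d < R" and r: "R powr \<delta> \<le> r" "r \<le> R"
      using Rr R1 by auto
    have cR: "ereal (2 * cst * R) < r\<^sub>G"
    proof -
      have "0 < ereal (2 * cst)" using cs by simp
      then have "ereal (2 * cst) * ereal R < r\<^sub>G"
        using Rr by (subst ereal_less_divide_pos[symmetric]) (auto simp: cst_def)
      then show ?thesis by simp
    qed
    have small: "ereal \<rho> < r\<^sub>G" if "\<rho> \<le> 2 * cst * R" for \<rho>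
      using that cR by (meson ereal_less_eq(3) le_less_trans)
    have cR_ge: "8 * R \<le> cst * R" using cs R by simp
    have R_rG: "ereal R < r\<^sub>G" "ereal (2 * R) < r\<^sub>G" "ereal (cst * R) < r\<^sub>G"
      using cR_ge R by (auto intro!: small)
    have r\<theta>: "R powr \<theta> \<le> r" 
    proof -
      have "R powr \<theta> \<le> R powr \<delta>" using R \<delta> by (intro powr_mono) auto
      then show ?thesis using r by linarith
    qed
    have r1: "1 \<le> r" using ge_one_powr_ge_zero[of R \<delta>] R r \<delta> assms by simp
    have d1: "1 \<le> d"
    proof (rule ccontr)
      assume "\<not> 1 \<le> d"
      then have "r\<^sub>G \<le> ereal R\<^sub>d" using R\<^sub>d[OF _ WG v] by simp
      then show False using R_rG(1) R(5) by (meson ereal_less_eq(3) leD le_less_trans less_imp_le order_trans)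
    qed
    have near: "(\<Sum>z\<in>gball V E y \<rho>. w y z / real (gdist E y z) powr (d + \<alpha> - 2)) \<le> C * \<rho> powr (2 - \<alpha>)"
      and thick: "c\<^sub>0 * measure \<mu> (gball V E y \<rho>) \<le> measure \<mu> (wball V E w y y \<rho>)"
      and inv: "(\<Sum>z\<in>wball V E w y y (c_star c\<^sub>G d * \<rho>). inverse (w y z)) \<le> C * \<rho> powr d"
      if "R\<^sub>0 < R" "ereal R < r\<^sub>G" "R powr \<theta> / 2 \<le> \<rho>" "\<rho> \<le> 2 * R" "y \<in> gball V E v\<^sub>0 (6 * R)" for R \<rho> y
      using H1[rule_format, of R \<rho>] that by auto
    have far: "(\<Sum>\<^sub>\<infinity>z\<in>{z \<in> V. real (gdist E y z) > \<rho>}. w y z / real (gdist E y z) powr (d + \<alpha>)) \<le> C * \<rho> powr (- \<alpha>)"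
      if "R powr \<theta> / 2 \<le> \<rho>" "y \<in> gball V E v\<^sub>0 (6 * R)" for \<rho> y
      using H2 R(2) R_rG(1) that by blast
    define s\<^sub>1 where "s\<^sub>1 = r powr (\<theta>\<^sub>2 * \<alpha>)"
    have burn: "c\<^sub>M * exp (- (s\<^sub>1 / 2) / (A * (R powr \<theta>) powr \<alpha>)) \<le> 2 * A * (R powr \<theta>) powr (- d)"
    proof -
      define q where "q = (R powr \<theta>) powr \<alpha>"
      have q: "0 < q" using R by (simp add: q_def)
      have "R powr \<eta> * q = R powr (\<eta> + \<theta> * \<alpha>)" by (simp add: q_def powr_powr powr_add)
      also have "\<eta> + \<theta> * \<alpha> = \<delta> * (\<theta>\<^sub>2 * \<alpha>)" by (simp add: \<eta>_def algebra_simps)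
      also have "R powr (\<delta> * (\<theta>\<^sub>2 * \<alpha>)) = (R powr \<delta>) powr (\<theta>\<^sub>2 * \<alpha>)" by (simp add: powr_powr)
      also have "\<dots> \<le> s\<^sub>1" unfolding s\<^sub>1_def using r \<theta>\<^sub>2 alpha by (intro powr_mono2) auto
      finally have "R powr \<eta> / (2 * A) \<le> (s\<^sub>1 / 2) / (A * q)" using q A0 by (simp add: field_simps)
      then have "c\<^sub>M * exp (- (s\<^sub>1 / 2) / (A * q)) * R powr (\<theta> * d) \<le> c\<^sub>M * exp (- (R powr \<eta> / (2 * A))) * R powr (\<theta> * d)"
        using c_M by (intro mult_right_mono mult_left_mono) auto
      also have "\<dots> \<le> 2 * A" by (rule R\<^sub>b[OF R(3)])
      finally have "c\<^sub>M * exp (- (s\<^sub>1 / 2) / (A * q)) \<le> 2 * A / R powr (\<theta> * d)"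
        using R by (subst pos_le_divide_eq) auto
      also have "\<dots> = 2 * A * (R powr \<theta>) powr (- d)" by (simp add: powr_powr powr_minus divide_inverse)
      finally show ?thesis by (simp add: q_def)
    qed
    have s1: "0 < s\<^sub>1 / 2" "2 * (s\<^sub>1 / 2) \<le> s\<^sub>1" using r1 by (auto simp: s\<^sub>1_def)
    define T where "T = r powr \<alpha>"
    have T0: "0 < T" using r1 by (simp add: T_def)
    have survive: "\<exists>D\<in>sets (P x). D \<subseteq> {\<omega> \<in> space (P x). ennreal t < exit_time X (gball V E x r) \<omega>} \<and>
        1 - measure (P x) D \<le> C\<^sub>1 * (t / T) powr (1/2) * max 1 (ln (T / t))"
      if x: "x \<in> gball V E v\<^sub>0 (2 * R)" and t: "r powr (\<theta>' * \<alpha>) \<le> t" "t \<le> T" for x t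
    proof -
      have "r powr (\<theta>\<^sub>2 * \<alpha>) \<le> r powr (\<theta>' * \<alpha>)"
        using r1 \<theta>\<^sub>2 alpha by (intro powr_mono) auto
      then have t1: "s\<^sub>1 \<le> t" using t by (simp add: s\<^sub>1_def)
      obtain D where D: "D \<in> sets (P x)" "D \<subseteq> {\<omega> \<in> space (P x). ennreal t < exit_time X (gball V E x r) \<omega>}"
        "1 - measure (P x) D \<le> sqrt (s\<^sub>1 / r powr \<alpha>) * (ln (1 + c\<^sub>M * r powr d) + 2 * k) +
          sqrt (t / r powr \<alpha>) * (ln (1 + nash_constant A \<alpha> d) + 1 + d / \<alpha> * ln (r powr \<alpha> / t) + 2 * (d / \<alpha>) + 2 * k)
          + k * (t / r powr \<alpha>)"
        using exit_probability_at_scale[OF X v x less_imp_le[OF R(1)] R_rG(2) \<open>0 < \<theta>\<close> \<open>\<theta> < 1\<close> r\<theta> r(2) _ \<open>C > 0\<close>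
            near[OF R(2) R_rG(1)] thick[OF R(2) R_rG(1)] inv[OF R(2) R_rG(1)] far A_def burn s1 t1 t(2)[unfolded T_def] k_def]
          \<open>1/2 < c\<^sub>0\<close> by auto
      note D(3)
      also have "sqrt (s\<^sub>1 / r powr \<alpha>) * (ln (1 + c\<^sub>M * r powr d) + 2 * k) +
          sqrt (t / r powr \<alpha>) * (ln (1 + nash_constant A \<alpha> d) + 1 + d / \<alpha> * ln (r powr \<alpha> / t) + 2 * (d / \<alpha>) + 2 * k)
          + k * (t / r powr \<alpha>) \<le> Ca * (t / r powr \<alpha>) powr (1/2) * max 1 (ln (r powr \<alpha> / t))"
        unfolding s\<^sub>1_def K_def[symmetric] Ca_def \<epsilon>_def
        by (rule exit_bound_simplified[OF \<open>0 < d\<close> \<open>0 < \<alpha>\<close> k0 K0 c_M \<theta>\<^sub>2(2) r1 t[unfolded T_def]])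
      also have "\<dots> \<le> C\<^sub>1 * (t / r powr \<alpha>) powr (1/2) * max 1 (ln (r powr \<alpha> / t))"
        using C1 by (intro mult_right_mono) auto
      finally show ?thesis using D(1,2) by (auto simp: T_def)
    qed
    have prob: "prob_space (P x)" if "x \<in> gball V E v\<^sub>0 (2 * R)" for x
      using X that unfolding conductance_process_def gball_def by blast
    have complement: "measure (P x) {\<omega> \<in> space (P x). exit_time X B \<omega> \<le> ennreal t} \<le> 1 - measure (P x) D"
      if "prob_space (P x)" "D \<in> sets (P x)" "D \<subseteq> {\<omega> \<in> space (P x). ennreal t < exit_time X B \<omega>}" for x B t D
    proof -
      interpret prob_space "P x" by fact
      have "measure (P x) {\<omega> \<in> space (P x). exit_time X B \<omega> \<le> ennreal t} \<le> measure (P x) (space (P x) - D)"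
        using that(2,3) by (intro finite_measure_mono) (auto dest: leD)
      then show ?thesis using prob_compl[OF that(2)] by simp
    qed
    define t\<^sub>0 where "t\<^sub>0 = C\<^sub>0 * T"
    have t0: "r powr (\<theta>' * \<alpha>) \<le> t\<^sub>0" "t\<^sub>0 \<le> T"
    proof -
      show "t\<^sub>0 \<le> T" unfolding t\<^sub>0_def using C0 T0 by simp
      define \<beta> where "\<beta> = (1 - \<theta>') * \<alpha>"
      have \<beta>: "0 < \<beta>" "0 < \<delta> * \<beta>" using assms \<delta> by (auto simp: \<beta>_def)
      have y: "0 < (16 * C\<^sub>1) ^ 4" using C1 by simp
      have "(16 * C\<^sub>1) ^ 4 = R\<^sub>e powr (\<delta> * \<beta>)"
      proof -
        have "R\<^sub>e = ((16 * C\<^sub>1) ^ 4) powr (1 / (\<delta> * \<beta>))" by (simp add: R\<^sub>e_def \<beta>_def mult.assoc)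
        then show ?thesis using \<beta> y by (auto simp: powr_powr)
      qed
      also have "\<dots> \<le> R powr (\<delta> * \<beta>)" using R \<beta> by (intro powr_mono2) (auto simp: R\<^sub>e_def)
      also have "\<dots> = (R powr \<delta>) powr \<beta>" by (simp add: powr_powr)
      also have "\<dots> \<le> r powr \<beta>" using r \<beta> by (intro powr_mono2) auto
      finally have "(16 * C\<^sub>1) ^ 4 * r powr (\<theta>' * \<alpha>) \<le> r powr \<beta> * r powr (\<theta>' * \<alpha>)" by (intro mult_right_mono) auto
      also have "\<dots> = T" by (simp add: T_def \<beta>_def powr_add[symmetric] algebra_simps)
      finally show "r powr (\<theta>' * \<alpha>) \<le> t\<^sub>0" using y by (simp add: t\<^sub>0_def C\<^sub>0_def field_simps)
    qed
    have survive0: "\<exists>D\<in>sets (P x). D \<subseteq> {\<omega> \<in> space (P x). ennreal t\<^sub>0 < exit_time X (gball V E x r) \<omega>} \<and>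
        1 - measure (P x) D \<le> 1 / 4" if x: "x \<in> gball V E v\<^sub>0 (2 * R)" for x
    proof -
      have "t\<^sub>0 / T = 1 / (16 * C\<^sub>1) ^ 4" "T / t\<^sub>0 = (16 * C\<^sub>1) ^ 4"
        using T0 by (auto simp: t\<^sub>0_def C\<^sub>0_def)
      then have "C\<^sub>1 * (t\<^sub>0 / T) powr (1/2) * max 1 (ln (T / t\<^sub>0)) \<le> 1 / 4"
        using small_time_constant[OF C1(1)] by (simp only:)
      moreover obtain D where "D \<in> sets (P x)" "D \<subseteq> {\<omega> \<in> space (P x). ennreal t\<^sub>0 < exit_time X (gball V E x r) \<omega>}"
        "1 - measure (P x) D \<le> C\<^sub>1 * (t\<^sub>0 / T) powr (1/2) * max 1 (ln (T / t\<^sub>0))"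
        using survive[OF x t0] by blast
      ultimately show ?thesis by (intro bexI[of _ D] conjI) (assumption | linarith)+
    qed
    show "\<forall>x \<in> gball V E v\<^sub>0 (2 * R).
          measure (P x) {\<omega> \<in> space (P x). exit_time X (gball V E x r) \<omega> \<le> ennreal (C\<^sub>0 * r powr \<alpha>)} \<le> 1/4"
    proof
      fix x assume x: "x \<in> gball V E v\<^sub>0 (2 * R)"
      then show "measure (P x) {\<omega> \<in> space (P x). exit_time X (gball V E x r) \<omega> \<le> ennreal (C\<^sub>0 * r powr \<alpha>)} \<le> 1/4"
        using survive0[OF x] complement[OF prob[OF x]] unfolding t\<^sub>0_def T_def by (meson order_trans)
    qed
    show "\<forall>x \<in> gball V E v\<^sub>0 (2 * R). \<forall>t \<ge> r powr (\<theta>' * \<alpha>).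
          measure (P x) {\<omega> \<in> space (P x). exit_time X (gball V E x r) \<omega> \<le> ennreal t}
            \<le> C\<^sub>1 * (t / r powr \<alpha>) powr (1/2) * max 1 (ln (r powr \<alpha> / t))"
    proof (intro ballI allI impI)
      fix x t assume x: "x \<in> gball V E v\<^sub>0 (2 * R)" and t: "r powr (\<theta>' * \<alpha>) \<le> t"
      interpret prob_space "P x" by (rule prob[OF x])
      show "measure (P x) {\<omega> \<in> space (P x). exit_time X (gball V E x r) \<omega> \<le> ennreal t}
            \<le> C\<^sub>1 * (t / r powr \<alpha>) powr (1/2) * max 1 (ln (r powr \<alpha> / t))"
      proof (cases "t \<le> T")
        case True
        then show ?thesis
          using survive[OF x t True] complement[OF prob[OF x]] unfolding T_def by (meson order_trans)
      next
        case False
        then have "1 \<le> (t / T) powr (1/2)" using T0 by (intro ge_one_powr_ge_zero) auto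
        then have "1 * 1 * 1 \<le> C\<^sub>1 * (t / T) powr (1/2) * max 1 (ln (T / t))"
          using C1 by (intro mult_mono) auto
        then show ?thesis unfolding T_def[symmetric] by (intro order_trans[OF prob_le_1]) simp
      qed
    qed
    show "\<forall>x \<in> gball V E v\<^sub>0 (2 * R).
          ennreal (C\<^sub>2 * r powr \<alpha>) \<le> (\<integral>\<^sup>+\<omega>. exit_time X (gball V E x r) \<omega> \<partial>P x) \<and>
          (\<integral>\<^sup>+\<omega>. exit_time X (gball V E x r) \<omega> \<partial>P x) \<le> ennreal (C\<^sub>1 * r powr \<alpha>)"
    proof (intro ballI conjI)
      fix x assume x: "x \<in> gball V E v\<^sub>0 (2 * R)"
      interpret prob_space "P x" by (rule prob[OF x])
      obtain D where D: "D \<in> sets (P x)" "D \<subseteq> {\<omega> \<in> space (P x). ennreal t\<^sub>0 < exit_time X (gball V E x r) \<omega>}"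
        "1 - measure (P x) D \<le> 1 / 4" using survive0[OF x] by blast
      have t00: "0 \<le> t\<^sub>0" using C0 T0 by (simp add: t\<^sub>0_def)
      have "ennreal (C\<^sub>2 * r powr \<alpha>) = ennreal (t\<^sub>0 * (3 / 4))" by (simp add: C\<^sub>2_def t\<^sub>0_def T_def mult_ac)
      also have "\<dots> \<le> ennreal (t\<^sub>0 * measure (P x) D)" using D(3) t00 by (intro ennreal_leI mult_left_mono) auto
      also have "\<dots> = (\<integral>\<^sup>+\<omega>. ennreal t\<^sub>0 * indicator D \<omega> \<partial>P x)"
        using D(1) t00 by (simp add: nn_integral_cmult_indicator emeasure_eq_measure ennreal_mult)
      also have "\<dots> \<le> (\<integral>\<^sup>+\<omega>. exit_time X (gball V E x r) \<omega> \<partial>P x)"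
        using D(2) by (intro nn_integral_mono) (auto simp: indicator_def less_imp_le)
      finally show "ennreal (C\<^sub>2 * r powr \<alpha>) \<le> (\<integral>\<^sup>+\<omega>. exit_time X (gball V E x r) \<omega> \<partial>P x)" .
      have "(\<integral>\<^sup>+\<omega>. exit_time X (gball V E x r) \<omega> \<partial>P x) \<le> ennreal (2 / \<kappa> * r powr \<alpha>)"
      proof (rule mean_exit_time_at_scale[OF X v x less_imp_le[OF R(1)] cR[unfolded cst_def] \<open>0 < \<theta>\<close> \<open>\<theta> < 1\<close> r\<theta> r(2) d1
            \<open>1/2 < c\<^sub>0\<close> \<open>C > 0\<close> _ _ \<kappa>_def])
        fix \<rho> y
        have "R\<^sub>0 < cst * R" using cR_ge R by linarith
        then show "c\<^sub>0 * measure \<mu> (gball V E y \<rho>) \<le> measure \<mu> (wball V E w y y \<rho>)"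
          if "(c_star c\<^sub>G d * R) powr \<theta> / 2 \<le> \<rho>" "\<rho> \<le> 2 * (c_star c\<^sub>G d * R)" "y \<in> gball V E v\<^sub>0 (6 * (c_star c\<^sub>G d * R))"
          using thick[of "cst * R" \<rho> y] R_rG(3) that by (simp add: cst_def)
        show "(\<Sum>z\<in>wball V E w y y (c_star c\<^sub>G d * \<rho>). inverse (w y z)) \<le> C * \<rho> powr d"
          if "R powr \<theta> / 2 \<le> \<rho>" "\<rho> \<le> 2 * R" "y \<in> gball V E v\<^sub>0 (6 * R)"
          by (rule inv[OF R(2) R_rG(1) that])
      qed
      also have "\<dots> \<le> ennreal (C\<^sub>1 * r powr \<alpha>)" using C1 by (intro ennreal_leI mult_right_mono) auto
      finally show "(\<integral>\<^sup>+\<omega>. exit_time X (gball V E x r) \<omega> \<partial>P x) \<le> ennreal (C\<^sub>1 * r powr \<alpha>)" .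
    qed
  qed
qed

end
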